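(* Let $n \geq 6$ and $k \geq 1$ be integers. Let $H$ be a graph of order $n$ with exactly $k$ connected components, each of which is a cycle of even length at least $6$. Let $G$ be a finite simple bipartite graph with bipartition $(X,Y)$ such that $|X| = |Y| \geq n/2$. If the minimum degree of $G$ satisfies $\delta(G) \geq n/2 - k + 1$, then $G$ contains a subdivision of $H$ as a subgraph.
   Context: All graphs are finite and simple. A subdivision of a graph $H$ is any graph obtainable from $H$ by a sequence of edge subdivisions, where subdividing an edge $uv$ means replacing it by a path $u w v$ through a new vertex $w$. Thus a subdivision of a disjoint union of cycles $C_1,\dots,C_k$ is a collection of vertex-disjoint cycles $C_1^*,\dots,C_k^*$ with $|C_i^*| \geq |C_i|$ for each $i$. "$G$ contains a subdivision of $H$" means some subgraph of $G$ is isomorphic to a subdivision of $H$. $\delta(G)$ denotes the minimum degree of $G$. *)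

theory Defs
  imports "Graph_Theory.Graph_Theory"
begin

text \<open>
  A finite simple graph is a \<^locale>\<open>pair_graph\<close>: a finite, loop-free, symmetric set of arcs, in which
  each edge is represented by its two orientations.
\<close>

text \<open>A cycle graph only for \<^term>\<open>m \<ge> (3::nat)\<close>.\<close>

definition cycle_graph :: "nat \<Rightarrow> nat pair_pre_digraph" where
  "cycle_graph m = \<lparr> pverts = {..<m},
     parcs = {(i, j). i < m \<and> j < m \<and> (j = Suc i mod m \<or> i = Suc j mod m)} \<rparr>"

definition bipartition :: "'a pair_pre_digraph \<Rightarrow> 'a set \<Rightarrow> 'a set \<Rightarrow> bool" where
  "bipartition G X Y \<longleftrightarrow>
     X \<union> Y = pverts G \<and> X \<inter> Y = {} \<and> parcs G \<subseteq> X \<times> Y \<union> Y \<times> X"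

text \<open>By symmetry the out-degree of a vertex is its degree. Meaningful for nonempty finite graphs.\<close>

definition min_degree :: "'a pair_pre_digraph \<Rightarrow> nat" where
  "min_degree G = Min (out_degree (with_proj G) ` pverts G)"

text \<open>
  The constant \<^const>\<open>subdivision\<close> relates graphs over one vertex type, while the vertex type of
  \<^term>\<open>H\<close> may be too small to hold the subdividing vertices. So we first move to an isomorphic
  copy \<^term>\<open>H'\<close> of \<^term>\<open>H\<close> over the vertex type of \<^term>\<open>G\<close> and subdivide that; up to isomorphism
  this gives the same subgraphs as subdividing \<^term>\<open>H\<close> first.
\<close>

definition contains_subdivision :: "'a pair_pre_digraph \<Rightarrow> 'b pair_pre_digraph \<Rightarrow> bool" where
  "contains_subdivision G H \<longleftrightarrow>
     (\<exists>(H' :: 'a pair_pre_digraph) (S :: 'a pair_pre_digraph).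
        digraph_iso (with_proj H) (with_proj H') \<and>
        subdivision_pair H' S \<and>
        subgraph (with_proj S) (with_proj G))"

end

theory Submission
  imports Defs
begin

text \<open>
  Write the cycle lengths as \<open>2 * h j\<close>; every vertex of \<open>G\<close> has degree at least \<open>1 + (\<Sum>j. h j - 1)\<close>.
  Induct on the number of non-edges between the colour classes. After adding one edge the cycles exist,
  and at most one of them uses that edge, so it suffices to complete a family lacking a single cycle, of
  half-length \<open>h0\<close>. Choose the family with the fewest vertices on its cycles, then with a longest path in
  the rest \<open>R\<close>, then with the most edges inside the vertex sets of the cycles. If \<open>R\<close> contains no cycle
  of length at least \<open>2 * h0\<close>, the ends of the path have fewer than \<open>h0\<close> neighbours in \<open>R\<close>, so some cycle
  of length exactly \<open>2 * h j\<close> contains all but at most one of the possible neighbours of the two ends.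
  Exchanging vertices with such a cycle would lengthen the path unless the path covers \<open>R\<close>. Once it does,
  consider its two ends, their neighbours on the path and two vertices that can be exchanged for the ends:
  by the degree condition these six vertices have more than \<open>6 * (h j - 1)\<close> neighbours on some cycle, and
  then trading one or two vertices of that cycle closes the path into the missing cycle. Hexagons need the
  third extremality condition and a finite count.
\<close>

subsection \<open>Cycles in bipartite graphs\<close>

text \<open>With \<open>h j\<close> the half-lengths, \<open>n/2 - k\<close> is the sum of all
  \<open>h j - 1\<close>. Setting one cycle aside turns the degree bound into \<open>h0\<close> plus
  the sum over the others, so a vertex with fewer than \<open>h0\<close> neighbours in the rest has
  on average more than \<open>h j - 1\<close> neighbours on a cycle. Minimality of the family forces
  such an excess onto cycles of exact length: a longer cycle with \<open>h j\<close> neighbours of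
  an outside vertex could be shortened through it. The obstacle is that the cycle found for the two
  ends of the path is already used to produce their substitutes. The exchange that closes the path
  must take place at a different cycle, so that both can be carried out together. This is why six
  vertices are counted: four have at most \<open>h0 - 1\<close> neighbours in the rest and two have
  at most \<open>h0\<close>, so their surplus on the cycles is at least 4, while the first cycle
  absorbs at most 3. On the second cycle, counting blocked positions bounds the six degrees by 14/3
  of the half-length. That suffices from half-length 4 on, but for a hexagon it gives 14 where 12 is
  needed.\<close>

definition gpath :: "('a \<Rightarrow> 'a \<Rightarrow> bool) \<Rightarrow> 'a list \<Rightarrow> bool" where
  "gpath adj xs \<longleftrightarrow> xs \<noteq> [] \<and> distinct xs \<and> successively adj xs"

definition gcycle :: "('a \<Rightarrow> 'a \<Rightarrow> bool) \<Rightarrow> 'a list \<Rightarrow> bool" where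
  "gcycle adj xs \<longleftrightarrow> gpath adj xs \<and> 3 \<le> length xs \<and> adj (last xs) (hd xs)"

text \<open>Families of cycles are kept as families of vertex sets: an exchange may change the
  cyclic order, and only the sets matter for disjointness, length and degrees.\<close>

definition hamiltonian :: "('a \<Rightarrow> 'a \<Rightarrow> bool) \<Rightarrow> 'a set \<Rightarrow> bool" where
  "hamiltonian adj S \<longleftrightarrow> (\<exists>xs. gcycle adj xs \<and> set xs = S)"

definition ndeg :: "('a \<Rightarrow> 'a \<Rightarrow> bool) \<Rightarrow> 'a set \<Rightarrow> 'a \<Rightarrow> nat" where
  "ndeg adj S v = card {w \<in> S. adj v w}"

lemma same_parity_card:
  assumes "finite N" "\<And>i. i \<in> N \<Longrightarrow> m \<le> i \<and> i \<le> n \<and> even (i - m)"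
  shows "card N \<le> (n - m) div 2 + 1"
proof -
  have "inj_on (\<lambda>i. (i - m) div 2) N"
  proof (rule inj_onI)
    fix i j assume ij: "i \<in> N" "j \<in> N" "(i - m) div 2 = (j - m) div 2"
    then have "i - m = j - m"
      using assms(2)[of i] assms(2)[of j] by (metis dvd_mult_div_cancel)
    then show "i = j"
      using assms(2)[OF ij(1)] assms(2)[OF ij(2)] by linarith
  qed
  moreover have "(\<lambda>i. (i - m) div 2) ` N \<subseteq> {0..(n - m) div 2}"
    using assms(2) by (auto intro!: div_le_mono diff_le_mono)
  ultimately show ?thesis
    using card_inj_on_le[of _ N "{0..(n - m) div 2}"] by fastforce
qed

locale coloured_graph =
  fixes adj :: "'a \<Rightarrow> 'a \<Rightarrow> bool" and c :: "'a \<Rightarrow> bool"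
  assumes adj_sym: "adj u v \<Longrightarrow> adj v u"
    and adj_colour: "adj u v \<Longrightarrow> c u \<noteq> c v"
begin

abbreviation "path \<equiv> gpath adj"
abbreviation "cyc \<equiv> gcycle adj"
abbreviation "ham \<equiv> hamiltonian adj"
abbreviation "deg \<equiv> ndeg adj"

lemma adj_commute: "adj u v \<longleftrightarrow> adj v u"
  using adj_sym by blast

lemma adj_irrefl: "\<not> adj u u"
  using adj_colour by blast

lemma path_append_iff:
  assumes "xs \<noteq> []" "ys \<noteq> []"
  shows "path (xs @ ys) \<longleftrightarrow>
    path xs \<and> path ys \<and> set xs \<inter> set ys = {} \<and> adj (last xs) (hd ys)"
  using assms by (auto simp: gpath_def successively_append_iff)

lemma path_Cons_iff:
  "ys \<noteq> [] \<Longrightarrow> path (x # ys) \<longleftrightarrow> path ys \<and> x \<notin> set ys \<and> adj x (hd ys)"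
  by (auto simp: gpath_def successively_Cons)

lemma path_singleton: "path [x]"
  by (simp add: gpath_def)

lemma path_snoc_iff:
  "xs \<noteq> [] \<Longrightarrow> path (xs @ [y]) \<longleftrightarrow> path xs \<and> y \<notin> set xs \<and> adj (last xs) y"
  by (auto simp: path_append_iff path_singleton)

lemma path_rev: "path xs \<Longrightarrow> path (rev xs)"
proof -
  have "(\<lambda>x y. adj y x) = adj"
    by (auto simp: fun_eq_iff adj_commute)
  then show "path xs \<Longrightarrow> path (rev xs)"
    by (metis distinct_rev gpath_def rev_is_Nil_conv successively_rev)
qed

text \<open>This form isolates one vertex: an outside vertex adjacent to both ends of
  \<open>vs\<close> can take the place of \<open>v\<close>.\<close>

lemma cyc_Cons_iff:
  "cyc (v # vs) \<longleftrightarrow> 2 \<le> length vs \<and> path vs \<and> v \<notin> set vs \<and> adj v (hd vs) \<and> adj v (last vs)"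
proof (cases vs)
  case (Cons w ws)
  then show ?thesis
    using adj_commute[of v] unfolding gcycle_def by (subst path_Cons_iff) auto
qed (simp add: gcycle_def)

lemma cyc_swap:
  assumes "cyc (xs @ ys)"
  shows "cyc (ys @ xs)"
proof (cases "xs = [] \<or> ys = []")
  case False
  then show ?thesis
    using assms by (auto simp: gcycle_def path_append_iff)
qed (use assms in auto)

lemma cyc_rotate:
  assumes "cyc xs"
  shows "cyc (rotate n xs)"
  using assms cyc_swap[of "take (n mod length xs) xs" "drop (n mod length xs) xs"]
  by (simp add: rotate_drop_take)

lemma ham_through:
  assumes "ham S" "v \<in> S"
  obtains vs where "cyc (v # vs)" "set (v # vs) = S"
proof -
  obtain xs where xs: "cyc xs" "set xs = S"
    using assms unfolding hamiltonian_def by blast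
  obtain ys zs where "xs = ys @ v # zs"
    using assms xs split_list by metis
  then show thesis
    using that[of "zs @ ys"] xs cyc_swap[of ys "v # zs"] by auto
qed

lemma hamI: "cyc xs \<Longrightarrow> ham (set xs)"
  unfolding hamiltonian_def by blast

lemma ham_finite: "ham S \<Longrightarrow> finite S"
  unfolding hamiltonian_def by auto

lemma path_colour:
  assumes "path xs" "i < length xs"
  shows "c (xs ! i) \<longleftrightarrow> (c (hd xs) \<longleftrightarrow> even i)"
  using assms(2)
proof (induction i)
  case 0
  then show ?case by (simp add: hd_conv_nth)
next
  case (Suc i)
  then have "adj (xs ! i) (xs ! Suc i)"
    using assms(1) by (auto simp: gpath_def successively_conv_nth)
  then show ?case
    using Suc adj_colour by auto
qed

lemma path_colour_count:
  assumes "path xs"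
  shows "card {v \<in> set xs. c v = k} =
    (if c (hd xs) = k then (length xs + 1) div 2 else length xs div 2)"
  using assms
proof (induction xs)
  case (Cons x xs)
  show ?case
  proof (cases "xs = []")
    case False
    then have *: "path xs" "x \<notin> set xs" "adj x (hd xs)"
      using Cons.prems by (auto simp: path_Cons_iff)
    have "{v \<in> set (x # xs). c v = k} = (if c x = k then {x} else {}) \<union> {v \<in> set xs. c v = k}"
      by auto
    then show ?thesis
      using Cons.IH[OF *(1)] * adj_colour[OF *(3)] by auto
  next
    case True
    then have "{v \<in> set (x # xs). c v = k} = (if c x = k then {x} else {})"
      by auto
    then show ?thesis using True by auto
  qed
qed (simp add: gpath_def)

lemma cyc_even: "cyc xs \<Longrightarrow> even (length xs)"
proof -
  assume *: "cyc xs"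
  then have "xs \<noteq> []" by (auto simp: gcycle_def)
  then have "c (last xs) \<longleftrightarrow> (c (hd xs) \<longleftrightarrow> even (length xs - 1))"
    using path_colour[of xs "length xs - 1"] * by (auto simp: gcycle_def last_conv_nth)
  then show "even (length xs)"
    using * \<open>xs \<noteq> []\<close> adj_colour[of "last xs" "hd xs"] by (cases xs) (auto simp: gcycle_def)
qed

lemma ham_balanced:
  assumes "ham S"
  shows "2 * card {v \<in> S. c v = k} = card S"
proof -
  obtain xs where xs: "cyc xs" "set xs = S"
    using assms unfolding hamiltonian_def by blast
  then have "card S = length xs"
    by (auto simp: gcycle_def gpath_def distinct_card)
  then show ?thesis
    using path_colour_count[of xs k] cyc_even[OF xs(1)] xs by (auto simp: gcycle_def)
qed

lemma deg_le_ham: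
  assumes "ham S"
  shows "2 * deg S v \<le> card S"
proof -
  have "deg S v \<le> card {w \<in> S. c w = (\<not> c v)}"
    unfolding ndeg_def using ham_finite[OF assms] adj_colour by (intro card_mono) auto
  then show ?thesis
    using ham_balanced[OF assms, of "\<not> c v"] by linarith
qed

definition seg :: "'a list \<Rightarrow> nat \<Rightarrow> nat \<Rightarrow> 'a list" where
  "seg xs i j = take (Suc j - i) (drop i xs)"

lemma seg_simps:
  assumes "i \<le> j" "j < length xs"
  shows "length (seg xs i j) = Suc j - i" "hd (seg xs i j) = xs ! i" "last (seg xs i j) = xs ! j"
    "set (seg xs i j) \<subseteq> set xs" "seg xs i j \<noteq> []"
proof -
  show 1: "length (seg xs i j) = Suc j - i"
    using assms by (simp add: seg_def)
  then show 2: "seg xs i j \<noteq> []"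
    using assms by auto
  show "hd (seg xs i j) = xs ! i"
    using assms by (simp add: seg_def hd_drop_conv_nth)
  show "last (seg xs i j) = xs ! j"
    using assms 1 2 by (simp add: last_conv_nth) (simp add: seg_def)
  show "set (seg xs i j) \<subseteq> set xs"
    unfolding seg_def by (meson in_set_dropD in_set_takeD subsetI)
qed

lemma path_seg:
  assumes "path xs" "i \<le> j" "j < length xs"
  shows "path (seg xs i j)"
proof -
  have "successively adj (drop i xs)"
    using assms(1) successively_append_iff[of adj "take i xs" "drop i xs"]
    by (auto simp: gpath_def)
  then have "successively adj (seg xs i j)"
    using successively_append_iff[of adj "seg xs i j" "drop (Suc j - i) (drop i xs)"]
    unfolding seg_def append_take_drop_id by blast
  then show ?thesis
    using assms seg_simps(5)[OF assms(2,3)] by (simp add: gpath_def seg_def)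
qed

lemma cyc_from_path:
  assumes "path vs" "v \<notin> set vs" "i < j" "j < length vs" "adj v (vs ! i)" "adj v (vs ! j)"
  shows "cyc (v # seg vs i j)"
  using assms path_seg[of vs i j] seg_simps[of i j vs]
  by (auto simp: cyc_Cons_iff)

lemma nbr_positions:
  assumes "path vs"
  shows "card {i. i < length vs \<and> adj v (vs ! i)} = deg (set vs) v"
proof -
  have "bij_betw (\<lambda>i. vs ! i) {i. i < length vs \<and> adj v (vs ! i)} {w \<in> set vs. adj v w}"
    using assms by (auto simp: bij_betw_def inj_on_def gpath_def nth_eq_iff_index_eq in_set_conv_nth)
  then show ?thesis
    unfolding ndeg_def by (rule bij_betw_same_card)
qed

lemma nbr_parity:
  assumes "path vs" "i < length vs" "j < length vs" "i \<le> j" "c (vs ! i) = c (vs ! j)"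
  shows "even (j - i)"
  using path_colour[OF assms(1,2)] path_colour[OF assms(1,3)] assms(4,5) by auto

text \<open>All neighbours of \<open>v\<close> have one colour, so their positions on the path have
  one parity. The first and the last of \<open>a\<close> neighbours are thus at least
  \<open>2 * (a - 1)\<close> apart, and the segment between them closes through
  \<open>v\<close>.\<close>

lemma ham_from_neighbours:
  assumes "path vs" "v \<notin> set vs" "a \<le> deg (set vs) v" "2 \<le> a"
  shows "\<exists>T. ham T \<and> T \<subseteq> insert v (set vs) \<and> v \<in> T \<and> 2 * a \<le> card T"
proof -
  define N where "N = {i. i < length vs \<and> adj v (vs ! i)}"
  have fin: "finite N" and card: "a \<le> card N"
    using nbr_positions[OF assms(1), of v] assms(3) by (auto simp: N_def)
  then have ne: "N \<noteq> {}" using assms(4) by auto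
  define i j where "i = Min N" and "j = Max N"
  have ij: "i \<in> N" "j \<in> N" "\<And>k. k \<in> N \<Longrightarrow> i \<le> k \<and> k \<le> j"
    using fin ne by (auto simp: i_def j_def)
  have "card N \<le> (j - i) div 2 + 1"
  proof (rule same_parity_card[OF fin])
    fix k assume k: "k \<in> N"
    then have "even (k - i)"
      using ij(1) ij(3)[OF k] adj_colour[of v "vs ! i"] adj_colour[of v "vs ! k"]
      by (intro nbr_parity[OF assms(1)]) (auto simp: N_def)
    then show "i \<le> k \<and> k \<le> j \<and> even (k - i)" using ij(3)[OF k] by auto
  qed
  then have len: "2 * a \<le> j - i + 2" using card by linarith
  then have "i < j" using assms(4) by linarith
  have cyc: "cyc (v # seg vs i j)"
    using ij \<open>i < j\<close> by (intro cyc_from_path[OF assms(1,2)]) (auto simp: N_def)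
  have "card (set (v # seg vs i j)) = length (v # seg vs i j)"
    using cyc by (intro distinct_card) (auto simp: gcycle_def gpath_def)
  then show ?thesis
    using cyc len ij \<open>i < j\<close> seg_simps[of i j vs] hamI[OF cyc] by (intro exI[of _ "set (v # seg vs i j)"]) (auto simp: N_def)
qed

text \<open>Delete from the cycle one vertex \<open>w\<close> of the colour not taken by \<open>v\<close>, and the two cycle
  neighbours of \<open>w\<close>; what remains is a path that still contains \<open>a\<close> neighbours of \<open>v\<close>.\<close>

lemma shorten_cycle:
  assumes "ham S" "v \<notin> S" "2 * a < card S" "2 \<le> a" "a \<le> deg S v"
  shows "\<exists>T. ham T \<and> T \<subseteq> insert v S \<and> v \<in> T \<and> 2 * a \<le> card T \<and> card T < card S"
proof -
  define A where "A = {w \<in> S. adj v w}"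
  define K where "K = {w \<in> S. c w = (\<not> c v)}"
  have fin: "finite S" using ham_finite[OF assms(1)] .
  have AK: "A \<subseteq> K" using adj_colour by (auto simp: A_def K_def)
  have cK: "a < card K"
    using ham_balanced[OF assms(1), of "\<not> c v"] assms(3) by (simp add: K_def)
  \<comment> \<open>If \<open>v\<close> is adjacent to all of \<open>K\<close>, which has more than
    \<open>a\<close> vertices, any \<open>w\<close> can be spared; otherwise take a non-neighbour of
    \<open>v\<close>.\<close>
  obtain w where w: "w \<in> K" "a \<le> card (A - {w})"
  proof (cases "A = K")
    case True
    obtain w where "w \<in> K" using cK by fastforce
    then show thesis using that[of w] cK fin True by (simp add: K_def)
  next
    case False
    then obtain w where "w \<in> K" "w \<notin> A" using AK by blast
    then show thesis using that[of w] assms(5) by (simp add: A_def ndeg_def)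
  qed
  obtain vs where vs: "cyc (w # vs)" "set (w # vs) = S"
    using ham_through[OF assms(1), of w] w by (auto simp: K_def)
  have len: "card S = Suc (length vs)"
    using vs distinct_card[of "w # vs"] by (auto simp: gcycle_def gpath_def)
  \<comment> \<open>The cycle has more than 4 vertices and even length, hence at least 6
    vertices.\<close>
  have "5 \<le> length vs"
    using assms(3,4) len cyc_even[OF vs(1)] by (cases "length vs = 4") auto
  then obtain x us y where us: "vs = x # us @ [y]" "us \<noteq> []"
    by (cases vs; cases "tl vs" rule: rev_cases) fastforce+
  have nb: "adj w x" "adj w y" and path: "path us"
    using vs(1) us by (auto simp: cyc_Cons_iff path_Cons_iff path_snoc_iff)
  \<comment> \<open>\<open>x\<close> and \<open>y\<close> are neighbours of \<open>w\<close>, so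
    they have the colour of \<open>v\<close> and are not adjacent to \<open>v\<close>.\<close>
  have "A - {w} \<subseteq> {u \<in> set us. adj v u}"
  proof
    fix u assume u: "u \<in> A - {w}"
    then have "u \<noteq> x" "u \<noteq> y" using nb w(1) adj_colour[of w] adj_colour[of v u] by (auto simp: A_def K_def)
    then show "u \<in> {u \<in> set us. adj v u}" using u vs(2) us by (auto simp: A_def)
  qed
  then have "card (A - {w}) \<le> deg (set us) v"
    unfolding ndeg_def by (intro card_mono) auto
  then obtain T where T: "ham T" "T \<subseteq> insert v (set us)" "v \<in> T" "2 * a \<le> card T"
    using ham_from_neighbours[OF path, of v a] assms(2,4) w vs(2) us by force
  have "card T \<le> card (insert v (set us))"
    using T by (intro card_mono) auto
  also have "\<dots> \<le> Suc (length us)"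
    using card_length[of us] by (simp add: card_insert_if)
  finally show ?thesis
    using T len us vs(2) by (intro exI[of _ T]) auto
qed

subsection \<open>Exchanging vertices with a cycle\<close>

text \<open>The cyclic order is given by two inverse permutations, so that blocked positions can be
  counted by pulling sets of missed vertices back along a bijection. The last clause cuts the cycle
  open at \<open>v\<close>, exposing both neighbours of \<open>v\<close>.\<close>

lemma ham_successor:
  assumes "ham S"
  obtains s p where "bij_betw s S S" "bij_betw p S S"
    "\<And>v. v \<in> S \<Longrightarrow> adj v (s v)" "\<And>v. v \<in> S \<Longrightarrow> p (s v) = v" "\<And>v. v \<in> S \<Longrightarrow> s (p v) = v"
    "\<And>v. v \<in> S \<Longrightarrow> \<exists>vs. cyc (v # s v # vs @ [p v]) \<and> set (v # s v # vs @ [p v]) = S \<and>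
        hd (vs @ [p v]) = s (s v)"
proof -
  obtain xs where xs: "cyc xs" "set xs = S"
    using assms unfolding hamiltonian_def by blast
  define n where "n = length xs"
  have d: "distinct xs" and n3: "3 \<le> n"
    using xs by (auto simp: gcycle_def gpath_def n_def)
  have nth_eq: "i < n \<Longrightarrow> j < n \<Longrightarrow> xs ! i = xs ! j \<longleftrightarrow> i = j" for i j
    using d by (simp add: nth_eq_iff_index_eq n_def)
  define ix where "ix v = (THE i. i < n \<and> xs ! i = v)" for v
  have ix_nth: "ix (xs ! i) = i" if "i < n" for i
    unfolding ix_def using that nth_eq by (intro the_equality) auto
  have ixS: "ix v < n" "xs ! (ix v) = v" if "v \<in> S" for v
    using that ix_nth xs(2) by (auto simp: in_set_conv_nth n_def)
  define s where "s v = xs ! ((ix v + 1) mod n)" for v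
  \<comment> \<open>Adding \<open>n - 1\<close> modulo \<open>n\<close> steps back by one without
    subtracting from position 0.\<close>
  define p where "p v = xs ! ((ix v + (n - 1)) mod n)" for v
  have in_S: "xs ! (i mod n) \<in> S" for i
  proof -
    have "i mod n < n" using n3 by simp
    then show ?thesis using xs(2) by (auto simp: n_def)
  qed
  have sS: "s v \<in> S" "p v \<in> S" for v
    unfolding s_def p_def by (rule in_S)+
  have ix_s: "ix (s v) = (ix v + 1) mod n" "ix (p v) = (ix v + (n - 1)) mod n" for v
    using n3 by (auto simp: s_def p_def intro!: ix_nth)
  have ps: "p (s v) = v" "s (p v) = v" if "v \<in> S" for v
  proof -
    have e: "ix v + 1 + (n - 1) = ix v + n" "ix v + (n - 1) + 1 = ix v + n"
      using n3 by auto
    have "((ix v + 1) mod n + (n - 1)) mod n = ix v"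
      unfolding mod_add_left_eq e using ixS(1)[OF that] by simp
    then show "p (s v) = v" by (simp add: p_def ix_s ixS(2)[OF that])
    have "((ix v + (n - 1)) mod n + 1) mod n = ix v"
      unfolding mod_add_left_eq e using ixS(1)[OF that] by simp
    then show "s (p v) = v" by (simp add: s_def ix_s ixS(2)[OF that])
  qed
  have bij: "bij_betw s S S" "bij_betw p S S"
    using ps sS by (auto intro!: bij_betw_byWitness[of S p s S] bij_betw_byWitness[of S s p S])
  have rot: "\<exists>vs. cyc (v # s v # vs @ [p v]) \<and> set (v # s v # vs @ [p v]) = S \<and>
        hd (vs @ [p v]) = s (s v)" if "v \<in> S" for v
  proof -
    define ys where "ys = rotate (ix v) xs"
    have ys: "cyc ys" "set ys = S" "length ys = n"
      using xs cyc_rotate by (auto simp: ys_def n_def)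
    have nth: "ys ! k = xs ! ((ix v + k) mod n)" if "k < n" for k
      using that by (simp add: ys_def nth_rotate n_def)
    have "ys \<noteq> []" using ys(3) n3 by auto
    have "ys = ys ! 0 # ys ! 1 # drop 2 ys"
      using ys(3) n3 by (cases ys; cases "tl ys") auto
    moreover have "drop 2 ys = butlast (drop 2 ys) @ [last (drop 2 ys)]"
      using ys(3) n3 by (intro append_butlast_last_id[symmetric]) auto
    moreover have "last (drop 2 ys) = p v"
      using ys(3) n3 nth[of "n - 1"] \<open>ys \<noteq> []\<close>
      by (subst last_drop) (auto simp: last_conv_nth p_def)
    moreover have "ys ! 0 = v" "ys ! 1 = s v"
      using nth[of 0] nth[of 1] n3 ixS[OF that] by (auto simp: s_def)
    moreover have "hd (drop 2 ys) = s (s v)"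
      using nth[of 2] n3 ys(3) by (simp add: hd_drop_conv_nth s_def[of "s v"] ix_s mod_simps)
    ultimately show ?thesis
      using ys by (intro exI[of _ "butlast (drop 2 ys)"]) metis
  qed
  have "adj v (s v)" if "v \<in> S" for v
    using rot[OF that] by (auto simp: cyc_Cons_iff)
  then show thesis
    using that bij ps rot by blast
qed

lemma deg_complement:
  assumes "ham S" "card S = 2 * a" "k = (\<not> c v)"
  shows "card {w \<in> S. c w = k \<and> \<not> adj v w} + deg S v = a"
proof -
  have "card {w \<in> S. c w = k} = a"
    using ham_balanced[OF assms(1), of k] assms(2) by simp
  moreover have "{w \<in> S. c w = k} = {w \<in> S. c w = k \<and> \<not> adj v w} \<union> {w \<in> S. adj v w}"
    using assms(3) adj_colour by auto
  moreover have "card ({w \<in> S. c w = k \<and> \<not> adj v w} \<union> {w \<in> S. adj v w}) =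
      card {w \<in> S. c w = k \<and> \<not> adj v w} + card {w \<in> S. adj v w}"
    using ham_finite[OF assms(1)] by (intro card_Un_disjoint) auto
  ultimately show ?thesis
    by (simp add: ndeg_def)
qed

text \<open>Bounds the vertices blocked through a shifted position: the permutation \<open>f\<close>
  moves each of them to a missed vertex.\<close>

lemma card_shifted_le:
  assumes "finite T" "bij_betw f S S" "A \<subseteq> S" "f ` A \<subseteq> T"
  shows "card A \<le> card T"
  using assms card_inj_on_le[of f A T] by (meson bij_betw_def inj_on_subset)

text \<open>Every miss of \<open>y\<close> or \<open>z\<close> blocks one vertex of the cycle, every miss of \<open>x\<close> blocks two.\<close>

lemma exchange_one:
  assumes S: "ham S" "card S = 2 * a" "2 \<le> a" and x: "x \<notin> S"
    and cols: "c y = (\<not> c x)" "c z = (\<not> c x)"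
    and large: "3 * a < deg S y + deg S z + 2 * deg S x"
  obtains u where "u \<in> S" "c u = c x" "adj y u" "adj z u" "ham (insert x (S - {u}))"
proof -
  obtain s p where sp: "bij_betw s S S" "bij_betw p S S"
    "\<And>v. v \<in> S \<Longrightarrow> adj v (s v)" "\<And>v. v \<in> S \<Longrightarrow> p (s v) = v" "\<And>v. v \<in> S \<Longrightarrow> s (p v) = v"
    "\<And>v. v \<in> S \<Longrightarrow> \<exists>vs. cyc (v # s v # vs @ [p v]) \<and> set (v # s v # vs @ [p v]) = S \<and>
        hd (vs @ [p v]) = s (s v)"
    using ham_successor[OF S(1)] by blast
  have fin: "finite S" using ham_finite[OF S(1)] .
  have maps: "s v \<in> S" "p v \<in> S" if "v \<in> S" for v
    using that sp(1,2) by (auto simp: bij_betw_def)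
  have col_p: "c (p v) = (\<not> c v)" "c (s v) = (\<not> c v)" if "v \<in> S" for v
    using that sp(3)[of "p v"] sp(3)[of v] sp(5) maps adj_colour by fastforce+
  let ?X = "{w \<in> S. c w = c x}"
  let ?M = "{w \<in> S. c w = (\<not> c x) \<and> \<not> adj x w}"
  define By where "By = {w \<in> S. c w = c x \<and> \<not> adj y w}"
  define Bz where "Bz = {w \<in> S. c w = c x \<and> \<not> adj z w}"
  define Bs where "Bs = {w \<in> S. c w = c x \<and> \<not> adj x (s w)}"
  define Bp where "Bp = {w \<in> S. c w = c x \<and> \<not> adj x (p w)}"
  have "card Bs \<le> card ?M"
    using fin sp(1) maps col_p by (intro card_shifted_le[of _ s S]) (auto simp: Bs_def)
  moreover have "card Bp \<le> card ?M"
    using fin sp(2) maps col_p by (intro card_shifted_le[of _ p S]) (auto simp: Bp_def)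
  moreover have "card ?M + deg S x = a" "card By + deg S y = a" "card Bz + deg S z = a"
    unfolding By_def Bz_def using cols by (intro deg_complement[OF S(1,2)]; simp)+
  moreover have "card (By \<union> Bz \<union> Bs \<union> Bp) \<le> card By + card Bz + card Bs + card Bp"
    by (meson add_le_mono1 card_Un_le le_trans)
  \<comment> \<open>The misses add up to \<open>4 * a\<close> minus the degree sum in
    \<open>large\<close>, so fewer than \<open>a\<close> of the \<open>a\<close> candidates are
    blocked.\<close>
  ultimately have "card (By \<union> Bz \<union> Bs \<union> Bp) < a"
    using large by linarith
  moreover have "card ?X = a"
    using ham_balanced[OF S(1), of "c x"] S(2) by simp
  ultimately have "\<not> ?X \<subseteq> By \<union> Bz \<union> Bs \<union> Bp"
    using card_mono[of "By \<union> Bz \<union> Bs \<union> Bp" ?X] fin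
    by (auto simp: By_def Bz_def Bs_def Bp_def)
  then obtain u where u: "u \<in> S" "c u = c x" "adj y u" "adj z u" "adj x (s u)" "adj x (p u)"
    by (auto simp: By_def Bz_def Bs_def Bp_def)
  obtain vs where vs: "cyc (u # s u # vs @ [p u])" "set (u # s u # vs @ [p u]) = S"
    using sp(6)[OF u(1)] by blast
  then have "cyc (x # s u # vs @ [p u])"
    using u x by (auto simp: cyc_Cons_iff)
  then have "ham (insert x (S - {u}))"
    using hamI[of "x # s u # vs @ [p u]"] vs by (auto simp: cyc_Cons_iff insert_Diff_if)
  then show thesis using that u by blast
qed

text \<open>Two consecutive vertices \<open>w\<close>, \<open>s w\<close> make room for the edge
  between \<open>x\<close> and \<open>y\<close>, which is attached at \<open>p w\<close> and
  \<open>s (s w)\<close>. A miss of any of \<open>t\<close>, \<open>r\<close>, \<open>x\<close>,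
  \<open>y\<close> blocks only one \<open>w\<close>, found by pulling back along the identity,
  \<open>s\<close>, \<open>p\<close> and \<open>s \<circ> s\<close>.\<close>

lemma exchange_two:
  assumes S: "ham S" "card S = 2 * a" "3 \<le> a" and xy: "x \<notin> S" "y \<notin> S" "adj x y"
    and cols: "c t = (\<not> c x)" "c r = c x"
    and large: "3 * a < deg S t + deg S r + deg S x + deg S y"
  obtains w w' where "w \<in> S" "w' \<in> S" "c w = c x" "adj w w'" "adj t w" "adj r w'"
    "ham (insert x (insert y (S - {w, w'})))"
proof -
  obtain s p where sp: "bij_betw s S S" "bij_betw p S S"
    "\<And>v. v \<in> S \<Longrightarrow> adj v (s v)" "\<And>v. v \<in> S \<Longrightarrow> p (s v) = v" "\<And>v. v \<in> S \<Longrightarrow> s (p v) = v"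
    "\<And>v. v \<in> S \<Longrightarrow> \<exists>vs. cyc (v # s v # vs @ [p v]) \<and> set (v # s v # vs @ [p v]) = S \<and>
        hd (vs @ [p v]) = s (s v)"
    using ham_successor[OF S(1)] by blast
  have fin: "finite S" using ham_finite[OF S(1)] .
  have maps: "s v \<in> S" "p v \<in> S" if "v \<in> S" for v
    using that sp(1,2) by (auto simp: bij_betw_def)
  have col_p: "c (p v) = (\<not> c v)" "c (s v) = (\<not> c v)" if "v \<in> S" for v
    using that sp(3)[of "p v"] sp(3)[of v] sp(5) maps adj_colour by fastforce+
  have cy: "c y = (\<not> c x)" using adj_colour[OF xy(3)] by auto
  have ss: "bij_betw (s \<circ> s) S S"
    using sp(1) bij_betw_trans by blast
  let ?X = "{w \<in> S. c w = c x}"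
  define Bt where "Bt = {w \<in> S. c w = c x \<and> \<not> adj t w}"
  define Br where "Br = {w \<in> S. c w = c x \<and> \<not> adj r (s w)}"
  define Bx where "Bx = {w \<in> S. c w = c x \<and> \<not> adj x (p w)}"
  define By where "By = {w \<in> S. c w = c x \<and> \<not> adj y (s (s w))}"
  have "card Br \<le> card {w \<in> S. c w = (\<not> c x) \<and> \<not> adj r w}"
    using fin sp(1) maps col_p by (intro card_shifted_le[of _ s S]) (auto simp: Br_def)
  moreover have "card Bx \<le> card {w \<in> S. c w = (\<not> c x) \<and> \<not> adj x w}"
    using fin sp(2) maps col_p by (intro card_shifted_le[of _ p S]) (auto simp: Bx_def)
  moreover have "card By \<le> card {w \<in> S. c w = c x \<and> \<not> adj y w}"
    using fin ss maps col_p by (intro card_shifted_le[of _ "s \<circ> s" S]) (auto simp: By_def)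
  moreover have "card {w \<in> S. c w = (\<not> c x) \<and> \<not> adj r w} + deg S r = a"
    "card {w \<in> S. c w = (\<not> c x) \<and> \<not> adj x w} + deg S x = a"
    "card {w \<in> S. c w = c x \<and> \<not> adj y w} + deg S y = a" "card Bt + deg S t = a"
    unfolding Bt_def using cols cy by (intro deg_complement[OF S(1,2)]; simp)+
  moreover have "card (Bt \<union> Br \<union> Bx \<union> By) \<le> card Bt + card Br + card Bx + card By"
    by (meson add_le_mono1 card_Un_le le_trans)
  ultimately have "card (Bt \<union> Br \<union> Bx \<union> By) < a"
    using large by linarith
  moreover have "card ?X = a"
    using ham_balanced[OF S(1), of "c x"] S(2) by simp
  ultimately have "\<not> ?X \<subseteq> Bt \<union> Br \<union> Bx \<union> By"
    using card_mono[of "Bt \<union> Br \<union> Bx \<union> By" ?X] fin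
    by (auto simp: Bt_def Br_def Bx_def By_def)
  then obtain w where w: "w \<in> S" "c w = c x" "adj t w" "adj r (s w)" "adj x (p w)" "adj y (s (s w))"
    by (auto simp: Bt_def Br_def Bx_def By_def)
  obtain vs where vs: "cyc (w # s w # vs @ [p w])" "set (w # s w # vs @ [p w]) = S"
      "hd (vs @ [p w]) = s (s w)"
    using sp(6)[OF w(1)] by blast
  have "card S = length (w # s w # vs @ [p w])"
    using vs(1,2) distinct_card by (metis gcycle_def gpath_def)
  then have ne: "vs \<noteq> []" using S by auto
  have "path (vs @ [p w])" "w \<notin> set (vs @ [p w])" "s w \<notin> set (vs @ [p w])"
    using vs(1) by (auto simp: cyc_Cons_iff path_Cons_iff)
  then have "cyc (x # y # vs @ [p w])"
    using w xy vs ne adj_sym adj_irrefl by (auto simp: cyc_Cons_iff path_Cons_iff)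
  moreover have "set (x # y # vs @ [p w]) = insert x (insert y (S - {w, s w}))"
    using vs by (auto simp: cyc_Cons_iff path_Cons_iff)
  ultimately have "ham (insert x (insert y (S - {w, s w})))"
    using hamI by metis
  then show thesis using that[of w "s w"] w sp(3) maps by blast
qed

end

section \<open>Counting edges between a hexagon and six outside vertices\<close>

lemma forall_less_three: "(\<forall>i<3. P i) \<longleftrightarrow> P 0 \<and> P 1 \<and> P (2::nat)"
  by (auto simp: less_Suc_eq numeral_3_eq_3 numeral_2_eq_2)

lemma exists_less_three: "(\<exists>i<3. P i) \<longleftrightarrow> P 0 \<or> P 1 \<or> P (2::nat)"
  using forall_less_three[of "\<lambda>i. \<not> P i"] by blast

text \<open>Given \<open>t i\<close> and \<open>r j\<close>, the two values of \<open>x\<close> off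
  \<open>j\<close> and the two of \<open>v\<close> off \<open>i\<close> form two pairs of sum at
  most 1, and the other two values add at most 2. If \<open>t\<close> and \<open>r\<close> each hold
  at two indices, every \<open>x k\<close> can be paired with \<open>v k\<close>.\<close>

lemma pair_count_complete:
  fixes t r :: "nat \<Rightarrow> bool" and x v :: "nat \<Rightarrow> int"
  assumes bounds: "\<forall>i<3. x i \<le> 1" "\<forall>i<3. v i \<le> 1"
    and two: "\<forall>i<3. \<forall>j<3. \<forall>k<3. \<forall>l<3. k \<noteq> j \<longrightarrow> l \<noteq> i \<longrightarrow> t i \<longrightarrow> r j \<longrightarrow> x k + v l \<le> 1"
  shows "i < 3 \<Longrightarrow> j < 3 \<Longrightarrow> t i \<Longrightarrow> r j \<Longrightarrow> x 0 + x 1 + x 2 + v 0 + v 1 + v 2 \<le> 4"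
    and "\<forall>l<3. \<exists>i<3. i \<noteq> l \<and> t i \<Longrightarrow> \<forall>k<3. \<exists>j<3. j \<noteq> k \<and> r j \<Longrightarrow>
      x 0 + x 1 + x 2 + v 0 + v 1 + v 2 \<le> 3"
proof -
  have b: "x 0 \<le> 1" "x 1 \<le> 1" "x 2 \<le> 1" "v 0 \<le> 1" "v 1 \<le> 1" "v 2 \<le> 1"
    using bounds by (auto simp: forall_less_three)
  show "x 0 + x 1 + x 2 + v 0 + v 1 + v 2 \<le> 4" if "i < 3" "j < 3" "t i" "r j"
  proof -
    have "x k + v l \<le> 1" if "k < 3" "l < 3" "k \<noteq> j" "l \<noteq> i" for k l
      using two that \<open>i < 3\<close> \<open>j < 3\<close> \<open>t i\<close> \<open>r j\<close> by blast
    note this[of 0 0] this[of 0 1] this[of 0 2] this[of 1 0] this[of 1 1] this[of 1 2]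
      this[of 2 0] this[of 2 1] this[of 2 2]
    moreover have "i = 0 \<or> i = 1 \<or> i = 2" "j = 0 \<or> j = 1 \<or> j = 2"
      using that by linarith+
    ultimately show ?thesis using b by (elim disjE) simp_all
  qed
  show "x 0 + x 1 + x 2 + v 0 + v 1 + v 2 \<le> 3"
    if "\<forall>l<3. \<exists>i<3. i \<noteq> l \<and> t i" "\<forall>k<3. \<exists>j<3. j \<noteq> k \<and> r j"
  proof -
    have "x k + v k \<le> 1" if "k < 3" for k
      using two that \<open>\<forall>l<3. \<exists>i<3. i \<noteq> l \<and> t i\<close> \<open>\<forall>k<3. \<exists>j<3. j \<noteq> k \<and> r j\<close> by metis
    from this[of 0] this[of 1] this[of 2] show ?thesis by simp
  qed
qed

text \<open>In the next two lemmas \<open>X 0, Y 0, X 1, Y 1, X 2, Y 2\<close> is a hexagon and \<open>t, r, x, u, z, v\<close> indicate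
  adjacency to six outside vertices: \<open>t i\<close>, \<open>z i\<close>, \<open>v i\<close> to \<open>X i\<close> and \<open>r i\<close>, \<open>x i\<close>, \<open>u i\<close> to \<open>Y i\<close>. In the first
  lemma the hexagon induces a complete bipartite graph, so that any pair \<open>X i, Y j\<close> can be exchanged.\<close>

lemma hexagon_count_complete:
  fixes t r :: "nat \<Rightarrow> bool" and x u z v :: "nat \<Rightarrow> int"
  assumes bounds:
      "\<forall>i<3. 0 \<le> x i \<and> x i \<le> 1 \<and> 0 \<le> u i \<and> u i \<le> 1 \<and> 0 \<le> z i \<and> z i \<le> 1 \<and> 0 \<le> v i \<and> v i \<le> 1"
    and one: "\<forall>i<3. t i \<longrightarrow> z i + x i + x ((i + 2) mod 3) \<le> 2"
      "\<forall>i<3. t i \<longrightarrow> z i + u i + u ((i + 2) mod 3) \<le> 2"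
      "\<forall>i<3. r i \<longrightarrow> x i + z i + z ((i + 1) mod 3) \<le> 2"
      "\<forall>i<3. r i \<longrightarrow> x i + v i + v ((i + 1) mod 3) \<le> 2"
    and two: "\<forall>i<3. \<forall>j<3. \<forall>k<3. \<forall>l<3. k \<noteq> j \<longrightarrow> l \<noteq> i \<longrightarrow> t i \<longrightarrow> r j \<longrightarrow> x k + v l \<le> 1"
      "\<forall>i<3. \<forall>j<3. \<forall>k<3. \<forall>l<3. k \<noteq> j \<longrightarrow> l \<noteq> i \<longrightarrow> t i \<longrightarrow> r j \<longrightarrow> u k + z l \<le> 1"
  shows "(\<Sum>i<3. of_bool (t i) + of_bool (r i) + x i + u i + z i + v i) \<le> 12"
proof -
  have sum: "(\<Sum>i<3. f i) = f 0 + f 1 + f (2::nat)" for f :: "nat \<Rightarrow> int"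
    by (simp add: numeral_3_eq_3 numeral_2_eq_2)
  have mods: "(0 + 2) mod 3 = (2::nat)" "(1 + 2) mod 3 = (0::nat)" "(2 + 2) mod 3 = (1::nat)"
     "(0 + 1) mod 3 = (1::nat)" "(1 + 1) mod 3 = (2::nat)" "(2 + 1) mod 3 = (0::nat)"
    by auto
  note facts = bounds[unfolded forall_less_three] one[unfolded forall_less_three mods]
  have le1: "\<forall>i<3. x i \<le> 1" "\<forall>i<3. v i \<le> 1" "\<forall>i<3. u i \<le> 1" "\<forall>i<3. z i \<le> 1"
    using bounds by auto
  note xv = pair_count_complete[OF le1(1,2) two(1)] and uz = pair_count_complete[OF le1(3,4) two(2)]
  consider "\<forall>i<3. \<not> t i" | "\<forall>j<3. \<not> r j"
    | (both) i j where "i < 3" "j < 3" "t i" "r j" by blast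
  then show ?thesis
  proof cases
    case 1
    then show ?thesis
      using facts unfolding sum forall_less_three
      by (cases "r 0"; cases "r 1"; cases "r 2"; simp only: simp_thms of_bool_eq) (smt (verit))+
  next
    case 2
    then show ?thesis
      using facts unfolding sum forall_less_three
      by (cases "t 0"; cases "t 1"; cases "t 2"; simp only: simp_thms of_bool_eq) (smt (verit))+
  next
    case both
    \<comment> \<open>If \<open>T \<le> 4\<close>, the bound is 4 + 4 + 4. Otherwise
      \<open>t\<close> and \<open>r\<close> both hold at two indices or more, and the bound is 6 + 3
      + 3.\<close>
    define T :: int where "T = of_bool (t 0) + of_bool (t 1) + of_bool (t 2) +
      of_bool (r 0) + of_bool (r 1) + of_bool (r 2)"
    have *: "?thesis \<longleftrightarrow> T + (x 0 + x 1 + x 2 + v 0 + v 1 + v 2) + (u 0 + u 1 + u 2 + z 0 + z 1 + z 2) \<le> 12"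
      unfolding sum T_def by linarith
    have ?thesis if "T \<le> 4"
      using xv(1)[OF both] uz(1)[OF both] * that by linarith
    moreover have ?thesis if "\<not> T \<le> 4"
    proof -
      have ge2: "\<forall>l<3. \<exists>i<3. i \<noteq> l \<and> t i" "\<forall>k<3. \<exists>j<3. j \<noteq> k \<and> r j"
        using that unfolding T_def forall_less_three exists_less_three
        by (auto simp: of_bool_def split: if_splits)
      moreover have "T \<le> 6" by (auto simp: T_def of_bool_def)
      ultimately show ?thesis
        using xv(2)[OF ge2] uz(2)[OF ge2] * by linarith
    qed
    ultimately show ?thesis by blast
  qed
qed
lemma hexagon_count_sparse:
  fixes t r :: "nat \<Rightarrow> bool" and x u z v :: "nat \<Rightarrow> int"
  assumes bounds:
      "\<forall>i<3. 0 \<le> x i \<and> x i \<le> 1 \<and> 0 \<le> u i \<and> u i \<le> 1 \<and> 0 \<le> z i \<and> z i \<le> 1 \<and> 0 \<le> v i \<and> v i \<le> 1"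
    and one: "\<forall>i<3. t i \<longrightarrow> z i + x i + x ((i + 2) mod 3) \<le> 2"
      "\<forall>i<3. t i \<longrightarrow> z i + u i + u ((i + 2) mod 3) \<le> 2"
      "\<forall>i<3. r i \<longrightarrow> x i + z i + z ((i + 1) mod 3) \<le> 2"
      "\<forall>i<3. r i \<longrightarrow> x i + v i + v ((i + 1) mod 3) \<le> 2"
    and two: "\<forall>i<3. t i \<longrightarrow> r i \<longrightarrow> x ((i + 2) mod 3) + v ((i + 1) mod 3) \<le> 1"
      "\<forall>i<3. t i \<longrightarrow> r i \<longrightarrow> u ((i + 2) mod 3) + z ((i + 1) mod 3) \<le> 1"
      "\<forall>i<3. t i \<longrightarrow> r ((i + 2) mod 3) \<longrightarrow> x i + v ((i + 2) mod 3) \<le> 1"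
      "\<forall>i<3. t i \<longrightarrow> r ((i + 2) mod 3) \<longrightarrow> u i + z ((i + 2) mod 3) \<le> 1"
    and full: "x 0 + x 1 + x 2 \<le> 2 \<or> (\<exists>i<3. \<not> t i \<and> z i \<le> 0)"
      "z 0 + z 1 + z 2 \<le> 2 \<or> (\<exists>i<3. \<not> r i \<and> x i \<le> 0)"
  shows "(\<Sum>i<3. of_bool (t i) + of_bool (r i) + x i + u i + z i + v i) \<le> 12"
proof -
  have sum: "(\<Sum>i<3. f i) = f 0 + f 1 + f (2::nat)" for f :: "nat \<Rightarrow> int"
    by (simp add: numeral_3_eq_3 numeral_2_eq_2)
  have mods: "(0 + 2) mod 3 = (2::nat)" "(1 + 2) mod 3 = (0::nat)" "(2 + 2) mod 3 = (1::nat)" 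
     "(0 + 1) mod 3 = (1::nat)" "(1 + 1) mod 3 = (2::nat)" "(2 + 1) mod 3 = (0::nat)"
    by auto
  note facts = bounds[unfolded forall_less_three] one[unfolded forall_less_three mods]
    two[unfolded forall_less_three mods] full[unfolded exists_less_three]
  \<comment> \<open>Here \<open>two\<close> covers only pairs adjacent on the hexagon;
    \<open>full\<close> makes up for the others. Fixing \<open>t\<close> and \<open>r\<close> leaves
    64 cases of arithmetic in \<open>x\<close>, \<open>u\<close>, \<open>z\<close>,
    \<open>v\<close>.\<close>
  show ?thesis
    using facts unfolding sum
    by (cases "t 0"; cases "t 1"; cases "t 2"; cases "r 0"; cases "r 1"; cases "r 2";
        simp only: simp_thms of_bool_eq) (smt (verit))+
qed

context coloured_graph begin

lemma ham_replace:
  assumes "cyc (a # b # vs @ [d])" "x \<notin> set (b # vs @ [d])" "adj x b" "adj x d"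
  shows "ham (insert x (set (a # b # vs @ [d]) - {a}))"
proof -
  have "cyc (x # b # vs @ [d])"
    using assms by (auto simp: cyc_Cons_iff)
  then show ?thesis
    using hamI[of "x # b # vs @ [d]"] assms(1) by (auto simp: cyc_Cons_iff insert_Diff_if)
qed

lemma full_adjacent:
  assumes "ham S" "card S = 2 * a" "deg S v = a" "w \<in> S" "c w = (\<not> c v)"
  shows "adj v w"
proof -
  have "card {w \<in> S. c w = (\<not> c v) \<and> \<not> adj v w} = 0"
    using deg_complement[OF assms(1,2), of "\<not> c v" v] assms(3) by simp
  then show ?thesis
    using assms(4,5) ham_finite[OF assms(1)] by auto
qed

text \<open>In the next two lemmas \<open>x\<close> and \<open>z\<close> are the ends of the path covering the rest, \<open>t\<close> and \<open>r\<close> their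
  neighbours on it, and \<open>u\<close> and \<open>v\<close> possible substitutes for \<open>x\<close> and \<open>z\<close>. The hypotheses \<open>E1\<close> to \<open>E3\<close>
  exclude the exchanges that would close the path, \<open>F1\<close> and \<open>F2\<close> express that the number of edges
  inside the cycles is maximal.\<close>

lemma hexagon_bound:
  assumes S: "ham S" "card S = 6"
    and out: "x \<notin> S" "u \<notin> S" "z \<notin> S" "v \<notin> S"
    and cols: "c u = c x" "c r = c x" "c t = (\<not> c x)" "c z = (\<not> c x)" "c v = (\<not> c x)"
    and edges: "adj x v" "adj u z"
    and E1: "\<And>y w. y \<in> {x, u} \<Longrightarrow> w \<in> S \<Longrightarrow> adj t w \<Longrightarrow> adj z w \<Longrightarrow> \<not> ham (insert y (S - {w}))"
    and E2: "\<And>y w. y \<in> {z, v} \<Longrightarrow> w \<in> S \<Longrightarrow> adj r w \<Longrightarrow> adj x w \<Longrightarrow> \<not> ham (insert y (S - {w}))"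
    and E3: "\<And>y y' w w'. (y, y') \<in> {(x, v), (u, z)} \<Longrightarrow> w \<in> S \<Longrightarrow> w' \<in> S \<Longrightarrow> adj w w' \<Longrightarrow>
        adj t w \<Longrightarrow> adj r w' \<Longrightarrow> \<not> ham (insert y (insert y' (S - {w, w'})))"
    and F1: "\<And>w. deg S x = 3 \<Longrightarrow> w \<in> S \<Longrightarrow> adj t w \<or> adj z w \<Longrightarrow> deg S w = 3"
    and F2: "\<And>w. deg S z = 3 \<Longrightarrow> w \<in> S \<Longrightarrow> adj x w \<or> adj r w \<Longrightarrow> deg S w = 3"
  shows "deg S t + deg S r + deg S x + deg S u + deg S z + deg S v \<le> 12"
proof -
  have "card {w \<in> S. c w = c x} \<noteq> 0"
    using ham_balanced[OF S(1), of "c x"] S(2) by simp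
  then obtain a0 where "a0 \<in> S" "c a0 = c x"
    by (metis (mono_tags, lifting) card.empty empty_Collect_eq)
  then obtain vs where "cyc (a0 # vs)" "set (a0 # vs) = S"
    using ham_through[OF S(1)] by metis
  moreover from this have "length vs = 5"
    using S(2) distinct_card[of "a0 # vs"] by (auto simp: gcycle_def gpath_def)
  moreover from this obtain b0 a1 b1 a2 b2 where "vs = [b0, a1, b1, a2, b2]"
    by (auto simp: numeral_eq_Suc length_Suc_conv)
  ultimately have cyc0: "cyc [a0, b0, a1, b1, a2, b2]" and setS: "S = {a0, b0, a1, b1, a2, b2}"
    by auto
  have adjs: "adj a0 b0" "adj b0 a1" "adj a1 b1" "adj b1 a2" "adj a2 b2" "adj b2 a0"
    and dist: "distinct [a0, b0, a1, b1, a2, b2]"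
    using cyc0 adj_sym by (auto simp: gcycle_def gpath_def)
  have ca: "c a0 = c x" "c a1 = c x" "c a2 = c x" "c b0 = (\<not> c x)" "c b1 = (\<not> c x)" "c b2 = (\<not> c x)"
    using \<open>c a0 = c x\<close> adjs adj_colour by metis+
  \<comment> \<open>Around the hexagon, with indices modulo 3, \<open>Y i\<close> lies between
    \<open>X i\<close> and \<open>X (i + 1)\<close>, and \<open>X i\<close> between
    \<open>Y (i + 2)\<close> and \<open>Y i\<close>.\<close>
  define X where "X i = [a0, a1, a2] ! i" for i
  define Y where "Y i = [b0, b1, b2] ! i" for i
  have XY: "X 0 = a0" "X 1 = a1" "X 2 = a2" "Y 0 = b0" "Y 1 = b1" "Y 2 = b2"
    "X (Suc 0) = a1" "X (Suc (Suc 0)) = a2" "Y (Suc 0) = b1" "Y (Suc (Suc 0)) = b2"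
    by (auto simp: X_def Y_def)
  have inS: "X i \<in> S" "Y i \<in> S" "c (X i) = c x" "c (Y i) = (\<not> c x)" if "i < 3" for i
    using that ca by (auto simp: less_Suc_eq numeral_3_eq_3 XY setS X_def Y_def)
  have surj: "w \<in> S \<Longrightarrow> c w = c x \<Longrightarrow> \<exists>i<3. w = X i" "w \<in> S \<Longrightarrow> c w = (\<not> c x) \<Longrightarrow> \<exists>i<3. w = Y i" for w
    using ca unfolding exists_less_three XY setS by auto
  have sum: "(\<Sum>i<3. f i) = f 0 + f 1 + f (2::nat)" for f :: "nat \<Rightarrow> int"
    by (simp add: numeral_3_eq_3 numeral_2_eq_2)
  have degX: "int (deg S y) = of_bool (adj y (X 0)) + of_bool (adj y (X 1)) + of_bool (adj y (X 2))"
    if "c y = (\<not> c x)" for y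
  proof -
    have "{w \<in> S. adj y w} = (if adj y a0 then {a0} else {}) \<union> (if adj y a1 then {a1} else {}) \<union>
        (if adj y a2 then {a2} else {})"
      using that ca adj_colour[of y] by (auto simp: setS split: if_splits)
    then show ?thesis using dist by (auto simp: ndeg_def XY card_insert_if)
  qed
  have degY: "int (deg S y) = of_bool (adj y (Y 0)) + of_bool (adj y (Y 1)) + of_bool (adj y (Y 2))"
    if "c y = c x" for y
  proof -
    have "{w \<in> S. adj y w} = (if adj y b0 then {b0} else {}) \<union> (if adj y b1 then {b1} else {}) \<union>
        (if adj y b2 then {b2} else {})"
      using that ca adj_colour[of y] by (auto simp: setS split: if_splits)
    then show ?thesis using dist by (auto simp: ndeg_def XY card_insert_if)
  qed
  have rots: "cyc [b0, a1, b1, a2, b2, a0]" "cyc [a1, b1, a2, b2, a0, b0]" "cyc [b1, a2, b2, a0, b0, a1]"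
    "cyc [a2, b2, a0, b0, a1, b1]" "cyc [b2, a0, b0, a1, b1, a2]"
    using cyc0 adjs adj_sym by (auto simp: gcycle_def gpath_def)
  have rep: "ham (insert y (S - {p0}))"
    if "cyc [p0,p1,p2,p3,p4,p5]" "{p0,p1,p2,p3,p4,p5} = S" "y \<notin> S" "adj y p1" "adj y p5"
    for y p0 p1 p2 p3 p4 p5
    using ham_replace[of p0 p1 "[p2,p3,p4]" p5 y] that by auto
  have three: "i = 0 \<or> i = 1 \<or> i = 2" if "i < 3" for i :: nat
    using that by linarith
  have third: "\<exists>m<3. distinct [i, l, m]" if "i < 3" "l < 3" "i \<noteq> l" for i l :: nat
    using three[OF that(1)] three[OF that(2)] that(3) unfolding exists_less_three by auto
  have one: "ham (insert y (S - {X i}))" if "i < 3" "y \<notin> S" "adj y (Y i)" "adj y (Y ((i + 2) mod 3))" for y i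
    using three[OF that(1)] that(2-) rep[OF cyc0, of y] rep[OF rots(2), of y] rep[OF rots(4), of y]
    by (elim disjE) (auto simp: XY setS insert_commute)
  have one': "ham (insert y (S - {Y i}))" if "i < 3" "y \<notin> S" "adj y (X i)" "adj y (X ((i + 1) mod 3))" for y i
    using three[OF that(1)] that(2-) rep[OF rots(1), of y] rep[OF rots(3), of y] rep[OF rots(5), of y]
    by (elim disjE) (auto simp: XY setS insert_commute)
  have inj: "X i = X j \<longleftrightarrow> i = j" "Y i = Y j \<longleftrightarrow> i = j" if "i < 3" "j < 3" for i j
    using three[OF that(1)] three[OF that(2)] dist by (auto simp: XY)
  have XY_ne: "X i \<noteq> Y j" if "i < 3" "j < 3" for i j
    using inS that by metis
  \<comment> \<open>The four vertices other than \<open>X i\<close> and \<open>Y j\<close> form a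
    path \<open>X l\<close>, \<open>Y k'\<close>, \<open>X l'\<close>, \<open>Y k\<close>, which is
    closed by the edge between \<open>y\<close> and \<open>y'\<close>.\<close>
  have rep2: "ham (insert y (insert y' (S - {X i, Y j})))"
    if "i < 3" "l < 3" "l' < 3" "distinct [i, l, l']" "j < 3" "k < 3" "k' < 3" "distinct [j, k, k']"
      "y \<notin> S" "y' \<notin> S" "adj y y'" "adj y' (X l)" "adj (X l) (Y k')" "adj (Y k') (X l')"
      "adj (X l') (Y k)" "adj y (Y k)" for y y' i l l' j k k'
  proof -
    have "m = i \<or> m = l \<or> m = l'" "m = j \<or> m = k \<or> m = k'" if "m < 3" for m
      using that \<open>i < 3\<close> \<open>l < 3\<close> \<open>l' < 3\<close> \<open>distinct [i, l, l']\<close>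
        \<open>j < 3\<close> \<open>k < 3\<close> \<open>k' < 3\<close> \<open>distinct [j, k, k']\<close> by auto
    then have "w \<in> {X i, X l, X l', Y j, Y k, Y k'}" if "w \<in> S" for w
      using surj[OF that] by blast
    then have "S = {X i, X l, X l', Y j, Y k, Y k'}"
      using inS that by blast
    moreover have "distinct [X i, X l, X l', Y j, Y k, Y k']"
      using that inj XY_ne by auto
    ultimately have *: "S - {X i, Y j} = {X l, Y k', X l', Y k}" by auto
    have "cyc [y, y', X l, Y k', X l', Y k]"
      using that inj XY_ne inS adj_irrefl adj_sym by (auto simp: cyc_Cons_iff path_Cons_iff path_singleton)
    then show ?thesis
      using hamI[of "[y, y', X l, Y k', X l', Y k]"] by (simp add: *)
  qed
  have edge: "adj (X i) (Y i)" "adj (X ((i + 1) mod 3)) (Y i)" if "i < 3" for i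
    using three[OF that] adjs adjs[THEN adj_sym] by (auto simp: XY)
  define B where "B a w = (of_bool (adj a w) :: int)" for a w
  have total: "int (deg S t + deg S r + deg S x + deg S u + deg S z + deg S v) =
      (\<Sum>i<3. of_bool (adj t (X i)) + of_bool (adj r (Y i)) + B x (Y i) + B u (Y i) + B z (X i) + B v (X i))"
    using cols by (simp add: degX degY sum B_def)
  have bounds: "\<forall>i<3. 0 \<le> B x (Y i) \<and> B x (Y i) \<le> 1 \<and> 0 \<le> B u (Y i) \<and> B u (Y i) \<le> 1 \<and>
      0 \<le> B z (X i) \<and> B z (X i) \<le> 1 \<and> 0 \<le> B v (X i) \<and> B v (X i) \<le> 1"
    by (simp add: B_def)
  have mod3: "(i + 1) mod 3 < 3" "(i + 2) mod 3 < 3" for i :: nat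
    by simp_all
  have oneX: "B z (X i) + B y (Y i) + B y (Y ((i + 2) mod 3)) \<le> 2"
    if "i < 3" "adj t (X i)" "y \<in> {x, u}" for y i
  proof (rule ccontr)
    assume "\<not> ?thesis"
    then have "adj z (X i)" "adj y (Y i)" "adj y (Y ((i + 2) mod 3))"
      by (auto simp: B_def of_bool_def split: if_splits)
    moreover have "y \<notin> S" using that(3) out by blast
    ultimately show False
      using one[OF that(1)] E1[OF that(3) inS(1)[OF that(1)] that(2)] by blast
  qed
  have oneY: "B x (Y i) + B y (X i) + B y (X ((i + 1) mod 3)) \<le> 2"
    if "i < 3" "adj r (Y i)" "y \<in> {z, v}" for y i
  proof (rule ccontr)
    assume "\<not> ?thesis"
    then have "adj x (Y i)" "adj y (X i)" "adj y (X ((i + 1) mod 3))"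
      by (auto simp: B_def of_bool_def split: if_splits)
    moreover have "y \<notin> S" using that(3) out by blast
    ultimately show False
      using one'[OF that(1)] E2[OF that(3) inS(2)[OF that(1)] that(2)] by blast
  qed
  have ones: "\<forall>i<3. adj t (X i) \<longrightarrow> B z (X i) + B x (Y i) + B x (Y ((i + 2) mod 3)) \<le> 2"
      "\<forall>i<3. adj t (X i) \<longrightarrow> B z (X i) + B u (Y i) + B u (Y ((i + 2) mod 3)) \<le> 2"
      "\<forall>i<3. adj r (Y i) \<longrightarrow> B x (Y i) + B z (X i) + B z (X ((i + 1) mod 3)) \<le> 2"
      "\<forall>i<3. adj r (Y i) \<longrightarrow> B x (Y i) + B v (X i) + B v (X ((i + 1) mod 3)) \<le> 2"
    using oneX oneY by blast+
  show ?thesis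
  proof (cases "\<forall>i<3. \<forall>j<3. adj (X i) (Y j)")
    case True
    have two: "B y (Y k) + B y' (X l) \<le> 1"
      if "(y, y') \<in> {(x, v), (u, z)}" "i < 3" "j < 3" "k < 3" "l < 3" "k \<noteq> j" "l \<noteq> i" "adj t (X i)" "adj r (Y j)"
      for y y' i j k l
    proof (rule ccontr)
      assume "\<not> B y (Y k) + B y' (X l) \<le> 1"
      then have "adj y (Y k)" "adj y' (X l)"
        by (auto simp: B_def of_bool_def split: if_splits)
      moreover obtain l' where "l' < 3" "distinct [i, l, l']"
        using third[of i l] \<open>i < 3\<close> \<open>l < 3\<close> \<open>l \<noteq> i\<close> by blast
      moreover obtain k' where "k' < 3" "distinct [j, k, k']"
        using third[of j k] \<open>j < 3\<close> \<open>k < 3\<close> \<open>k \<noteq> j\<close> by blast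
      moreover have "y \<notin> S" "y' \<notin> S" "adj y y'"
        using that(1) out edges by auto
      ultimately have "ham (insert y (insert y' (S - {X i, Y j})))"
        using that True adj_sym by (intro rep2[of i l l' j k k' y y']) auto
      then show False
        using E3[OF that(1), of "X i" "Y j"] that inS True by blast
    qed
    have "(\<Sum>i<3. of_bool (adj t (X i)) + of_bool (adj r (Y i)) + B x (Y i) + B u (Y i) + B z (X i) + B v (X i)) \<le> 12"
      using two by (intro hexagon_count_complete[OF bounds ones]) blast+
    then show ?thesis using total by linarith
  next
    case False
    \<comment> \<open>Without \<open>X i\<close> and \<open>Y i\<close> the hexagon is a path from
      \<open>X (i + 1)\<close> to \<open>Y (i + 2)\<close>.\<close>
    have two: "B y (Y ((i + 2) mod 3)) + B y' (X ((i + 1) mod 3)) \<le> 1"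
      if "(y, y') \<in> {(x, v), (u, z)}" "i < 3" "adj t (X i)" "adj r (Y i)" for y y' i
    proof (rule ccontr)
      assume "\<not> B y (Y ((i + 2) mod 3)) + B y' (X ((i + 1) mod 3)) \<le> 1"
      then have "adj y (Y ((i + 2) mod 3))" "adj y' (X ((i + 1) mod 3))"
        by (auto simp: B_def of_bool_def split: if_splits)
      moreover have "adj (X ((i + 2) mod 3)) (Y ((i + 1) mod 3))"
        using edge(2)[OF mod3(1)[of i]] by (simp add: mod_simps)
      moreover have "distinct [i, (i + 1) mod 3, (i + 2) mod 3]"
        using three[OF that(2)] by auto
      moreover have "y \<notin> S" "y' \<notin> S" "adj y y'"
        using that(1) out edges by auto
      ultimately have "ham (insert y (insert y' (S - {X i, Y i})))"
        using that mod3[of i] edge adj_sym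
        by (intro rep2[of i "(i + 1) mod 3" "(i + 2) mod 3" i "(i + 2) mod 3" "(i + 1) mod 3"]) auto
      then show False
        using E3[OF that(1), of "X i" "Y i"] that inS edge by blast
    qed
    \<comment> \<open>The other neighbour of \<open>X i\<close> on the hexagon is
      \<open>Y (i + 2)\<close>; without these two it is a path from \<open>Y i\<close> to
      \<open>X (i + 2)\<close>.\<close>
    have two': "B y (Y i) + B y' (X ((i + 2) mod 3)) \<le> 1"
      if "(y, y') \<in> {(x, v), (u, z)}" "i < 3" "adj t (X i)" "adj r (Y ((i + 2) mod 3))" for y y' i
    proof (rule ccontr)
      assume "\<not> B y (Y i) + B y' (X ((i + 2) mod 3)) \<le> 1"
      then have "adj y (Y i)" "adj y' (X ((i + 2) mod 3))"
        by (auto simp: B_def of_bool_def split: if_splits)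
      moreover have e: "adj (X ((i + 2) mod 3)) (Y ((i + 1) mod 3))" "adj (X i) (Y ((i + 2) mod 3))"
        using edge(2)[OF mod3(1)[of i]] edge(2)[OF mod3(2)[of i]] that(2) by (simp_all add: mod_simps)
      moreover have "distinct [i, (i + 2) mod 3, (i + 1) mod 3]" "distinct [(i + 2) mod 3, i, (i + 1) mod 3]"
        using three[OF that(2)] by auto
      moreover have "y \<notin> S" "y' \<notin> S" "adj y y'"
        using that(1) out edges by auto
      ultimately have "ham (insert y (insert y' (S - {X i, Y ((i + 2) mod 3)})))"
        using that mod3[of i] edge adj_sym
        by (intro rep2[of i "(i + 2) mod 3" "(i + 1) mod 3" "(i + 2) mod 3" i "(i + 1) mod 3"]) auto
      then show False
        using E3[OF that(1), of "X i" "Y ((i + 2) mod 3)"] that inS mod3 e by blast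
    qed
    have six: "card S = 2 * 3" using S(2) by simp
    \<comment> \<open>Neither vertex of a non-adjacent pair has full degree. If \<open>x\<close> is
      adjacent to every \<open>Y\<close>, then by \<open>F1\<close> all neighbours of
      \<open>t\<close> or \<open>z\<close> on the hexagon are full, so \<open>X i\<close> is
      adjacent to neither; likewise \<open>Y j\<close> by \<open>F2\<close>.\<close>
    obtain i j where ij: "i < 3" "j < 3" "\<not> adj (X i) (Y j)" "\<not> adj (Y j) (X i)"
      using False adj_commute by blast
    have notfull: "deg S (X i) \<noteq> 3" "deg S (Y j) \<noteq> 3"
      using full_adjacent[OF S(1) six, of "X i" "Y j"] full_adjacent[OF S(1) six, of "Y j" "X i"]
        inS ij by auto
    have B: "B a w \<le> 1" "0 < B a w \<longleftrightarrow> adj a w" for a w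
      by (auto simp: B_def)
    have "B x (Y 0) + B x (Y 1) + B x (Y 2) \<le> 2 \<or> (\<exists>i<3. \<not> adj t (X i) \<and> B z (X i) \<le> 0)"
    proof (rule ccontr)
      assume *: "\<not> ?thesis"
      then have "int (deg S x) = 3"
        using degY[of x] B(1)[of x "Y 0"] B(1)[of x "Y 1"] B(1)[of x "Y 2"] unfolding B_def by linarith
      moreover have "adj t (X i) \<or> adj z (X i)"
        using * ij(1) B(2)[of z "X i"] by force
      ultimately show False
        using notfull(1) F1[of "X i"] inS(1)[OF ij(1)] by simp
    qed
    moreover have "B z (X 0) + B z (X 1) + B z (X 2) \<le> 2 \<or> (\<exists>i<3. \<not> adj r (Y i) \<and> B x (Y i) \<le> 0)"
    proof (rule ccontr)
      assume *: "\<not> ?thesis"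
      then have "int (deg S z) = 3"
        using degX[OF cols(4)] B(1)[of z "X 0"] B(1)[of z "X 1"] B(1)[of z "X 2"] unfolding B_def by linarith
      moreover have "adj x (Y j) \<or> adj r (Y j)"
        using * ij(2) B(2)[of x "Y j"] by force
      ultimately show False
        using notfull(2) F2[of "Y j"] inS(2)[OF ij(2)] by simp
    qed
    ultimately have "(\<Sum>i<3. of_bool (adj t (X i)) + of_bool (adj r (Y i)) + B x (Y i) + B u (Y i) + B z (X i) + B v (X i)) \<le> 12"
      using two two' by (intro hexagon_count_sparse[OF bounds ones]) blast+
    then show ?thesis using total by linarith
  qed
qed

lemma local_bound:
  assumes S: "ham S" "card S = 2 * a" "3 \<le> a"
    and out: "x \<notin> S" "u \<notin> S" "z \<notin> S" "v \<notin> S"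
    and cols: "c u = c x" "c r = c x" "c t = (\<not> c x)" "c z = (\<not> c x)" "c v = (\<not> c x)"
    and edges: "adj x v" "adj u z"
    and E1: "\<And>y w. y \<in> {x, u} \<Longrightarrow> w \<in> S \<Longrightarrow> adj t w \<Longrightarrow> adj z w \<Longrightarrow> \<not> ham (insert y (S - {w}))"
    and E2: "\<And>y w. y \<in> {z, v} \<Longrightarrow> w \<in> S \<Longrightarrow> adj r w \<Longrightarrow> adj x w \<Longrightarrow> \<not> ham (insert y (S - {w}))"
    and E3: "\<And>y y' w w'. (y, y') \<in> {(x, v), (u, z)} \<Longrightarrow> w \<in> S \<Longrightarrow> w' \<in> S \<Longrightarrow> adj w w' \<Longrightarrow>
        adj t w \<Longrightarrow> adj r w' \<Longrightarrow> \<not> ham (insert y (insert y' (S - {w, w'})))"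
    and F1: "\<And>w. deg S x = a \<Longrightarrow> w \<in> S \<Longrightarrow> adj t w \<or> adj z w \<Longrightarrow> deg S w = a"
    and F2: "\<And>w. deg S z = a \<Longrightarrow> w \<in> S \<Longrightarrow> adj x w \<or> adj r w \<Longrightarrow> deg S w = a"
  shows "deg S t + deg S r + deg S x + deg S u + deg S z + deg S v \<le> 6 * (a - 1)"
proof (cases "a = 3")
  case True
  then have six: "card S = 6" using S(2) by simp
  have "deg S t + deg S r + deg S x + deg S u + deg S z + deg S v \<le> 12"
    by (rule hexagon_bound[OF S(1) six out cols edges]; fact E1 E2 E3 F1[unfolded True] F2[unfolded True])
  then show ?thesis using True by simp
next
  case False
  then have a: "4 \<le> a" "2 \<le> a" using S(3) by auto
  have I1: "\<not> 3 * a < deg S t + deg S r + deg S x + deg S v"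
  proof
    assume "3 * a < deg S t + deg S r + deg S x + deg S v"
    then obtain w w' where "w \<in> S" "w' \<in> S" "adj w w'" "adj t w" "adj r w'"
        "ham (insert x (insert v (S - {w, w'})))"
      by (rule exchange_two[OF S out(1,4) edges(1) cols(3,2)])
    then show False using E3[of x v] by blast
  qed
  have I2: "\<not> 3 * a < deg S t + deg S r + deg S u + deg S z"
  proof
    assume *: "3 * a < deg S t + deg S r + deg S u + deg S z"
    have "c t = (\<not> c u)" "c r = c u" using cols by auto
    from this * obtain w w' where "w \<in> S" "w' \<in> S" "adj w w'" "adj t w" "adj r w'"
        "ham (insert u (insert z (S - {w, w'})))"
      by (rule exchange_two[OF S out(2,3) edges(2)])
    then show False using E3[of u z] by blast
  qed
  have I3: "\<not> 3 * a < deg S t + deg S z + 2 * deg S y" if "y \<in> {x, u}" for y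
  proof
    assume *: "3 * a < deg S t + deg S z + 2 * deg S y"
    have "y \<notin> S" "c t = (\<not> c y)" "c z = (\<not> c y)" using cols out that by auto
    from this * obtain w where "w \<in> S" "adj t w" "adj z w" "ham (insert y (S - {w}))"
      by (rule exchange_one[OF S(1,2) a(2)])
    then show False using E1[OF that] by blast
  qed
  have I4: "\<not> 3 * a < deg S r + deg S x + 2 * deg S y" if "y \<in> {z, v}" for y
  proof
    assume *: "3 * a < deg S r + deg S x + 2 * deg S y"
    have "y \<notin> S" "c r = (\<not> c y)" "c x = (\<not> c y)" using cols out that by auto
    from this * obtain w where "w \<in> S" "adj r w" "adj x w" "ham (insert y (S - {w}))"
      by (rule exchange_one[OF S(1,2) a(2)])
    then show False using E2[OF that] by blast
  qed
  have "2 * (deg S t + deg S r) + (deg S x + deg S v + deg S u + deg S z) \<le> 6 * a"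
    using add_mono[OF I1[unfolded not_less] I2[unfolded not_less]] by simp
  moreover have "deg S t + deg S r + deg S u + deg S v + 2 * (deg S x + deg S z) \<le> 6 * a"
    using I3[of x] I3[of u] I4[of z] I4[of v] by simp
  moreover have "deg S u \<le> a" "deg S v \<le> a"
    using deg_le_ham[OF S(1)] S(2) by auto
  \<comment> \<open>Adding the two inequalities and \<open>deg S u + deg S v \<le> 2 * a\<close>
    bounds three times the sum by \<open>14 * a\<close>. For \<open>a\<close> at least 4, rounding
    down gives at most \<open>6 * (a - 1)\<close>; at \<open>a = 4\<close> the rounding is
    essential.\<close>
  ultimately show ?thesis
    using a(1) by simp
qed

end

subsection \<open>Longest paths and matchings\<close>

lemma even_set_span:
  assumes "finite B" "B \<noteq> {}" "\<And>x y. x \<in> B \<Longrightarrow> y \<in> B \<Longrightarrow> x \<le> y \<Longrightarrow> even (y - x)"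
  shows "Min B + 2 * card B \<le> Max B + (2::nat)"
proof -
  have "Min B \<in> B" "Max B \<in> B" using assms(1,2) by auto
  have "card B \<le> (Max B - Min B) div 2 + 1"
  proof (rule same_parity_card[OF assms(1)])
    fix i assume i: "i \<in> B"
    then have "Min B \<le> i" "i \<le> Max B" using assms(1) by auto
    then show "Min B \<le> i \<and> i \<le> Max B \<and> even (i - Min B)"
      using assms(3)[OF \<open>Min B \<in> B\<close> i] by blast
  qed
  moreover have "Min B \<le> Max B" using assms(1,2) by auto
  ultimately show ?thesis by linarith
qed

text \<open>Here \<open>A\<close> and \<open>B\<close> are the positions, on a longest path, of the neighbours of the two ends of a
  further path with \<open>m\<close> vertices.\<close>

lemma far_positions:
  fixes A B :: "nat set"
  assumes fin: "finite A" "finite B" and ne: "A \<noteq> {}" "B \<noteq> {}"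
    and even: "\<And>x y. x \<in> B \<Longrightarrow> y \<in> B \<Longrightarrow> x \<le> y \<Longrightarrow> even (y - x)"
    and dist: "\<And>x y. x \<in> A \<Longrightarrow> y \<in> B \<Longrightarrow> x < y \<Longrightarrow> x + m + 1 \<le> y"
      "\<And>x y. x \<in> A \<Longrightarrow> y \<in> B \<Longrightarrow> y < x \<Longrightarrow> y + m + 1 \<le> x"
    and odd: "A \<inter> B \<noteq> {} \<Longrightarrow> odd m"
    and s: "a \<le> card A + s1" "a \<le> card B + s2" "2 * s1 \<le> m" "2 * s2 \<le> m" "1 \<le> s1" "1 \<le> s2"
    and first: "\<alpha> \<in> A" "\<And>x. x \<in> B \<Longrightarrow> \<alpha> \<le> x"
  shows "(\<exists>x\<in>A. \<exists>y\<in>B. x < y \<and> 2 * a \<le> y - x + 1 + m) \<or>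
    (\<exists>x\<in>A. \<exists>y\<in>B. y < x \<and> 2 * a \<le> x - y + 1 + m) \<or> (\<exists>x\<in>A \<inter> B. 2 * a \<le> m + 1)"
\<comment> \<open>If \<open>B\<close> has a position after \<open>\<alpha>\<close>, the cycle goes
  from \<open>\<alpha>\<close> to the last position in \<open>B\<close> and back along the further
  path: the gap after \<open>\<alpha>\<close> is at least \<open>m + 1\<close>, and later positions
  in \<open>B\<close> are at least 2 apart. This outweighs the neighbours, at most half of
  \<open>m\<close>, that an end has on its own path, because \<open>m\<close> is at least 2.\<close>
proof (cases "B - {\<alpha>} = {}")
  case False
  define B' where "B' = B - {\<alpha>}"
  have B': "finite B'" "B' \<noteq> {}" "B' \<subseteq> B" "card B \<le> card B' + 1" "\<alpha> \<in> B \<or> card B = card B'"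
    using fin False unfolding B'_def by (auto simp: card_Diff_singleton_if)
  have "Min B' + 2 * card B' \<le> Max B' + 2"
    using B' even by (intro even_set_span) auto
  moreover have mm: "Min B' \<in> B'" "Max B' \<in> B'" using B' by auto
  then have "Min B' \<in> B" "\<alpha> < Min B'" using first(2) B' unfolding B'_def by (auto simp: order.not_eq_order_implies_strict)
  then have "\<alpha> + m + 1 \<le> Min B'" using dist(1) first(1) by blast
  moreover have "\<alpha> < Max B'" using B' mm \<open>\<alpha> < Min B'\<close> by (meson Min_le le_trans less_le_trans)
  ultimately show ?thesis
    using s B'(4) mm first(1) B'(3) by (intro disjI1 bexI[of _ \<alpha>] bexI[of _ "Max B'"]) auto
next
  case True
  then have B: "B = {\<alpha>}" using ne by auto
  \<comment> \<open>With a single position in \<open>B\<close>, an end has at least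
    \<open>a - 1\<close> neighbours on its own path, which is then almost long enough itself. Parity
    or a second position in \<open>A\<close> supplies what is missing.\<close>
  then have m: "2 * a \<le> m + 2" using s by auto
  show ?thesis
  proof (cases "A = {\<alpha>}")
    case True
    then have "odd m" using odd B by auto
    then have "2 * a \<le> m + 1" using m by presburger
    then show ?thesis using True B by auto
  next
    case False
    then obtain x where x: "x \<in> A" "x \<noteq> \<alpha>" using ne by auto
    then consider "x < \<alpha>" | "\<alpha> < x" by linarith
    then show ?thesis
    proof cases
      case 1
      then have "x + m + 1 \<le> \<alpha>" using dist(1) x B by auto
      then show ?thesis using m x 1 B by (intro disjI1 bexI[of _ x] bexI[of _ \<alpha>]) auto
    next
      case 2
      then have "\<alpha> + m + 1 \<le> x" using dist(2) x B by auto
      then show ?thesis using m x 2 B by (intro disjI2 disjI1 bexI[of _ x] bexI[of _ \<alpha>]) auto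
    qed
  qed
qed

context coloured_graph begin

lemma deg_Un:
  "finite S \<Longrightarrow> finite T \<Longrightarrow> S \<inter> T = {} \<Longrightarrow> deg (S \<union> T) v = deg S v + deg T v"
  unfolding ndeg_def by (subst card_Un_disjoint[symmetric]) (auto intro!: arg_cong[of _ _ card])

lemma deg_hd_le:
  assumes "path Q"
  shows "2 * deg (set Q) (hd Q) \<le> length Q"
proof -
  have "deg (set Q) (hd Q) \<le> card {v \<in> set Q. c v = (\<not> c (hd Q))}"
    unfolding ndeg_def using adj_colour by (intro card_mono) auto
  then show ?thesis using path_colour_count[OF assms, of "\<not> c (hd Q)"] by simp
qed

text \<open>Routing \<open>P\<close> through \<open>Q\<close> cannot lengthen it, so a neighbour of
  \<open>hd Q\<close> and a neighbour of \<open>last Q\<close> on \<open>P\<close> coincide or are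
  more than \<open>length Q\<close> positions apart. Neighbours that far apart close into a long
  cycle through \<open>Q\<close>.\<close>

lemma ham_two_paths:
  assumes P: "path P" and Q: "path Q" and dis: "set P \<inter> set Q = {}" and a: "2 \<le> a"
    and longest: "\<And>P'. path P' \<Longrightarrow> set P' \<subseteq> set P \<union> set Q \<Longrightarrow> length P' \<le> length P"
    and deg: "a \<le> deg (set P \<union> set Q) (hd Q)" "a \<le> deg (set P \<union> set Q) (last Q)"
  shows "\<exists>T \<subseteq> set P \<union> set Q. ham T \<and> 2 * a \<le> card T"
proof (rule ccontr)
  assume none: "\<not> ?thesis"
  have no_cyc: "length xs < 2 * a" if "cyc xs" "set xs \<subseteq> set P \<union> set Q" for xs
  proof -
    have "card (set xs) = length xs" using that(1) by (intro distinct_card) (auto simp: gcycle_def gpath_def)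
    then show ?thesis using none hamI[OF that(1)] that(2) by force
  qed
  define m where "m = length Q"
  have Qne: "Q \<noteq> []" and dQ: "distinct Q" using Q by (auto simp: gpath_def)
  \<comment> \<open>Otherwise a long cycle lies within \<open>Q\<close>. Hence both ends of
    \<open>Q\<close> have neighbours on \<open>P\<close>.\<close>
  have own: "deg (set Q') (hd Q') < a" if p: "path Q'" "set Q' = set Q" for Q'
  proof (rule ccontr)
    assume *: "\<not> ?thesis"
    obtain q qs where q: "Q' = q # qs" using p by (cases Q') (auto simp: gpath_def)
    have "{w \<in> set Q'. adj q w} = {w \<in> set qs. adj q w}"
      using adj_irrefl by (auto simp: q)
    then have "a \<le> deg (set qs) q" using * by (simp add: q ndeg_def)
    moreover from this have "qs \<noteq> []" using a by (auto simp: ndeg_def)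
    ultimately obtain T where "ham T" "T \<subseteq> insert q (set qs)" "2 * a \<le> card T"
      using ham_from_neighbours[of qs q a] p(1) a by (auto simp: q path_Cons_iff)
    then show False using none p(2) q by auto
  qed
  define s1 where "s1 = deg (set Q) (hd Q)"
  define s2 where "s2 = deg (set Q) (last Q)"
  have rQ: "path (rev Q)" "hd (rev Q) = last Q" using path_rev[OF Q] Qne by (auto simp: hd_rev)
  have s_lt: "s1 < a" "s2 < a" using own[OF Q] own[OF rQ(1)] rQ(2) by (auto simp: s1_def s2_def)
  have s_le: "2 * s1 \<le> m" "2 * s2 \<le> m"
    using deg_hd_le[OF Q] deg_hd_le[OF rQ(1)] rQ(2) by (auto simp: s1_def s2_def m_def)
  define A where "A = {i. i < length P \<and> adj (hd Q) (P ! i)}"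
  define B where "B = {i. i < length P \<and> adj (last Q) (P ! i)}"
  have cards: "a \<le> card A + s1" "a \<le> card B + s2"
    using deg nbr_positions[OF P] deg_Un[of "set P" "set Q"] dis by (auto simp: A_def B_def s1_def s2_def)
  have "m \<noteq> 1"
  proof
    assume "m = 1"
    then obtain q where q: "Q = [q]" by (auto simp: m_def length_Suc_conv)
    then have "s1 = 0" using adj_irrefl by (auto simp: s1_def ndeg_def)
    then have "a \<le> deg (set P) q" using cards nbr_positions[OF P, of q] by (simp add: A_def q)
    then show False using ham_from_neighbours[OF P, of q a] a none dis q by auto
  qed
  then have m2: "2 \<le> m" using Qne by (cases Q) (auto simp: m_def Suc_le_eq)
  have sge: "1 \<le> deg (set Q') (hd Q')" if p: "path Q'" "2 \<le> length Q'" for Q'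
  proof -
    obtain q q' qs where q: "Q' = q # q' # qs" using p by (cases Q'; cases "tl Q'") auto
    then have "q' \<in> {w \<in> set Q'. adj q w}" using p(1) by (auto simp: gpath_def)
    then have "{w \<in> set Q'. adj q w} \<noteq> {}" by blast
    then have "0 < deg (set Q') q" by (simp add: ndeg_def card_gt_0_iff)
    then show ?thesis using q by simp
  qed
  have s1: "1 \<le> s1" "1 \<le> s2"
    using sge[OF Q] sge[OF rQ(1)] m2 rQ(2) by (auto simp: s1_def s2_def m_def)
  have fin: "finite A" "finite B" by (auto simp: A_def B_def)
  have "A \<noteq> {}" "B \<noteq> {}" using cards s_lt by auto
  have even: "even (y - x)" if "x \<le> y" "x \<in> A \<and> y \<in> A \<or> x \<in> B \<and> y \<in> B" for x y
    using that adj_colour by (intro nbr_parity[OF P]) (auto simp: A_def B_def)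
  \<comment> \<open>\<open>P\<close> up to \<open>x\<close>, then \<open>Q'\<close>, then
    \<open>P\<close> from \<open>y\<close> on is a path and so not longer than \<open>P\<close>; the
    segment from \<open>x\<close> to \<open>y\<close> together with \<open>Q'\<close> is a
    cycle.\<close>
  have detour: "x + m + 1 \<le> y" "length (seg P x y @ rev Q') = y - x + 1 + m" "y - x + 1 + m < 2 * a"
    if "path Q'" "set Q' = set Q" "length Q' = m" "adj (hd Q') (P ! x)" "adj (last Q') (P ! y)"
      "x < y" "y < length P" for Q' x y
  proof -
    have Q'ne: "Q' \<noteq> []" using that(1) by (auto simp: gpath_def)
    have b: "x < length P" "y \<le> length P - 1" "length P - 1 < length P" "x \<le> y"
      using that by auto
    note seg1 = seg_simps[OF le0 b(1)] path_seg[OF P le0 b(1)]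
    note seg2 = seg_simps[OF b(2,3)] path_seg[OF P b(2,3)]
    note seg3 = seg_simps[OF b(4) that(7)] path_seg[OF P b(4) that(7)]
    have "set (take (Suc x) P) \<inter> set (drop y P) = {}"
      using P that set_take_disj_set_drop_if_distinct[of P "Suc x" y] by (auto simp: gpath_def)
    then have "set (seg P 0 x) \<inter> set (seg P y (length P - 1)) = {}"
      using that by (auto simp: seg_def)
    then have "path (seg P 0 x @ Q' @ seg P y (length P - 1))"
      using seg1 seg2 that Q'ne dis adj_sym by (auto simp: path_append_iff)
    moreover have "set (seg P 0 x @ Q' @ seg P y (length P - 1)) \<subseteq> set P \<union> set Q"
      using seg1 seg2 that by auto
    ultimately have "length (seg P 0 x @ Q' @ seg P y (length P - 1)) \<le> length P"
      by (rule longest)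
    then show "x + m + 1 \<le> y"
      using seg1 seg2 that by simp
    show len: "length (seg P x y @ rev Q') = y - x + 1 + m"
      using seg3 that by simp
    have "path (seg P x y @ rev Q')"
      using seg3 that Q'ne dis path_rev[OF that(1)] adj_sym by (auto simp: path_append_iff hd_rev)
    then have "cyc (seg P x y @ rev Q')"
      using seg3 that Q'ne len m2 by (auto simp: gcycle_def last_rev)
    then show "y - x + 1 + m < 2 * a"
      using no_cyc[of "seg P x y @ rev Q'"] seg3 that len by auto
  qed
  have AB: "x + m + 1 \<le> y" "y - x + 1 + m < 2 * a" if "x \<in> A" "y \<in> B" "x < y" for x y
    using detour[OF Q, of x y] that by (auto simp: A_def B_def m_def)
  have BA: "x + m + 1 \<le> y" "y - x + 1 + m < 2 * a" if "x \<in> B" "y \<in> A" "x < y" for x y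
    using detour[OF rQ(1), of x y] that rQ(2) Qne by (auto simp: A_def B_def m_def last_rev)
  \<comment> \<open>A common neighbour of the two ends forces them to have the same colour, and it
    closes \<open>Q\<close> into a cycle.\<close>
  have same: "odd m" "m + 1 < 2 * a" if x: "x \<in> A \<inter> B" for x
  proof -
    have "c (hd Q) = c (last Q)" using x adj_colour[of "hd Q"] adj_colour[of "last Q"] by (auto simp: A_def B_def)
    then show "odd m"
      using path_colour[OF Q, of "m - 1"] Qne by (cases m) (auto simp: m_def last_conv_nth)
    have "P ! x \<in> set P" using x by (auto simp: A_def)
    then have "P ! x \<notin> set Q" using dis by blast
    then have "cyc (P ! x # Q)"
      using x Q m2 adj_sym by (auto simp: cyc_Cons_iff A_def B_def m_def)
    then show "m + 1 < 2 * a"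
      using no_cyc[of "P ! x # Q"] x by (auto simp: A_def m_def)
  qed
  \<comment> \<open>\<open>far_positions\<close> is not symmetric: the first neighbour position
    decides which end supplies the set \<open>A\<close> there.\<close>
  define \<alpha> where "\<alpha> = Min (A \<union> B)"
  have \<alpha>: "\<alpha> \<in> A \<union> B" "\<And>x. x \<in> A \<union> B \<Longrightarrow> \<alpha> \<le> x"
    using fin \<open>A \<noteq> {}\<close> Min_in[of "A \<union> B"] by (auto simp: \<alpha>_def)
  show False
  proof (cases "\<alpha> \<in> A")
    case True
    have "(\<exists>x\<in>A. \<exists>y\<in>B. x < y \<and> 2 * a \<le> y - x + 1 + m) \<or>
      (\<exists>x\<in>A. \<exists>y\<in>B. y < x \<and> 2 * a \<le> x - y + 1 + m) \<or> (\<exists>x\<in>A \<inter> B. 2 * a \<le> m + 1)"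
      using fin \<open>A \<noteq> {}\<close> \<open>B \<noteq> {}\<close> even AB(1) BA(1) same(1) cards s_le s1 True \<alpha>(2)
      by (intro far_positions[of A B m a s1 s2 \<alpha>]) blast+
    then show False using AB(2) BA(2) same(2) by (meson not_le)
  next
    case False
    then have "\<alpha> \<in> B" using \<alpha>(1) by auto
    have "(\<exists>x\<in>B. \<exists>y\<in>A. x < y \<and> 2 * a \<le> y - x + 1 + m) \<or>
      (\<exists>x\<in>B. \<exists>y\<in>A. y < x \<and> 2 * a \<le> x - y + 1 + m) \<or> (\<exists>x\<in>B \<inter> A. 2 * a \<le> m + 1)"
      using fin \<open>A \<noteq> {}\<close> \<open>B \<noteq> {}\<close> even AB(1) BA(1) same(1) cards s_le s1 \<open>\<alpha> \<in> B\<close> \<alpha>(2)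
      by (intro far_positions[of B A m a s2 s1 \<alpha>]) blast+
    then show False using AB(2) BA(2) same(2) by (metis Int_iff not_le)
  qed
qed

section \<open>Maximum matchings and closed paths\<close>

definition matching :: "'a set \<Rightarrow> bool \<Rightarrow> ('a \<times> 'a) set \<Rightarrow> bool" where
  "matching D k N \<longleftrightarrow> inj_on fst N \<and> inj_on snd N \<and>
    (\<forall>p\<in>N. fst p \<in> D \<and> snd p \<in> D \<and> c (fst p) = k \<and> adj (fst p) (snd p))"

lemma matchingD:
  assumes "matching D k N" "p \<in> N"
  shows "fst p \<in> D" "snd p \<in> D" "c (fst p) = k" "c (snd p) = (\<not> k)" "adj (fst p) (snd p)"
  using assms adj_colour[of "fst p" "snd p"] by (auto simp: matching_def)

lemma matching_subset:
  assumes "matching D k N" "M \<subseteq> N" "\<And>p. p \<in> M \<Longrightarrow> fst p \<in> E \<and> snd p \<in> E"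
  shows "matching E k M"
  using assms inj_on_subset unfolding matching_def by blast

lemma matching_finite:
  assumes "finite D" "matching D k N"
  shows "finite N"
proof (rule finite_subset)
  show "N \<subseteq> D \<times> D" using matchingD[OF assms(2)] by auto
qed (use assms(1) in auto)

lemma matching_Un:
  assumes "matching D k N" "matching E k M" "D \<inter> E = {}"
  shows "matching (D \<union> E) k (N \<union> M)" "N \<inter> M = {}"
proof -
  note * = matchingD[OF assms(1)] and ** = matchingD[OF assms(2)]
  have inj: "inj_on f (N \<union> M)" if "inj_on f N" "inj_on f M" "f ` N \<subseteq> D" "f ` M \<subseteq> E" for f :: "'a \<times> 'a \<Rightarrow> 'a"
  proof -
    have "f ` (N - M) \<inter> f ` (M - N) = {}" using that(3,4) assms(3) by blast
    then show ?thesis using that(1,2) by (simp add: inj_on_Un)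
  qed
  have "fst ` N \<subseteq> D" "snd ` N \<subseteq> D" "fst ` M \<subseteq> E" "snd ` M \<subseteq> E"
    using *(1,2) **(1,2) by auto
  then show "matching (D \<union> E) k (N \<union> M)"
    using assms(1,2) inj unfolding matching_def by auto
  show "N \<inter> M = {}"
    using *(1) **(1) assms(3) by fastforce
qed

lemma path_perfect_matching:
  assumes "path Q" "c (hd Q) = k" "even (length Q)"
  shows "\<exists>M. matching (set Q) k M \<and> card M = length Q div 2"
  using assms
proof (induction Q rule: induct_list012)
  case (3 x y Q)
  have xy: "adj x y" "x \<noteq> y" "x \<notin> set Q" "y \<notin> set Q"
    using 3(3) by (auto simp: gpath_def)
  have base: "matching {x, y} k {(x, y)}"
    using xy 3(4) by (auto simp: matching_def)
  show ?case
  proof (cases "Q = []")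
    case True
    then show ?thesis using base by (intro exI[of _ "{(x, y)}"]) auto
  next
    case False
    then have Q: "path Q" "adj y (hd Q)" using 3(3) by (auto simp: path_Cons_iff)
    then have "c (hd Q) = k" using 3(4) adj_colour[OF xy(1)] adj_colour[OF Q(2)] by auto
    then obtain M where M: "matching (set Q) k M" "card M = length Q div 2"
      using 3(1) Q(1) 3(5) by auto
    have "{x, y} \<inter> set Q = {}" using xy by auto
    from matching_Un[OF base M(1) this] show ?thesis
      using M(2) matching_finite[OF _ M(1)]
      by (intro exI[of _ "{(x, y)} \<union> M"]) (auto simp: insert_commute)
  qed
qed (auto simp: gpath_def)

text \<open>Fix a maximum matching of \<open>D\<close>. Grow a path of odd length whose removal decreases the matching
  number by exactly half its length (rounded down). Such a path can be grown at an end
  that still has a neighbour outside: an unmatched neighbour would give a larger matching.\<close>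

lemma closed_path:
  assumes fin: "finite D" and less: "card {v \<in> D. c v = (\<not> k)} < card {v \<in> D. c v = k}"
  obtains Q where "path Q" "set Q \<subseteq> D" "c (hd Q) = k" "c (last Q) = k"
    "\<And>w. w \<in> D \<Longrightarrow> adj (hd Q) w \<Longrightarrow> w \<in> set Q" "\<And>w. w \<in> D \<Longrightarrow> adj (last Q) w \<Longrightarrow> w \<in> set Q"
proof -
  have bound: "card N \<le> card {v \<in> D. c v = (\<not> k)}" if "matching D k N" for N
    using that fin matchingD[OF that] by (intro card_inj_on_le[of snd]) (auto simp: matching_def)
  obtain N0 where N0: "matching D k N0" "\<And>N. matching D k N \<Longrightarrow> card N \<le> card N0"
    using ex_has_greatest_nat[of "matching D k" "{}" card "Suc (card {v \<in> D. c v = (\<not> k)})"] bound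
    by (force simp: matching_def less_Suc_eq_le)
  define good where "good Q \<longleftrightarrow> path Q \<and> set Q \<subseteq> D \<and> c (hd Q) = k \<and> c (last Q) = k \<and>
    (\<exists>N. matching (D - set Q) k N \<and> card N + length Q div 2 = card N0)" for Q
  have good_rev: "good (rev Q)" if "good Q" for Q
    using that path_rev[of Q] by (auto simp: good_def gpath_def hd_rev last_rev)
  have odd: "odd (length Q)" if "good Q" for Q
    using that path_colour[of Q "length Q - 1"]
    by (cases Q rule: rev_cases) (auto simp: good_def gpath_def)
  \<comment> \<open>Colour \<open>k\<close> has more vertices than the matching has edges, so one of
    its vertices is unmatched; the path starts there.\<close>
  have "card (fst ` N0) < card {v \<in> D. c v = k}"
    using bound[OF N0(1)] less N0(1) by (simp add: card_image matching_def)
  then have "\<not> {v \<in> D. c v = k} \<subseteq> fst ` N0"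
    using matching_finite[OF fin N0(1)] by (meson card_mono finite_imageI not_le)
  then obtain x0 where x0: "x0 \<in> D" "c x0 = k" "x0 \<notin> fst ` N0" by auto
  have "matching (D - {x0}) k N0"
  proof (rule matching_subset[OF N0(1) subset_refl])
    fix p assume "p \<in> N0"
    then show "fst p \<in> D - {x0} \<and> snd p \<in> D - {x0}"
      using matchingD[OF N0(1), of p] x0 by auto
  qed
  then have good0: "good [x0]"
    using x0 by (auto simp: good_def path_singleton)
  have len: "length Q < Suc (card D)" if "good Q" for Q
    using that fin card_mono[of D "set Q"] distinct_card[of Q] by (auto simp: good_def gpath_def)
  obtain Q where Q: "good Q" "\<And>Q'. good Q' \<Longrightarrow> length Q' \<le> length Q"
    using ex_has_greatest_nat[of good "[x0]" length "Suc (card D)"] good0 len by blast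
  have closed: "w \<in> set Q'" if Q': "good Q'" "length Q' = length Q" and w: "w \<in> D" "adj (last Q') w" for Q' w
  proof (rule ccontr)
    assume out: "w \<notin> set Q'"
    have p: "path Q'" "set Q' \<subseteq> D" "c (hd Q') = k" "c (last Q') = k" "Q' \<noteq> []"
      using Q'(1) by (auto simp: good_def gpath_def)
    obtain N where N: "matching (D - set Q') k N" "card N + length Q' div 2 = card N0"
      using Q'(1) by (auto simp: good_def)
    have pw: "path (Q' @ [w])" using p out w by (simp add: path_snoc_iff)
    show False
    proof (cases "w \<in> snd ` N")
      case False
      \<comment> \<open>\<open>Q'\<close> has odd length, so adding \<open>w\<close> gives a perfect
        matching with one edge more than \<open>good\<close> accounts for.\<close>
      obtain M where M: "matching (set (Q' @ [w])) k M" "card M = length (Q' @ [w]) div 2"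
        using path_perfect_matching[OF pw, of k] p(3,5) odd[OF Q'(1)] by auto
      have "matching (D - set (Q' @ [w])) k N"
      proof (rule matching_subset[OF N(1) subset_refl])
        fix q assume "q \<in> N"
        then show "fst q \<in> D - set (Q' @ [w]) \<and> snd q \<in> D - set (Q' @ [w])"
          using matchingD[OF N(1), of q] False p(4) adj_colour[OF w(2)] by auto
      qed
      from matching_Un[OF this M(1)] have "matching D k (N \<union> M)" "N \<inter> M = {}"
        using p(2) w(1) by (auto simp: Un_absorb2 insert_absorb Diff_partition Un_commute)
      then have "card N + card M \<le> card N0"
        using N0(2)[of "N \<union> M"] matching_finite[OF _ N(1)] matching_finite[OF _ M(1)] fin
        by (simp add: card_Un_disjoint)
      then show False using M(2) N(2) odd[OF Q'(1)] by simp
    next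
      \<comment> \<open>The matching loses the edge \<open>(x, w)\<close> while the path gains these
        two vertices, so the balance in \<open>good\<close> is kept.\<close>
      case True
      then obtain x where x: "(x, w) \<in> N" by auto
      then have x': "x \<in> D" "x \<notin> set Q'" "c x = k" "adj w x" "x \<noteq> w"
        using matchingD[OF N(1) x] adj_sym adj_irrefl by auto
      have "path (Q' @ [w] @ [x])"
        using path_append_iff[of "Q' @ [w]" "[x]"] pw x' by (simp add: path_singleton)
      moreover have "matching (D - set (Q' @ [w] @ [x])) k (N - {(x, w)})"
      proof (rule matching_subset[OF N(1)])
        fix q assume q: "q \<in> N - {(x, w)}"
        then have "fst q \<noteq> x" "snd q \<noteq> w"
          using N(1) x by (auto simp: matching_def inj_on_def)
        then show "fst q \<in> D - set (Q' @ [w] @ [x]) \<and> snd q \<in> D - set (Q' @ [w] @ [x])"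
          using matchingD[OF N(1), of q] q x' p(4) adj_colour[OF w(2)] by auto
      qed auto
      moreover have "card (N - {(x, w)}) + length (Q' @ [w] @ [x]) div 2 = card N0"
        using N(2) x matching_finite[OF _ N(1)] fin card_gt_0_iff[of N] by (auto simp: card_Diff_singleton)
      ultimately have "good (Q' @ [w] @ [x])"
        unfolding good_def using p x' w by auto
      then show False using Q(2)[of "Q' @ [w] @ [x]"] Q'(2) by simp
    qed
  qed
  have "Q \<noteq> []" using Q(1) by (auto simp: good_def gpath_def)
  then have "w \<in> set Q" if "w \<in> D" "adj (hd Q) w" for w
    using closed[OF good_rev[OF Q(1)] _ that(1)] that(2) by (simp add: last_rev)
  moreover have "w \<in> set Q" if "w \<in> D" "adj (last Q) w" for w
    using closed[OF Q(1) refl that] .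
  ultimately show thesis
    using that[of Q] Q(1) unfolding good_def by blast
qed

end

subsection \<open>Extremal families of cycles\<close>

text \<open>The cycles \<open>S j\<close> are to have at least \<open>2 * h j\<close> vertices; \<open>h0\<close> is the half-length required of one
  further cycle, which is to be found in the rest.\<close>

locale cycle_system = coloured_graph adj c
  for adj :: "'a \<Rightarrow> 'a \<Rightarrow> bool" and c :: "'a \<Rightarrow> bool" +
  fixes V :: "'a set" and J :: "'i set" and h :: "'i \<Rightarrow> nat" and h0 :: nat
  assumes finite_V: "finite V" and adj_V: "adj u v \<Longrightarrow> u \<in> V"
    and finite_J: "finite J" and h_ge: "j \<in> J \<Longrightarrow> 3 \<le> h j" and h0_ge: "3 \<le> h0"
    and balanced: "card {v \<in> V. c v = k} = card {v \<in> V. c v = (\<not> k)}"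
    and min_deg: "v \<in> V \<Longrightarrow> h0 + (\<Sum>j\<in>J. h j - 1) \<le> ndeg adj V v"
begin

definition conf :: "('i \<Rightarrow> 'a set) \<Rightarrow> bool" where
  "conf S \<longleftrightarrow> (\<forall>j\<in>J. ham (S j) \<and> 2 * h j \<le> card (S j)) \<and>
    (\<forall>i\<in>J. \<forall>j\<in>J. i \<noteq> j \<longrightarrow> S i \<inter> S j = {})"

definition rest :: "('i \<Rightarrow> 'a set) \<Rightarrow> 'a set" where
  "rest S = V - (\<Union>j\<in>J. S j)"

definition minconf :: "('i \<Rightarrow> 'a set) \<Rightarrow> bool" where
  "minconf S \<longleftrightarrow> conf S \<and> (\<forall>S'. conf S' \<longrightarrow> (\<Sum>j\<in>J. card (S j)) \<le> (\<Sum>j\<in>J. card (S' j)))"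

lemma confD:
  assumes "conf S" "j \<in> J"
  shows "ham (S j)" "2 * h j \<le> card (S j)" "i \<in> J \<Longrightarrow> i \<noteq> j \<Longrightarrow> S i \<inter> S j = {}"
  using assms by (auto simp: conf_def)

lemma ham_in_V: "ham T \<Longrightarrow> T \<subseteq> V"
proof
  fix v assume "ham T" "v \<in> T"
  then obtain vs where "cyc (v # vs)" using ham_through by metis
  then show "v \<in> V" using adj_V by (auto simp: cyc_Cons_iff)
qed

lemma finite_rest: "finite (rest S)"
  using finite_V by (simp add: rest_def)

lemma rest_disjoint: "j \<in> J \<Longrightarrow> rest S \<inter> S j = {}"
  by (auto simp: rest_def)

lemma minconf_conf: "minconf S \<Longrightarrow> conf S"
  by (simp add: minconf_def)

lemma conf_update:
  assumes "conf S" "j \<in> J" "ham T" "2 * h j \<le> card T" "T \<subseteq> rest S \<union> S j"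
  shows "conf (S(j := T))"
proof -
  have *: "S i \<inter> T = {}" if "i \<in> J" "i \<noteq> j" for i
    using confD(3)[OF assms(1,2) that] assms(5) that(1) by (auto simp: rest_def)
  then show ?thesis
    using assms(1-4) unfolding conf_def by (auto simp: Int_commute)
qed

lemma rest_update:
  assumes "conf S" "j \<in> J"
  shows "rest (S(j := T)) = (rest S \<union> S j) - T"
  using confD(3)[OF assms] ham_in_V[OF confD(1)[OF assms]] assms(2)
  by (auto simp: rest_def split: if_splits)

lemma sum_update:
  assumes "j \<in> J"
  shows "(\<Sum>i\<in>J. card ((S(j := T)) i)) + card (S j) = (\<Sum>i\<in>J. card (S i)) + card (T :: 'a set)"
proof -
  have "(\<Sum>i\<in>J - {j}. card ((S(j := T)) i)) = (\<Sum>i\<in>J - {j}. card (S i))"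
    by (rule sum.cong) auto
  then show ?thesis
    using sum.remove[OF finite_J assms, of "\<lambda>i. card (S i)"]
      sum.remove[OF finite_J assms, of "\<lambda>i. card ((S(j := T)) i)"] by simp
qed

lemma minconf_update:
  assumes "minconf S" "j \<in> J" "ham T" "T \<subseteq> rest S \<union> S j" "card T = card (S j)"
  shows "minconf (S(j := T))"
proof -
  have "conf (S(j := T))"
    using assms confD(2)[OF minconf_conf] by (intro conf_update) (auto simp: minconf_conf)
  then show ?thesis
    using assms(1,5) sum_update[OF assms(2), of S T] by (simp add: minconf_def)
qed

lemma swap:
  assumes "minconf S" "j \<in> J" "x \<in> rest S" "u \<in> S j" "ham (insert x (S j - {u}))"
  shows "minconf (S(j := insert x (S j - {u})))"
    "rest (S(j := insert x (S j - {u}))) = insert u (rest S - {x})"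
proof -
  have x: "x \<notin> S j" using assms(2,3) by (auto simp: rest_def)
  have "finite (S j)" using ham_finite confD(1)[OF minconf_conf] assms(1,2) by blast
  then have "card (insert x (S j - {u})) = card (S j)"
    using x assms(4) by (simp add: card.insert_remove card_Diff_singleton card_gt_0_iff)
      (metis Suc_pred card_gt_0_iff empty_iff)
  then show "minconf (S(j := insert x (S j - {u})))"
    using assms by (intro minconf_update) auto
  show "rest (S(j := insert x (S j - {u}))) = insert u (rest S - {x})"
    unfolding rest_update[OF minconf_conf[OF assms(1)] assms(2)]
    using rest_disjoint[OF assms(2), of S] x assms(3,4) by blast
qed

text \<open>With \<open>h j\<close> neighbours on a cycle that is longer than required,
  \<open>v\<close> would yield a smaller cycle that is still long enough, against
  minimality.\<close>

lemma long_cycle_deg: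
  assumes "minconf S" "j \<in> J" "v \<in> rest S" "2 * h j < card (S j)"
  shows "deg (S j) v \<le> h j - 1"
proof (rule ccontr)
  assume "\<not> ?thesis"
  then have "h j \<le> deg (S j) v" "2 \<le> h j" using h_ge[OF assms(2)] by auto
  moreover have "ham (S j)" "v \<notin> S j"
    using assms confD(1)[OF minconf_conf] by (auto simp: rest_def)
  ultimately obtain T where T: "ham T" "T \<subseteq> insert v (S j)" "2 * h j \<le> card T" "card T < card (S j)"
    using shorten_cycle[of "S j" v "h j"] assms(4) by blast
  then have "conf (S(j := T))"
    using assms by (intro conf_update) (auto simp: minconf_conf)
  then show False
    using assms(1) T(4) sum_update[OF assms(2), of S T] by (force simp: minconf_def)
qed

lemma card_conf_filter:
  assumes "conf S"
  shows "card (\<Union>j\<in>J. {w \<in> S j. Q w}) = (\<Sum>j\<in>J. card {w \<in> S j. Q w})"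
proof (rule card_UN_disjoint[OF finite_J])
  show "\<forall>j\<in>J. finite {w \<in> S j. Q w}"
    using ham_finite confD(1)[OF assms] by simp
  show "\<forall>i\<in>J. \<forall>j\<in>J. i \<noteq> j \<longrightarrow> {w \<in> S i. Q w} \<inter> {w \<in> S j. Q w} = {}"
  proof (intro ballI impI)
    fix i j assume "i \<in> J" "j \<in> J" "i \<noteq> j"
    then have "S i \<inter> S j = {}" using assms by (simp add: conf_def)
    then show "{w \<in> S i. Q w} \<inter> {w \<in> S j. Q w} = {}" by blast
  qed
qed

lemma finite_conf_Union: "conf S \<Longrightarrow> finite (\<Union>j\<in>J. S j)"
  using finite_J ham_finite confD(1) by blast

lemma conf_Union_V: "conf S \<Longrightarrow> (\<Union>j\<in>J. S j) \<subseteq> V"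
  using ham_in_V confD(1) by blast

lemma deg_V_split:
  assumes "conf S"
  shows "deg V v = deg (rest S) v + (\<Sum>j\<in>J. deg (S j) v)"
proof -
  have "V = rest S \<union> (\<Union>j\<in>J. S j)" using conf_Union_V[OF assms] by (auto simp: rest_def)
  moreover have "rest S \<inter> (\<Union>j\<in>J. S j) = {}" by (auto simp: rest_def)
  ultimately have "deg V v = deg (rest S) v + deg (\<Union>j\<in>J. S j) v"
    using deg_Un[OF finite_rest finite_conf_Union[OF assms]] by metis
  moreover have "{w \<in> (\<Union>j\<in>J. S j). adj v w} = (\<Union>j\<in>J. {w \<in> S j. adj v w})" by blast
  ultimately show ?thesis
    using card_conf_filter[OF assms, of "adj v"] by (simp add: ndeg_def)
qed

text \<open>Every cycle has equally many vertices of both colours, so removing the cycles keeps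
  \<open>V\<close> balanced.\<close>

lemma rest_balanced:
  assumes "conf S"
  shows "card {v \<in> rest S. c v = k} = card {v \<in> rest S. c v = (\<not> k)}"
proof -
  have *: "card {v \<in> V. c v = k} = card {v \<in> rest S. c v = k} + (\<Sum>j\<in>J. card {v \<in> S j. c v = k})" for k
  proof -
    have "{v \<in> V. c v = k} = {v \<in> rest S. c v = k} \<union> (\<Union>j\<in>J. {v \<in> S j. c v = k})"
      using conf_Union_V[OF assms] by (auto simp: rest_def)
    moreover have "card ({v \<in> rest S. c v = k} \<union> (\<Union>j\<in>J. {v \<in> S j. c v = k})) =
        card {v \<in> rest S. c v = k} + card (\<Union>j\<in>J. {v \<in> S j. c v = k})"
    proof (rule card_Un_disjoint)
      show "finite {v \<in> rest S. c v = k}" using finite_rest by simp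
      show "finite (\<Union>j\<in>J. {v \<in> S j. c v = k})"
        by (rule finite_subset[OF _ finite_conf_Union[OF assms]]) blast
      show "{v \<in> rest S. c v = k} \<inter> (\<Union>j\<in>J. {v \<in> S j. c v = k}) = {}"
        by (auto simp: rest_def)
    qed
    ultimately show ?thesis
      using card_conf_filter[OF assms, of "\<lambda>v. c v = k"] by simp
  qed
  have "card {v \<in> S j. c v = k} = card {v \<in> S j. c v = (\<not> k)}" if "j \<in> J" for j
    using ham_balanced[OF confD(1)[OF assms that], of k] ham_balanced[OF confD(1)[OF assms that], of "\<not> k"]
    by linarith
  then have "(\<Sum>j\<in>J. card {v \<in> S j. c v = k}) = (\<Sum>j\<in>J. card {v \<in> S j. c v = (\<not> k)})"
    by (rule sum.cong[OF refl])
  then show ?thesis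
    using balanced[of k] *[of k] *[of "\<not> k"] by linarith
qed

end

section \<open>Longest paths in the rest of a minimal family\<close>

locale stuck_system = cycle_system adj c V J h h0
  for adj :: "'a \<Rightarrow> 'a \<Rightarrow> bool" and c V and J :: "'i set" and h h0 +
  assumes no_completion: "conf S \<Longrightarrow> ham T \<Longrightarrow> T \<subseteq> rest S \<Longrightarrow> card T < 2 * h0"
begin

text \<open>With \<open>h0\<close> neighbours, all of them on \<open>P\<close>, the first vertex
  would close a cycle of the missing length inside the rest.\<close>

lemma closed_end_deg:
  assumes "conf S" "path P" "set P \<subseteq> rest S"
    and closed: "\<And>w. w \<in> rest S \<Longrightarrow> adj (hd P) w \<Longrightarrow> w \<in> set P"
  shows "deg (rest S) (hd P) < h0"
proof (rule ccontr)
  assume *: "\<not> ?thesis"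
  obtain x vs where P: "P = x # vs" using assms(2) by (cases P) (auto simp: gpath_def)
  have "{w \<in> rest S. adj x w} = {w \<in> set vs. adj x w}"
    using closed assms(3) adj_irrefl by (auto simp: P)
  then have d: "h0 \<le> deg (set vs) x" using * by (simp add: P ndeg_def)
  then have "vs \<noteq> []" using h0_ge by (auto simp: ndeg_def)
  then obtain T where "ham T" "T \<subseteq> insert x (set vs)" "2 * h0 \<le> card T"
    using ham_from_neighbours[of vs x h0] assms(2) d h0_ge by (auto simp: P path_Cons_iff)
  then show False using no_completion[OF assms(1), of T] assms(3) P by auto
qed

text \<open>Both vertices fall short of \<open>h0\<close> in the rest, so together they exceed twice
  the sum of the \<open>h j - 1\<close> on the cycles. Some cycle therefore exceeds its share
  \<open>2 * (h j - 1)\<close>, and by \<open>long_cycle_deg\<close> it has exactly the required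
  length.\<close>

lemma find_tight:
  assumes "minconf S" "x \<in> rest S" "y \<in> rest S" "deg (rest S) x < h0" "deg (rest S) y < h0"
  obtains j where "j \<in> J" "card (S j) = 2 * h j" "2 * h j \<le> deg (S j) x + deg (S j) y + 1"
proof (rule ccontr)
  note found = that
  assume none: "\<not> thesis"
  have "deg (S j) x + deg (S j) y \<le> 2 * (h j - 1)" if j: "j \<in> J" for j
  proof (cases "card (S j) = 2 * h j")
    case True
    then have "\<not> 2 * h j \<le> deg (S j) x + deg (S j) y + 1" using none found j by blast
    then show ?thesis by linarith
  next
    case False
    then have "2 * h j < card (S j)" using confD(2)[OF minconf_conf[OF assms(1)] j] by linarith
    then show ?thesis
      using long_cycle_deg[OF assms(1) j assms(2)] long_cycle_deg[OF assms(1) j assms(3)] by linarith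
  qed
  then have "(\<Sum>j\<in>J. deg (S j) x + deg (S j) y) \<le> (\<Sum>j\<in>J. 2 * (h j - 1))"
    by (rule sum_mono)
  then have "(\<Sum>j\<in>J. deg (S j) x) + (\<Sum>j\<in>J. deg (S j) y) \<le> 2 * (\<Sum>j\<in>J. h j - 1)"
    by (simp add: sum.distrib sum_distrib_left)
  moreover have "x \<in> V" "y \<in> V" using assms(2,3) by (auto simp: rest_def)
  ultimately show False
    using deg_V_split[OF minconf_conf[OF assms(1)], of x] deg_V_split[OF minconf_conf[OF assms(1)], of y]
      min_deg[of x] min_deg[of y] assms(4,5) by linarith
qed

text \<open>The maximum ranges over all minimal families at once, so an exchange with a cycle cannot
  make room for a longer path either.\<close>

definition longest :: "('i \<Rightarrow> 'a set) \<Rightarrow> 'a list \<Rightarrow> bool" where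
  "longest S P \<longleftrightarrow> minconf S \<and> path P \<and> set P \<subseteq> rest S \<and>
    (\<forall>S' P'. minconf S' \<longrightarrow> path P' \<longrightarrow> set P' \<subseteq> rest S' \<longrightarrow> length P' \<le> length P)"

lemma longestD:
  assumes "longest S P"
  shows "minconf S" "conf S" "path P" "set P \<subseteq> rest S" "P \<noteq> []"
    "\<And>S' P'. minconf S' \<Longrightarrow> path P' \<Longrightarrow> set P' \<subseteq> rest S' \<Longrightarrow> length P' \<le> length P"
  using assms by (auto simp: longest_def minconf_def gpath_def)

lemma longest_rev: "longest S P \<Longrightarrow> longest S (rev P)"
  using path_rev by (simp add: longest_def)

text \<open>After an exchange that preserves the length, the bounds for ends of longest paths hold
  for the new ends. This controls vertices that were inside the original path or on a cycle.\<close>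

lemma longest_transfer:
  assumes "longest S P" "minconf S'" "path P'" "set P' \<subseteq> rest S'" "length P' = length P"
  shows "longest S' P'"
  using assms by (auto simp: longest_def)

lemma longest_closed:
  assumes "longest S P" "w \<in> rest S" "adj (hd P) w"
  shows "w \<in> set P"
proof (rule ccontr)
  assume "w \<notin> set P"
  then have "path (w # P)" "set (w # P) \<subseteq> rest S"
    using assms longestD[OF assms(1)] adj_sym by (auto simp: path_Cons_iff)
  then show False using longestD(6)[OF assms(1) longestD(1)[OF assms(1)], of "w # P"] by simp
qed

lemma longest_end_deg: "longest S P \<Longrightarrow> deg (rest S) (hd P) < h0"
  by (rule closed_end_deg[OF longestD(2-4)]) (auto intro: longest_closed)

text \<open>If \<open>v\<close> had low degree, some tight cycle would be almost completely joined
  to \<open>v\<close> and \<open>hd P\<close>. Putting \<open>v\<close> there in place of a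
  neighbour \<open>u\<close> of \<open>hd P\<close> would free \<open>u\<close> to lengthen the
  path.\<close>

lemma longest_outside_deg:
  assumes P: "longest S P" and v: "v \<in> rest S" "v \<notin> set P" "c v \<noteq> c (hd P)"
  shows "h0 \<le> deg (rest S) v"
proof (rule ccontr)
  assume *: "\<not> ?thesis"
  note PD = longestD[OF P]
  have e: "hd P \<in> rest S" "hd P \<in> set P" using PD by auto
  have low: "deg (rest S) v < h0" "deg (rest S) (hd P) < h0"
    using * longest_end_deg[OF P] by auto
  obtain j where j: "j \<in> J" "card (S j) = 2 * h j" "2 * h j \<le> deg (S j) v + deg (S j) (hd P) + 1"
    by (rule find_tight[OF PD(1) v(1) e(1) low])
  have ham: "ham (S j)" using confD(1)[OF PD(2) j(1)] .
  \<comment> \<open>\<open>hd P\<close> plays both \<open>y\<close> and \<open>z\<close> in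
    \<open>exchange_one\<close>. The sum is at least \<open>4 * h j - 2\<close>, which exceeds
    \<open>3 * h j\<close> since \<open>h j\<close> is at least 3.\<close>
  have ge: "2 \<le> h j" "3 * h j < deg (S j) (hd P) + deg (S j) (hd P) + 2 * deg (S j) v"
    using j h_ge[OF j(1)] by linarith+
  have vn: "v \<notin> S j" "c (hd P) = (\<not> c v)" using rest_disjoint[OF j(1), of S] v by auto
  obtain u where u: "u \<in> S j" "adj (hd P) u" "ham (insert v (S j - {u}))"
    by (rule exchange_one[OF ham j(2) ge(1) vn(1) vn(2) vn(2) ge(2)])
  note sw = swap[OF PD(1) j(1) v(1) u(1,3)]
  have "u \<notin> set P" using rest_disjoint[OF j(1), of S] u(1) PD(4) by auto
  then have "path (u # P)" using PD(3,5) adj_sym[OF u(2)] by (simp add: path_Cons_iff)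
  moreover have "set (u # P) \<subseteq> rest (S(j := insert v (S j - {u})))"
    unfolding sw(2) using PD(4) v(2) by auto
  ultimately show False using PD(6)[OF sw(1), of "u # P"] by simp
qed

text \<open>It suffices to find a path \<open>Q\<close> outside \<open>P\<close> whose ends have all
  their neighbours outside \<open>P\<close> on \<open>Q\<close> and at least \<open>h0\<close>
  neighbours in the rest: \<open>ham_two_paths\<close> then gives the missing cycle.\<close>

lemma longest_spans:
  assumes P: "longest S P"
  shows "set P = rest S"
proof (rule ccontr)
  assume "set P \<noteq> rest S"
  note PD = longestD[OF P]
  define D where "D = rest S - set P"
  have D: "D \<noteq> {}" "finite D" using PD \<open>set P \<noteq> rest S\<close> finite_rest by (auto simp: D_def)
  have "\<exists>Q. path Q \<and> set Q \<subseteq> D \<and> (\<forall>w\<in>D. adj (hd Q) w \<longrightarrow> w \<in> set Q) \<and> (\<forall>w\<in>D. adj (last Q) w \<longrightarrow> w \<in> set Q) \<and>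
      h0 \<le> deg (rest S) (hd Q) \<and> h0 \<le> deg (rest S) (last Q)"
  proof (cases "c (hd P) = c (last P)")
    \<comment> \<open>Only outside vertices of colour \<open>k\<close> are known to have large
      degree here. As \<open>P\<close> is odd and the rest is balanced, \<open>D\<close> has a
      surplus of that colour, so \<open>closed_path\<close> gives \<open>Q\<close> with both ends in
      it.\<close>
    case True
    define k where "k = (\<not> c (hd P))"
    have "odd (length P)"
      using path_colour[OF PD(3), of "length P - 1"] PD(5) True by (cases P rule: rev_cases) auto
    then have "card {v \<in> set P. c v = (\<not> k)} = card {v \<in> set P. c v = k} + 1"
      using path_colour_count[OF PD(3)] by (auto simp: k_def elim!: oddE)
    moreover have "card {v \<in> rest S. c v = k'} = card {v \<in> set P. c v = k'} + card {v \<in> D. c v = k'}" for k'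
    proof -
      have "{v \<in> rest S. c v = k'} = {v \<in> set P. c v = k'} \<union> {v \<in> D. c v = k'}"
        using PD(4) by (auto simp: D_def)
      then show ?thesis
        using D(2) by (simp add: card_Un_disjoint D_def disjoint_iff)
    qed
    ultimately have "card {v \<in> D. c v = (\<not> k)} < card {v \<in> D. c v = k}"
      using rest_balanced[OF PD(2), of k] by auto
    then obtain Q where Q: "path Q" "set Q \<subseteq> D" "c (hd Q) = k" "c (last Q) = k"
        "\<And>w. w \<in> D \<Longrightarrow> adj (hd Q) w \<Longrightarrow> w \<in> set Q" "\<And>w. w \<in> D \<Longrightarrow> adj (last Q) w \<Longrightarrow> w \<in> set Q"
      using closed_path[OF D(2)] by blast
    have "hd Q \<in> D" "last Q \<in> D" using Q(1,2) by (auto simp: gpath_def)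
    then have "h0 \<le> deg (rest S) (hd Q)" "h0 \<le> deg (rest S) (last Q)"
      using longest_outside_deg[OF P] Q(3,4) by (auto simp: D_def k_def)
    then show ?thesis using Q by blast
  next
    \<comment> \<open>The ends of \<open>P\<close> have different colours, so all outside vertices
      have large degree and any longest path in \<open>D\<close> will do.\<close>
    case False
    have nonlow: "h0 \<le> deg (rest S) v" if "v \<in> D" for v
    proof (cases "c v = c (hd P)")
      case True
      then show ?thesis
        using longest_outside_deg[OF longest_rev[OF P], of v] that False PD(5) by (auto simp: D_def hd_rev)
    qed (use longest_outside_deg[OF P, of v] that in \<open>auto simp: D_def\<close>)
    obtain v where "v \<in> D" using D by auto
    then have "path [v] \<and> set [v] \<subseteq> D" by (simp add: path_singleton)
    moreover have "\<forall>Q. path Q \<and> set Q \<subseteq> D \<longrightarrow> length Q < Suc (card D)"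
      using D(2) card_mono distinct_card unfolding gpath_def by (metis le_imp_less_Suc)
    ultimately obtain Q where Q: "path Q" "set Q \<subseteq> D"
        "\<And>Q'. path Q' \<Longrightarrow> set Q' \<subseteq> D \<Longrightarrow> length Q' \<le> length Q"
      using ex_has_greatest_nat[of "\<lambda>Q. path Q \<and> set Q \<subseteq> D" "[v]" length "Suc (card D)"] by blast
    have closed: "w \<in> set Q'" if "path Q'" "set Q' = set Q" "length Q' = length Q" "w \<in> D" "adj (hd Q') w" for w Q'
    proof (rule ccontr)
      assume "w \<notin> set Q'"
      moreover have "Q' \<noteq> []" using that(1) by (auto simp: gpath_def)
      ultimately have "path (w # Q')" using that adj_sym by (simp add: path_Cons_iff)
      then show False using Q(3)[of "w # Q'"] that Q(2) by auto
    qed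
    have ends: "hd Q \<in> D" "last Q \<in> D" "hd (rev Q) = last Q" using Q(1,2) by (auto simp: gpath_def hd_rev)
    show ?thesis
      using Q(1,2) closed[OF Q(1) refl refl] closed[of "rev Q"] path_rev[OF Q(1)] nonlow ends by auto
  qed
  then obtain Q where Q: "path Q" "set Q \<subseteq> D" "\<forall>w\<in>D. adj (hd Q) w \<longrightarrow> w \<in> set Q"
      "\<forall>w\<in>D. adj (last Q) w \<longrightarrow> w \<in> set Q" "h0 \<le> deg (rest S) (hd Q)" "h0 \<le> deg (rest S) (last Q)"
    by blast
  have sub: "set P \<union> set Q \<subseteq> rest S" using PD(4) Q(2) by (auto simp: D_def)
  have "deg (rest S) v = deg (set P \<union> set Q) v" if "\<forall>w\<in>D. adj v w \<longrightarrow> w \<in> set Q" for v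
  proof -
    have "{w \<in> rest S. adj v w} = {w \<in> set P \<union> set Q. adj v w}"
      using that sub by (auto simp: D_def)
    then show ?thesis by (simp add: ndeg_def)
  qed
  then have "h0 \<le> deg (set P \<union> set Q) (hd Q)" "h0 \<le> deg (set P \<union> set Q) (last Q)"
    using Q by auto
  moreover have "set P \<inter> set Q = {}" using Q(2) by (auto simp: D_def)
  moreover have "length P' \<le> length P" if "path P'" "set P' \<subseteq> set P \<union> set Q" for P'
    using PD(6)[OF PD(1) that(1)] that(2) sub by blast
  ultimately obtain T where "T \<subseteq> set P \<union> set Q" "ham T" "2 * h0 \<le> card T"
    using ham_two_paths[OF PD(3) Q(1), of h0] h0_ge by auto
  then show False using no_completion[OF PD(2), of T] sub by auto
qed

end

section \<open>Maximising the edges inside the cycles\<close>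

context coloured_graph begin

text \<open>Twice the number of edges inside \<open>S\<close>.\<close>

definition edge_weight :: "'a set \<Rightarrow> nat" where
  "edge_weight S = (\<Sum>v\<in>S. deg S v)"

lemma edge_weight_insert:
  assumes "finite S" "v \<notin> S"
  shows "edge_weight (insert v S) = edge_weight S + 2 * deg S v"
proof -
  have own: "deg (insert v S) v = deg S v"
    unfolding ndeg_def using adj_irrefl by (intro arg_cong[of _ _ card]) auto
  have "deg (insert v S) u = deg S u + (if adj u v then 1 else 0)" for u
  proof -
    have "{w \<in> insert v S. adj u w} = (if adj u v then insert v {w \<in> S. adj u w} else {w \<in> S. adj u w})"
      by auto
    then show ?thesis using assms by (simp add: ndeg_def)
  qed
  then have "(\<Sum>u\<in>S. deg (insert v S) u) = (\<Sum>u\<in>S. deg S u) + (\<Sum>u\<in>S. if adj u v then 1 else 0)"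
    by (simp add: sum.distrib)
  also have "(\<Sum>u\<in>S. if adj u v then 1 else 0) = deg S v"
    using assms(1) by (simp add: ndeg_def sum.If_cases adj_commute Int_def)
  finally show ?thesis
    using assms own by (simp add: edge_weight_def)
qed

lemma ham_replace_dominated:
  assumes "ham S" "w \<in> S" "x \<notin> S" "\<And>v. v \<in> S \<Longrightarrow> adj w v \<Longrightarrow> adj x v"
  shows "ham (insert x (S - {w}))"
proof -
  obtain vs where vs: "cyc (w # vs)" "set (w # vs) = S" using ham_through[OF assms(1,2)] by metis
  have "vs \<noteq> []" "w \<notin> set vs" using vs(1) by (auto simp: cyc_Cons_iff)
  then have ends: "hd vs \<in> S" "last vs \<in> S" using vs(2) by auto
  have "cyc (x # vs)"
    using vs(1) assms(4)[OF ends(1)] assms(4)[OF ends(2)] assms(3) vs(2) by (auto simp: cyc_Cons_iff)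
  from hamI[OF this] show ?thesis
    using vs(2) \<open>w \<notin> set vs\<close> by (auto simp: insert_Diff_if)
qed

end

context cycle_system begin

lemma card_rest:
  assumes "conf S"
  shows "card (rest S) + (\<Sum>j\<in>J. card (S j)) = card V"
proof -
  have "V = rest S \<union> (\<Union>j\<in>J. S j)" using conf_Union_V[OF assms] by (auto simp: rest_def)
  moreover have "rest S \<inter> (\<Union>j\<in>J. S j) = {}" by (auto simp: rest_def)
  ultimately have "card V = card (rest S) + card (\<Union>j\<in>J. S j)"
    using card_Un_disjoint[OF finite_rest finite_conf_Union[OF assms]] by metis
  then show ?thesis using card_conf_filter[OF assms, of "\<lambda>_. True"] by simp
qed

definition total_weight :: "('i \<Rightarrow> 'a set) \<Rightarrow> nat" where
  "total_weight S = (\<Sum>j\<in>J. edge_weight (S j))"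

lemma total_weight_update:
  assumes "j \<in> J"
  shows "total_weight (S(j := T)) + edge_weight (S j) = total_weight S + edge_weight T"
proof -
  have "(\<Sum>i\<in>J - {j}. edge_weight ((S(j := T)) i)) = (\<Sum>i\<in>J - {j}. edge_weight (S i))"
    by (rule sum.cong) auto
  then show ?thesis
    unfolding total_weight_def
    using sum.remove[OF finite_J assms, of "\<lambda>i. edge_weight (S i)"]
      sum.remove[OF finite_J assms, of "\<lambda>i. edge_weight ((S(j := T)) i)"] by simp
qed

lemma total_weight_bound:
  assumes "conf S"
  shows "total_weight S \<le> card J * (card V * card V)"
proof -
  have "edge_weight (S j) \<le> card V * card V" if "j \<in> J" for j
  proof -
    have sub: "S j \<subseteq> V" using ham_in_V confD(1)[OF assms that] .
    have "deg (S j) v \<le> card V" for v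
      unfolding ndeg_def using sub finite_V by (intro card_mono) auto
    then have "edge_weight (S j) \<le> card (S j) * card V"
      unfolding edge_weight_def using sum_bounded_above[of "S j" "deg (S j)" "card V"] by simp
    also have "\<dots> \<le> card V * card V" using sub finite_V by (simp add: card_mono)
    finally show ?thesis .
  qed
  then show ?thesis
    unfolding total_weight_def using sum_bounded_above[of J "\<lambda>j. edge_weight (S j)"] by simp
qed

end

context stuck_system begin

lemma no_cycle_in_rest:
  assumes "conf S" "cyc xs" "set xs \<subseteq> rest S"
  shows "length xs < 2 * h0"
proof -
  have "card (set xs) = length xs" using assms(2) by (intro distinct_card) (auto simp: gcycle_def gpath_def)
  then show ?thesis using no_completion[OF assms(1) hamI[OF assms(2)] assms(3)] by simp
qed

definition heaviest :: "('i \<Rightarrow> 'a set) \<Rightarrow> 'a list \<Rightarrow> bool" where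
  "heaviest S P \<longleftrightarrow> longest S P \<and> (\<forall>S' P'. longest S' P' \<longrightarrow> total_weight S' \<le> total_weight S)"

lemma heaviest_rev: "heaviest S P \<Longrightarrow> heaviest S (rev P)"
  using longest_rev by (simp add: heaviest_def)

lemma heaviest_exists:
  assumes "conf S0" "2 * h0 \<le> card (rest S0)"
  obtains S P where "heaviest S P" "2 * h0 \<le> length P" "c (hd P) \<noteq> c (last P)"
proof -
  obtain S1 where S1: "conf S1" "\<And>S'. conf S' \<Longrightarrow> (\<Sum>j\<in>J. card (S1 j)) \<le> (\<Sum>j\<in>J. card (S' j))"
    using ex_has_least_nat[of conf S0 "\<lambda>S. \<Sum>j\<in>J. card (S j)"] assms(1) by blast
  \<comment> \<open>A minimal family uses no more vertices than \<open>S0\<close>, so its rest is at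
    least as large.\<close>
  have big: "2 * h0 \<le> card (rest S)" if "minconf S" for S
  proof -
    have "(\<Sum>j\<in>J. card (S j)) \<le> (\<Sum>j\<in>J. card (S0 j))"
      using that assms(1) by (simp add: minconf_def)
    then show ?thesis
      using assms(2) card_rest[OF assms(1)] card_rest[OF minconf_conf[OF that]] by linarith
  qed
  have min1: "minconf S1" using S1 by (simp add: minconf_def)
  then have "rest S1 \<noteq> {}" using big[OF min1] h0_ge by auto
  then obtain v where v: "v \<in> rest S1" by auto
  define path_in where "path_in SP \<longleftrightarrow> minconf (fst SP) \<and> path (snd SP) \<and> set (snd SP) \<subseteq> rest (fst SP)" for SP
  have "path_in (S1, [v])" using min1 v by (simp add: path_in_def path_singleton)
  moreover have "length (snd SP) < Suc (card V)" if "path_in SP" for SP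
  proof -
    have "set (snd SP) \<subseteq> V" "distinct (snd SP)"
      using that by (auto simp: path_in_def rest_def gpath_def)
    then show ?thesis
      using card_mono[OF finite_V, of "set (snd SP)"] distinct_card[of "snd SP"] by simp
  qed
  ultimately obtain SP where SP: "path_in SP" "\<And>SP'. path_in SP' \<Longrightarrow> length (snd SP') \<le> length (snd SP)"
    using ex_has_greatest_nat[of path_in "(S1, [v])" "\<lambda>SP. length (snd SP)" "Suc (card V)"] by blast
  have "length P' \<le> length (snd SP)" if "minconf S'" "path P'" "set P' \<subseteq> rest S'" for S' P'
    using SP(2)[of "(S', P')"] that by (simp add: path_in_def)
  then have "longest (fst SP) (snd SP)"
    using SP(1) by (simp add: longest_def path_in_def)
  then have ex: "\<exists>P. longest (fst SP) P" by blast
  have "\<forall>S. (\<exists>P. longest S P) \<longrightarrow> total_weight S < Suc (card J * (card V * card V))"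
    using total_weight_bound longestD(2) by (blast intro: le_imp_less_Suc)
  from ex_has_greatest_nat[of "\<lambda>S. \<exists>P. longest S P", OF ex this]
  obtain S P where SP: "longest S P" "\<And>S' P'. longest S' P' \<Longrightarrow> total_weight S' \<le> total_weight S"
    by blast
  have len: "length P = card (rest S)"
    using longest_spans[OF SP(1)] longestD(3)[OF SP(1)] distinct_card[of P] by (auto simp: gpath_def)
  \<comment> \<open>The path spans the rest, which is balanced, so its length is even.\<close>
  have "c (hd P) \<noteq> c (last P)"
  proof
    assume eq: "c (hd P) = c (last P)"
    note PD = longestD[OF SP(1)]
    have "odd (length P)"
      using path_colour[OF PD(3), of "length P - 1"] PD(5) eq by (cases P rule: rev_cases) auto
    then obtain m where "length P = 2 * m + 1" by (auto elim: oddE)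
    then show False
      using path_colour_count[OF PD(3), of "c (hd P)"] path_colour_count[OF PD(3), of "\<not> c (hd P)"]
        rest_balanced[OF PD(2), of "c (hd P)"] longest_spans[OF SP(1)] by simp
  qed
  moreover have "heaviest S P" using SP by (auto simp: heaviest_def)
  moreover have "2 * h0 \<le> length P" using big[OF longestD(1)[OF SP(1)]] len by simp
  ultimately show thesis by (intro that[of S P])
qed

text \<open>\<open>x\<close> is adjacent to all vertices of the other colour in \<open>S j\<close>
  and can replace \<open>w\<close>, while \<open>w\<close> extends the remaining path at
  \<open>hd M\<close> or at \<open>z\<close>. The new pair is again longest, so no edges are gained,
  and \<open>w\<close> has as many neighbours in \<open>S j\<close> as \<open>x\<close>.\<close>

lemma heaviest_full:
  assumes H: "heaviest S P" and P: "P = x # M @ [z]" "M \<noteq> []" and cz: "c x \<noteq> c z"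
    and j: "j \<in> J" "card (S j) = 2 * h j" "deg (S j) x = h j"
    and w: "w \<in> S j" "adj (hd M) w \<or> adj z w"
  shows "deg (S j) w = h j"
proof -
  have L: "longest S P" using H by (simp add: heaviest_def)
  note PD = longestD[OF L]
  have ham: "ham (S j)" using confD(1)[OF PD(2) j(1)] .
  have fin: "finite (S j)" using ham_finite[OF ham] .
  have x: "x \<in> rest S" "x \<notin> S j" using PD(4) P rest_disjoint[OF j(1), of S] by auto
  have pth: "path (M @ [z])" "adj x (hd M)" "x \<notin> set (M @ [z])"
    using PD(3) P path_Cons_iff[of "M @ [z]" x] by auto
  have cw: "c w = c x" using w(2) cz pth(2) adj_colour by metis
  have wn: "w \<notin> set P" using rest_disjoint[OF j(1), of S] w(1) PD(4) by auto
  have "adj x v" if "v \<in> S j" "adj w v" for v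
    using full_adjacent[OF ham j(2,3) that(1)] adj_colour[OF that(2)] cw by auto
  then have T: "ham (insert x (S j - {w}))"
    using ham_replace_dominated[OF ham w(1) x(2)] by blast
  define S' where "S' = S(j := insert x (S j - {w}))"
  note sw = swap[OF PD(1) j(1) x(1) w(1) T, folded S'_def]
  have "\<exists>P'. path P' \<and> set P' = insert w (set (M @ [z])) \<and> length P' = length P"
  proof (cases "adj z w")
    case True
    then have "path ((M @ [z]) @ [w])"
      using pth wn P by (subst path_snoc_iff) auto
    then show ?thesis using P by (intro exI[of _ "(M @ [z]) @ [w]"]) auto
  next
    case False
    then have "path (w # M @ [z])"
      using pth wn P w(2) adj_sym by (subst path_Cons_iff) auto
    then show ?thesis using P by (intro exI[of _ "w # M @ [z]"]) auto
  qed
  then obtain P' where P': "path P'" "set P' = insert w (set (M @ [z]))" "length P' = length P" by blast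
  have "set P' \<subseteq> rest S'" unfolding sw(2) P'(2) using PD(4) P pth(3) by auto
  then have "longest S' P'" using longest_transfer[OF L sw(1) P'(1)] P'(3) by blast
  then have "total_weight S' \<le> total_weight S" using H by (auto simp: heaviest_def)
  then have "edge_weight (insert x (S j - {w})) \<le> edge_weight (S j)"
    using total_weight_update[OF j(1), of S "insert x (S j - {w})"] by (simp add: S'_def)
  moreover have "edge_weight (S j) = edge_weight (S j - {w}) + 2 * deg (S j - {w}) w"
    using edge_weight_insert[of "S j - {w}" w] w(1) fin by (simp add: insert_absorb)
  moreover have "edge_weight (insert x (S j - {w})) = edge_weight (S j - {w}) + 2 * deg (S j - {w}) x"
    using edge_weight_insert[of "S j - {w}" x] fin x(2) by simp
  ultimately have "deg (S j - {w}) x \<le> deg (S j - {w}) w" by linarith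
  \<comment> \<open>\<open>x\<close> and \<open>w\<close> have the same colour, so deleting
    \<open>w\<close> changes neither degree.\<close>
  moreover have "deg (S j - {w}) v = deg (S j) v" if "\<not> adj v w" for v
    unfolding ndeg_def using that by (intro arg_cong[of _ _ card]) auto
  ultimately have "h j \<le> deg (S j) w"
    using j(3) cw adj_colour adj_irrefl by metis
  then show ?thesis using deg_le_ham[OF ham, of w] j(2) by linarith
qed

lemma no_configuration:
  assumes "conf S0" "2 * h0 \<le> card (rest S0)"
  shows False
proof -
  obtain S P where H: "heaviest S P" and long: "2 * h0 \<le> length P" and cols: "c (hd P) \<noteq> c (last P)"
    using heaviest_exists[OF assms] by blast
  have L: "longest S P" using H by (simp add: heaviest_def)
  note PD = longestD[OF L]
  define x where "x = hd P"
  define z where "z = last P"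
  define M where "M = butlast (tl P)"
  have P: "P = x # M @ [z]"
    using long h0_ge unfolding x_def z_def M_def by (cases P; cases "tl P" rule: rev_cases) auto
  have lenM: "4 \<le> length M" "2 * h0 \<le> length M + 2" using long h0_ge P by auto
  then have "M \<noteq> []" by auto
  define t where "t = hd M"
  define r where "r = last M"
  have tr: "t \<in> set M" "r \<in> set M" using \<open>M \<noteq> []\<close> by (auto simp: t_def r_def)
  have pth: "path M" "adj x t" "adj r z" "x \<notin> set M" "z \<notin> set M" "x \<noteq> z"
    using PD(3) \<open>M \<noteq> []\<close> unfolding P t_def r_def by (auto simp: path_Cons_iff path_snoc_iff)
  have cz: "c z = (\<not> c x)" using cols by (simp add: x_def z_def)
  have ct: "c t = (\<not> c x)" "c r = c x" using adj_colour[OF pth(2)] adj_colour[OF pth(3)] cz by auto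
  have inR: "x \<in> rest S" "z \<in> rest S" "set M \<subseteq> rest S" using PD(4) P by auto
  have lows: "deg (rest S) x < h0" "deg (rest S) z < h0"
    using longest_end_deg[OF L] longest_end_deg[OF longest_rev[OF L]] PD(5)
    by (auto simp: x_def z_def hd_rev)
  \<comment> \<open>A vertex \<open>w\<close> freed from a cycle replaces the end \<open>x\<close>
    by joining \<open>t\<close> to \<open>z\<close>; the resulting cycle is as long as
    \<open>P\<close>.\<close>
  have close_left: False
    if "conf S'" "insert w (insert z (set M)) \<subseteq> rest S'" "w \<notin> set P" "adj t w" "adj z w" for S' w
  proof -
    have "cyc (w # M @ [z])"
      using that(3-5) pth \<open>M \<noteq> []\<close> lenM adj_sym P by (auto simp: cyc_Cons_iff path_snoc_iff t_def r_def)
    then show False using no_cycle_in_rest[OF that(1), of "w # M @ [z]"] that(2) lenM by auto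
  qed
  have close_right: False
    if "conf S'" "insert w (insert x (set M)) \<subseteq> rest S'" "w \<notin> set P" "adj r w" "adj x w" for S' w
  proof -
    have "cyc (w # x # M)"
      using that(3-5) pth \<open>M \<noteq> []\<close> lenM adj_sym P by (auto simp: cyc_Cons_iff path_Cons_iff t_def r_def)
    then show False using no_cycle_in_rest[OF that(1), of "w # x # M"] that(2) lenM by auto
  qed
  \<comment> \<open>Both ends are replaced by an edge freed from a cycle.\<close>
  have close_both: False
    if "conf S'" "insert w (insert w' (set M)) \<subseteq> rest S'" "w \<notin> set P" "w' \<notin> set P"
      "adj t w" "adj r w'" "adj w w'" for S' w w'
  proof -
    have "w \<noteq> w'" using that(7) adj_irrefl by auto
    then have "cyc (w' # w # M)"
      using that(3-7) pth \<open>M \<noteq> []\<close> lenM adj_sym P by (auto simp: cyc_Cons_iff path_Cons_iff t_def r_def)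
    then show False using no_cycle_in_rest[OF that(1), of "w' # w # M"] that(2) lenM by auto
  qed
  have outP: "w \<notin> set P" if "w \<in> S j" "j \<in> J" for w j
    using rest_disjoint[OF that(2), of S] that(1) PD(4) by auto

  obtain A where A: "A \<in> J" "card (S A) = 2 * h A" "2 * h A \<le> deg (S A) x + deg (S A) z + 1"
    using find_tight[OF PD(1) inR(1,2) lows] by blast
  have hamA: "ham (S A)" using confD(1)[OF PD(2) A(1)] .
  have hA: "3 \<le> h A" "2 \<le> h A" using h_ge[OF A(1)] by auto
  have nA: "x \<notin> S A" "z \<notin> S A" using rest_disjoint[OF A(1), of S] inR by auto
  have big: "3 * h A < deg (S A) z + deg (S A) z + 2 * deg (S A) x"
    "3 * h A < deg (S A) x + deg (S A) x + 2 * deg (S A) z"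
    using A(3) hA by linarith+
  have cx: "c x = (\<not> c z)" using cz by simp
  \<comment> \<open>\<open>x\<close> takes the place of \<open>u\<close> on the cycle, and
    \<open>u\<close> extends the path beyond \<open>z\<close>; symmetrically for \<open>z\<close>
    and \<open>v\<close>.\<close>
  obtain u where u: "u \<in> S A" "c u = c x" "adj z u" "ham (insert x (S A - {u}))"
    by (rule exchange_one[OF hamA A(2) hA(2) nA(1) cz cz big(1)])
  obtain v where v: "v \<in> S A" "c v = c z" "adj x v" "ham (insert z (S A - {v}))"
    by (rule exchange_one[OF hamA A(2) hA(2) nA(2) cx cx big(2)])
  define Su where "Su = S(A := insert x (S A - {u}))"
  define Sv where "Sv = S(A := insert z (S A - {v}))"
  note swu = swap[OF PD(1) A(1) inR(1) u(1,4), folded Su_def]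
  note swv = swap[OF PD(1) A(1) inR(2) v(1,4), folded Sv_def]
  note confu = minconf_conf[OF swu(1)] and confv = minconf_conf[OF swv(1)]
  have uv_out: "u \<notin> set P" "v \<notin> set P" using outP u(1) v(1) A(1) by auto
  have Lu: "longest Su (M @ [z, u])"
  proof (rule longest_transfer[OF L swu(1)])
    show "path (M @ [z, u])"
      using path_snoc_iff[of "M @ [z]" u] path_snoc_iff[of M z] pth uv_out u(3) \<open>M \<noteq> []\<close> P
      by (auto simp: r_def)
    show "set (M @ [z, u]) \<subseteq> rest Su" unfolding swu(2) using inR pth by auto
  qed (simp add: P)
  have Lv: "longest Sv (v # x # M)"
  proof (rule longest_transfer[OF L swv(1)])
    show "path (v # x # M)"
      using pth uv_out v(3) \<open>M \<noteq> []\<close> P adj_sym by (auto simp: path_Cons_iff t_def)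
    show "set (v # x # M) \<subseteq> rest Sv" unfolding swv(2) using inR pth by auto
  qed (simp add: P)
  have lowu: "deg (rest Su) t < h0" "deg (rest Su) u < h0"
    using longest_end_deg[OF Lu] longest_end_deg[OF longest_rev[OF Lu]] \<open>M \<noteq> []\<close>
    by (auto simp: t_def hd_append)
  have lowv: "deg (rest Sv) r < h0" "deg (rest Sv) v < h0"
    using longest_end_deg[OF longest_rev[OF Lv]] longest_end_deg[OF Lv] \<open>M \<noteq> []\<close>
    by (auto simp: r_def hd_append hd_rev)
  have grow: "deg (rest S) y \<le> deg T y + (if adj y q then 1 else 0)" if "rest S \<subseteq> insert q T" "finite T" for y q T
  proof -
    have "{w \<in> rest S. adj y w} \<subseteq> {w \<in> T. adj y w} \<union> (if adj y q then {q} else {})"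
      using that(1) by auto
    then have "card {w \<in> rest S. adj y w} \<le> card ({w \<in> T. adj y w} \<union> (if adj y q then {q} else {}))"
      using that(2) by (intro card_mono) auto
    also have "\<dots> \<le> card {w \<in> T. adj y w} + (if adj y q then 1 else 0)"
      using card_Un_le[of "{w \<in> T. adj y w}" "if adj y q then {q} else {}"] by (auto split: if_splits)
    finally show ?thesis by (simp add: ndeg_def)
  qed
  have subu: "rest S \<subseteq> insert x (rest Su)" and subv: "rest S \<subseteq> insert z (rest Sv)"
    unfolding swu(2) swv(2) by auto
  \<comment> \<open>Returning to \<open>rest S\<close> adds at most \<open>x\<close> to the
    neighbours counted in \<open>rest Su\<close>. It is adjacent to \<open>t\<close> but not to
    \<open>u\<close>, which has its colour; hence the strict bound only for \<open>u\<close>. The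
    same holds for \<open>r\<close> and \<open>v\<close>.\<close>
  have deg_rest: "deg (rest S) t \<le> h0" "deg (rest S) r \<le> h0" "deg (rest S) u < h0" "deg (rest S) v < h0"
  proof -
    have "\<not> adj u x" "\<not> adj v z" using u(2) v(2) adj_colour by blast+
    then show "deg (rest S) u < h0" "deg (rest S) v < h0"
      using grow[OF subu finite_rest, of u] grow[OF subv finite_rest, of v] lowu lowv by auto
    show "deg (rest S) t \<le> h0" "deg (rest S) r \<le> h0"
      using grow[OF subu finite_rest, of t] grow[OF subv finite_rest, of r] lowu lowv
      by (auto split: if_splits)
  qed

  define six where "six j = deg (S j) t + deg (S j) r + deg (S j) x + deg (S j) u + deg (S j) z + deg (S j) v" for j
  \<comment> \<open>The exchanges at \<open>A\<close> that would close the path are impossible.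
    Writing vertices for their degrees into \<open>S A\<close>, this gives
    \<open>t + r + 3 * x + 3 * z \<le> 6 * h A\<close>. As \<open>x + z\<close> is at least
    \<open>2 * h A - 1\<close> and \<open>u\<close>, \<open>v\<close> are at most
    \<open>h A\<close>, the sum is at most \<open>4 * h A + 2\<close>.\<close>
  have sixA: "six A \<le> 6 * (h A - 1) + 3"
  proof -
    have "\<not> 3 * h A < deg (S A) t + deg (S A) z + 2 * deg (S A) x"
    proof
      assume large: "3 * h A < deg (S A) t + deg (S A) z + 2 * deg (S A) x"
      obtain w where w: "w \<in> S A" "adj t w" "adj z w" "ham (insert x (S A - {w}))"
        by (rule exchange_one[OF hamA A(2) hA(2) nA(1) ct(1) cz large])
      note sw = swap[OF PD(1) A(1) inR(1) w(1,4)]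
      show False
        by (rule close_left[OF minconf_conf[OF sw(1)] _ outP[OF w(1) A(1)] w(2,3)])
          (unfold sw(2), use inR pth in auto)
    qed
    moreover have "\<not> 3 * h A < deg (S A) r + deg (S A) x + 2 * deg (S A) z"
    proof
      assume large: "3 * h A < deg (S A) r + deg (S A) x + 2 * deg (S A) z"
      have cr: "c r = (\<not> c z)" using ct cz by simp
      obtain w where w: "w \<in> S A" "adj r w" "adj x w" "ham (insert z (S A - {w}))"
        by (rule exchange_one[OF hamA A(2) hA(2) nA(2) cr cx large])
      note sw = swap[OF PD(1) A(1) inR(2) w(1,4)]
      show False
        by (rule close_right[OF minconf_conf[OF sw(1)] _ outP[OF w(1) A(1)] w(2,3)])
          (unfold sw(2), use inR pth in auto)
    qed
    moreover have "deg (S A) u \<le> h A" "deg (S A) v \<le> h A"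
      using deg_le_ham[OF hamA] A(2) by auto
    ultimately show ?thesis unfolding six_def using A(3) hA(1) by linarith
  qed
  \<comment> \<open>The six degrees in the rest sum to at most \<open>6 * h0 - 4\<close>, so the
    cycles receive at least 4 more than six times the sum of the \<open>h j - 1\<close>. At most 3
    of this surplus falls on \<open>A\<close>.\<close>
  obtain B where B: "B \<in> J" "B \<noteq> A" "6 * (h B - 1) < six B"
  proof (rule ccontr)
    note found = that
    assume none: "\<not> thesis"
    have "six j \<le> 6 * (h j - 1)" if "j \<in> J - {A}" for j
      using none found[of j] that by (cases "six j \<le> 6 * (h j - 1)") auto
    then have "(\<Sum>j\<in>J - {A}. six j) \<le> (\<Sum>j\<in>J - {A}. 6 * (h j - 1))"
      by (rule sum_mono)
    then have "(\<Sum>j\<in>J. six j) \<le> 6 * (\<Sum>j\<in>J. h j - 1) + 3"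
      using sixA sum.remove[OF finite_J A(1), of six] sum.remove[OF finite_J A(1), of "\<lambda>j. h j - 1"]
      by (simp add: sum_distrib_left)
    moreover have "(\<Sum>j\<in>J. six j) = (\<Sum>j\<in>J. deg (S j) t) + (\<Sum>j\<in>J. deg (S j) r) + (\<Sum>j\<in>J. deg (S j) x) +
        (\<Sum>j\<in>J. deg (S j) u) + (\<Sum>j\<in>J. deg (S j) z) + (\<Sum>j\<in>J. deg (S j) v)"
      by (simp add: six_def sum.distrib)
    moreover have bound: "h0 + (\<Sum>j\<in>J. h j - 1) \<le> deg (rest S) y + (\<Sum>j\<in>J. deg (S j) y)" if "y \<in> V" for y
      using min_deg[OF that] deg_V_split[OF PD(2), of y] by simp
    have "t \<in> V" "r \<in> V" "x \<in> V" "u \<in> V" "z \<in> V" "v \<in> V"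
      using inR tr ham_in_V[OF hamA] u(1) v(1) by (auto simp: rest_def)
    note this[THEN bound]
    ultimately show False
      using lows deg_rest by linarith
  qed
  have hamB: "ham (S B)" using confD(1)[OF PD(2) B(1)] .
  have SuB: "Su B = S B" "Sv B = S B" using B(2) by (auto simp: Su_def Sv_def)
  have restu: "u \<in> rest Su" "z \<in> rest Su" "set M \<subseteq> rest Su"
    unfolding swu(2) using inR pth by auto
  have restv: "v \<in> rest Sv" "x \<in> rest Sv" "set M \<subseteq> rest Sv"
    unfolding swv(2) using inR pth by auto
  have nB: "x \<notin> S B" "u \<notin> S B" "z \<notin> S B" "v \<notin> S B"
    using rest_disjoint[OF B(1), of S] rest_disjoint[OF B(1), of Su] rest_disjoint[OF B(1), of Sv]
      inR restu restv SuB by auto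
  \<comment> \<open>Otherwise \<open>long_cycle_deg\<close> bounds all six degrees by
    \<open>h B - 1\<close>; for \<open>u\<close> and \<open>v\<close> it is applied to
    \<open>Su\<close> and \<open>Sv\<close>, where they belong to the rest.\<close>
  have tight: "card (S B) = 2 * h B"
  proof (rule ccontr)
    assume "card (S B) \<noteq> 2 * h B"
    then have lt: "2 * h B < card (S B)" using confD(2)[OF PD(2) B(1)] by linarith
    have bound: "deg (S B) y \<le> h B - 1" if "y \<in> rest S" for y
      using long_cycle_deg[OF PD(1) B(1) that lt] .
    have "deg (S B) u \<le> h B - 1" "deg (S B) v \<le> h B - 1"
      using long_cycle_deg[OF swu(1) B(1) restu(1)] long_cycle_deg[OF swv(1) B(1) restv(1)] lt SuB by auto
    moreover have "t \<in> rest S" "r \<in> rest S" using tr inR by auto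
    note this[THEN bound] inR(1,2)[THEN bound]
    ultimately have "six B \<le> 6 * (h B - 1)"
      unfolding six_def by linarith
    then show False using B(3) by simp
  qed
  have "six B \<le> 6 * (h B - 1)"
    unfolding six_def
  proof (rule local_bound[OF hamB tight h_ge[OF B(1)] nB u(2) ct(2) ct(1) cz _ v(3)])
    show "c v = (\<not> c x)" using v(2) cz by simp
    show "adj u z" using u(3) adj_sym by blast
  next
    fix y w assume *: "y \<in> {x, u}" "w \<in> S B" "adj t w" "adj z w"
    show "\<not> ham (insert y (S B - {w}))"
    proof
      assume ham: "ham (insert y (S B - {w}))"
      show False
      proof (cases "y = x")
        case True
        note sw = swap[OF PD(1) B(1) inR(1) *(2) ham[unfolded True]]
        show False
          by (rule close_left[OF minconf_conf[OF sw(1)] _ outP[OF *(2) B(1)] *(3,4)])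
            (unfold sw(2), use inR pth in auto)
      next
        case False
        then have "y = u" using *(1) by simp
        \<comment> \<open>In \<open>Su\<close> the vertex \<open>x\<close> already sits on cycle
          \<open>A\<close> and \<open>u\<close> is free; since \<open>B\<close> is a different
          cycle, \<open>u\<close> can now be exchanged for \<open>w\<close>.\<close>
        note sw = swap[OF swu(1) B(1) restu(1), of w, unfolded SuB, OF *(2) ham[unfolded this]]
        show False
          by (rule close_left[OF minconf_conf[OF sw(1)] _ outP[OF *(2) B(1)] *(3,4)])
            (unfold sw(2), use restu uv_out P in auto)
      qed
    qed
  next
    fix y w assume *: "y \<in> {z, v}" "w \<in> S B" "adj r w" "adj x w"
    show "\<not> ham (insert y (S B - {w}))"
    proof
      assume ham: "ham (insert y (S B - {w}))"
      show False
      proof (cases "y = z")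
        case True
        note sw = swap[OF PD(1) B(1) inR(2) *(2) ham[unfolded True]]
        show False
          by (rule close_right[OF minconf_conf[OF sw(1)] _ outP[OF *(2) B(1)] *(3,4)])
            (unfold sw(2), use inR pth in auto)
      next
        case False
        then have "y = v" using *(1) by simp
        note sw = swap[OF swv(1) B(1) restv(1), of w, unfolded SuB, OF *(2) ham[unfolded this]]
        show False
          by (rule close_right[OF minconf_conf[OF sw(1)] _ outP[OF *(2) B(1)] *(3,4)])
            (unfold sw(2), use restv uv_out P in auto)
      qed
    qed
  next
    fix y y' w w'
    assume *: "(y, y') \<in> {(x, v), (u, z)}" "w \<in> S B" "w' \<in> S B" "adj w w'" "adj t w" "adj r w'"
    show "\<not> ham (insert y (insert y' (S B - {w, w'})))" (is "\<not> ham ?T")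
    proof
      assume ham: "ham ?T"
      have "w \<noteq> w'" using *(4) adj_irrefl by auto
      have "y \<noteq> y'" "y \<notin> S B" "y' \<notin> S B" using *(1) nB v(3) u(3) adj_irrefl by auto
      have "finite (S B)" using ham_finite[OF hamB] .
      then have "card ?T = card (S B)"
        using \<open>w \<noteq> w'\<close> \<open>y \<noteq> y'\<close> \<open>y \<notin> S B\<close> \<open>y' \<notin> S B\<close> *(2,3) card_mono[of "S B" "{w, w'}"]
        by (simp add: card_Diff_subset)
      then have size: "2 * h B \<le> card ?T" using tight by simp
      \<comment> \<open>For the pair \<open>x\<close>, \<open>v\<close> the end \<open>z\<close> is
        stored in cycle \<open>A\<close>, which frees \<open>v\<close>; for the pair
        \<open>u\<close>, \<open>z\<close> it is \<open>x\<close> that is stored there.\<close>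
      obtain S' where S': "conf S'" "y \<in> rest S'" "y' \<in> rest S'" "set M \<subseteq> rest S'" "S' B = S B" "y \<notin> set M" "y' \<notin> set M"
      proof (cases "y = x")
        case True
        then have "y' = v" using *(1) u(1) nA(1) by auto
        then show ?thesis using that[of Sv] True confv restv SuB pth uv_out P by auto
      next
        case False
        then have "y = u" "y' = z" using *(1) by auto
        then show ?thesis using that[of Su] confu restu SuB pth uv_out P by auto
      qed
      have new: "conf (S'(B := ?T))"
        using S' by (intro conf_update[OF S'(1) B(1) ham size]) auto
      have "insert w (insert w' (set M)) \<subseteq> rest (S'(B := ?T))"
        unfolding rest_update[OF S'(1) B(1)] S'(5)
        using S'(4,6,7) *(2,3) \<open>y \<notin> S B\<close> \<open>y' \<notin> S B\<close> rest_disjoint[OF B(1), of S'] S'(5) by auto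
      from close_both[OF new this outP[OF *(2) B(1)] outP[OF *(3) B(1)] *(5,6,4)] show False .
    qed
  next
    fix w assume "deg (S B) x = h B" "w \<in> S B" "adj t w \<or> adj z w"
    then show "deg (S B) w = h B"
      using heaviest_full[OF H P \<open>M \<noteq> []\<close> _ B(1) tight] cz by (simp add: t_def)
  next
    fix w assume *: "deg (S B) z = h B" "w \<in> S B" "adj x w \<or> adj r w"
    have "rev P = z # rev M @ [x]" using P by simp
    then show "deg (S B) w = h B"
      using heaviest_full[OF heaviest_rev[OF H] _ _ _ B(1) tight *(1,2)] *(3) cz \<open>M \<noteq> []\<close>
      by (auto simp: r_def hd_rev)
  qed
  then show False using B(3) by simp
qed

end

subsection \<open>Induction on the missing edges\<close>

text \<open>Adjacency is a parameter because the induction compares families in two graphs.\<close>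

definition packs :: "('a \<Rightarrow> 'a \<Rightarrow> bool) \<Rightarrow> 'i set \<Rightarrow> ('i \<Rightarrow> nat) \<Rightarrow> ('i \<Rightarrow> 'a set) \<Rightarrow> bool" where
  "packs adj I h S \<longleftrightarrow> (\<forall>j\<in>I. hamiltonian adj (S j) \<and> 2 * h j \<le> card (S j)) \<and>
    (\<forall>i\<in>I. \<forall>j\<in>I. i \<noteq> j \<longrightarrow> S i \<inter> S j = {})"

lemma hamiltonian_cong:
  assumes "hamiltonian adj S" "\<And>u v. u \<in> S \<Longrightarrow> v \<in> S \<Longrightarrow> adj u v = adj' u v"
  shows "hamiltonian adj' S"
proof -
  obtain xs where xs: "gcycle adj xs" "set xs = S" using assms(1) by (auto simp: hamiltonian_def)
  then have "xs \<noteq> []" by (auto simp: gcycle_def gpath_def)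
  then have "last xs \<in> S" "hd xs \<in> S" using xs(2) by auto
  moreover have "successively adj xs = successively adj' xs"
    using assms(2) xs(2) by (intro successively_cong) auto
  ultimately have "gcycle adj' xs" using xs(1) assms(2) by (simp add: gcycle_def gpath_def)
  then show ?thesis using xs(2) by (auto simp: hamiltonian_def)
qed

lemma disjoint_subsets:
  fixes X :: "'a set" and I :: "'i set"
  assumes "finite I" "finite X" "(\<Sum>j\<in>I. h j) \<le> card X"
  shows "\<exists>A. (\<forall>j\<in>I. A j \<subseteq> X \<and> card (A j) = h j) \<and> (\<forall>i\<in>I. \<forall>j\<in>I. i \<noteq> j \<longrightarrow> A i \<inter> A j = {})"
  using assms
proof (induction I arbitrary: X rule: finite_induct)
  case (insert i I)
  then have "h i \<le> card X" by simp
  then obtain B where B: "B \<subseteq> X" "card B = h i"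
    by (rule obtain_subset_with_card_n)
  have "finite B" using B(1) insert.prems(1) finite_subset by blast
  then have "(\<Sum>j\<in>I. h j) \<le> card (X - B)"
    using B insert.prems(2) insert.hyps by (simp add: card_Diff_subset)
  then obtain A where A: "\<forall>j\<in>I. A j \<subseteq> X - B \<and> card (A j) = h j" "\<forall>i\<in>I. \<forall>j\<in>I. i \<noteq> j \<longrightarrow> A i \<inter> A j = {}"
    using insert.IH[of "X - B"] insert.prems(1) by auto
  have AB: "A j \<inter> B = {}" "B \<inter> A j = {}" if "j \<in> I" for j using A(1) that by blast+
  have "\<forall>j\<in>insert i I. (A(i := B)) j \<subseteq> X \<and> card ((A(i := B)) j) = h j"
    using A(1) B by auto
  moreover have "(A(i := B)) k \<inter> (A(i := B)) j = {}"
    if "k \<in> insert i I" "j \<in> insert i I" "k \<noteq> j" for k j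
    using A(2) AB that by (cases "k = i"; cases "j = i") auto
  ultimately show ?case by blast
qed simp

lemma complete_bipartite_path:
  assumes "finite X" "X \<noteq> {}" "card Y = card X" "X \<inter> Y = {}"
    "\<And>x y. x \<in> X \<Longrightarrow> y \<in> Y \<Longrightarrow> adj x y \<and> adj y x"
  shows "\<exists>zs. gpath adj zs \<and> set zs = X \<union> Y \<and> hd zs \<in> X \<and> last zs \<in> Y"
  using assms
proof (induction X arbitrary: Y rule: finite_ne_induct)
  case (singleton x)
  then have "card Y = 1" by simp
  then obtain y where "Y = {y}" by (rule card_1_singletonE)
  moreover have "x \<noteq> y" "adj x y"
    using singleton(2,3) \<open>Y = {y}\<close> by auto
  ultimately show ?case
    by (intro exI[of _ "[x, y]"]) (auto simp: gpath_def)
next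
  case (insert x X)
  then have "card Y = Suc (card X)" by simp
  then obtain y Y' where Y: "Y = insert y Y'" "y \<notin> Y'" "card Y' = card X"
    by (auto simp: card_Suc_eq)
  have edges: "adj x' y' \<and> adj y' x'" if "x' \<in> insert x X" "y' \<in> Y" for x' y'
    using insert.prems(3) that by blast
  have "X \<inter> Y' = {}" using insert.prems(2) Y(1) by blast
  from insert.IH[OF Y(3) this] obtain zs where
    zs: "gpath adj zs" "set zs = X \<union> Y'" "hd zs \<in> X" "last zs \<in> Y'"
    using edges unfolding Y(1) by auto
  have "zs \<noteq> []" using zs(1) by (simp add: gpath_def)
  have "x \<notin> set zs" "y \<notin> set zs" "x \<noteq> y"
    using zs(2) insert.hyps insert.prems(2) Y(1,2) by auto
  moreover have "adj x y" "adj y (hd zs)" using edges zs(3) Y(1) by auto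
  ultimately have "gpath adj (x # y # zs)"
    using zs(1) \<open>zs \<noteq> []\<close> by (simp add: gpath_def successively_Cons)
  then show ?case
    using zs Y(1) \<open>zs \<noteq> []\<close> by (intro exI[of _ "x # y # zs"]) auto
qed

lemma complete_bipartite_hamiltonian:
  assumes "finite X" "2 \<le> card X" "card Y = card X" "X \<inter> Y = {}"
    "\<And>x y. x \<in> X \<Longrightarrow> y \<in> Y \<Longrightarrow> adj x y \<and> adj y x"
  shows "hamiltonian adj (X \<union> Y)" "card (X \<union> Y) = 2 * card X"
proof -
  have "finite Y" using assms(2,3) by (auto intro: card_ge_0_finite)
  then show card: "card (X \<union> Y) = 2 * card X"
    using assms by (simp add: card_Un_disjoint)
  have "X \<noteq> {}" using assms(2) by auto
  then obtain zs where zs: "gpath adj zs" "set zs = X \<union> Y" "hd zs \<in> X" "last zs \<in> Y"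
    using complete_bipartite_path[of X Y adj] assms by auto
  have "length zs = 2 * card X"
    using zs card distinct_card[of zs] by (simp add: gpath_def)
  then have "gcycle adj zs"
    using zs assms(2,5) by (simp add: gcycle_def)
  then show "hamiltonian adj (X \<union> Y)" using zs(2) by (auto simp: hamiltonian_def)
qed

text \<open>Reserve \<open>h j\<close> vertices of either colour for each \<open>j\<close>; in a
  complete bipartite graph the two sets span a cycle.\<close>

lemma packs_complete:
  fixes V :: "'a set" and c :: "'a \<Rightarrow> bool" and h :: "'i \<Rightarrow> nat"
  assumes V: "finite V" and I: "finite I" "\<And>j. j \<in> I \<Longrightarrow> 3 \<le> h j"
    and bal: "\<And>k. card {v \<in> V. c v = k} = M" and room: "(\<Sum>j\<in>I. h j) \<le> M"
    and complete: "\<And>u v. u \<in> V \<Longrightarrow> v \<in> V \<Longrightarrow> c u \<noteq> c v \<Longrightarrow> adj u v"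
  shows "\<exists>S. packs adj I h S"
proof -
  have "\<exists>A. (\<forall>j\<in>I. A j \<subseteq> {v \<in> V. c v = k} \<and> card (A j) = h j) \<and>
      (\<forall>i\<in>I. \<forall>j\<in>I. i \<noteq> j \<longrightarrow> A i \<inter> A j = {})" for k
    using V room bal[of k] by (intro disjoint_subsets[OF I(1)]) auto
  then obtain A where A: "\<And>k j. j \<in> I \<Longrightarrow> A k j \<subseteq> {v \<in> V. c v = k} \<and> card (A k j) = h j"
      "\<And>k i j. i \<in> I \<Longrightarrow> j \<in> I \<Longrightarrow> i \<noteq> j \<Longrightarrow> A k i \<inter> A k j = {}"
    by metis
  have cross: "A True i \<inter> A False j = {}" if "i \<in> I" "j \<in> I" for i j
    using A(1)[OF that(1), of True] A(1)[OF that(2), of False] by auto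
  have "hamiltonian adj (A True j \<union> A False j) \<and> card (A True j \<union> A False j) = 2 * h j" if j: "j \<in> I" for j
  proof -
    have sub: "A True j \<subseteq> {v \<in> V. c v = True}" "A False j \<subseteq> {v \<in> V. c v = False}"
      and card: "card (A True j) = h j" "card (A False j) = h j"
      using A(1)[OF j] by auto
    have fin: "finite (A True j)" using finite_subset[OF sub(1)] V by simp
    have two: "2 \<le> card (A True j)" using card I(2)[OF j] by simp
    have eq: "card (A False j) = card (A True j)" using card by simp
    have edges: "adj x y \<and> adj y x" if "x \<in> A True j" "y \<in> A False j" for x y
      using complete[of x y] complete[of y x] sub that by auto
    show ?thesis
      using complete_bipartite_hamiltonian[OF fin two eq cross[OF j j] edges] card(1) by simp
  qed
  moreover have "(A True i \<union> A False i) \<inter> (A True j \<union> A False j) = {}"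
    if "i \<in> I" "j \<in> I" "i \<noteq> j" for i j
    using A(2)[OF that] cross[OF that(1,2)] cross[OF that(2,1)] by blast
  ultimately have "packs adj I h (\<lambda>j. A True j \<union> A False j)" by (simp add: packs_def)
  then show ?thesis by blast
qed

lemma packs_remove_edge:
  fixes V :: "'a set" and h :: "'i \<Rightarrow> nat"
  assumes "coloured_graph adj c" and V: "finite V" "\<And>u v. adj u v \<Longrightarrow> u \<in> V"
    and I: "finite I" "\<And>j. j \<in> I \<Longrightarrow> 3 \<le> h j"
    and bal: "\<And>k. card {v \<in> V. c v = k} = M"
    and deg: "\<And>v. v \<in> V \<Longrightarrow> 1 + (\<Sum>j\<in>I. h j - 1) \<le> ndeg adj V v"
    and S: "packs adj' I h S" and subV: "\<And>j. j \<in> I \<Longrightarrow> S j \<subseteq> V"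
    and adj': "\<And>u v. adj' u v \<longleftrightarrow> adj u v \<or> (u = a \<and> v = b) \<or> (u = b \<and> v = a)"
  shows "\<exists>S. packs adj I h S"
proof (rule ccontr)
  assume none: "\<not> ?thesis"
  interpret coloured_graph adj c by fact
  have SD: "hamiltonian adj' (S j)" "2 * h j \<le> card (S j)" if "j \<in> I" for j
    using S that by (auto simp: packs_def)
  have disj: "S i \<inter> S j = {}" if "i \<in> I" "j \<in> I" "i \<noteq> j" for i j
    using S that by (simp add: packs_def)
  have ham: "ham (S j)" if "j \<in> I" "a \<notin> S j \<or> b \<notin> S j" for j
    using that(2) adj' by (intro hamiltonian_cong[OF SD(1)[OF that(1)]]) auto
  have "\<exists>i\<in>I. a \<in> S i \<and> b \<in> S i"
  proof (rule ccontr)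
    assume "\<not> ?thesis"
    then have "packs adj I h S" using SD(2) disj ham by (simp add: packs_def)
    then show False using none by blast
  qed
  then obtain i where i: "i \<in> I" "a \<in> S i" "b \<in> S i" by blast
  define J where "J = I - {i}"
  have J: "finite J" "j \<in> J \<Longrightarrow> j \<in> I" "j \<in> J \<Longrightarrow> j \<noteq> i" for j
    using I(1) by (auto simp: J_def)
  interpret cycle_system adj c V J h "h i"
  proof
    show "finite V" "finite J" by (fact V(1), fact J(1))
    show "u \<in> V" if "adj u v" for u v using V(2)[OF that] .
    show "3 \<le> h j" if "j \<in> J" for j using I(2) J(2) that by blast
    show "3 \<le> h i" using I(2)[OF i(1)] .
    show "card {v \<in> V. c v = k} = card {v \<in> V. c v = (\<not> k)}" for k
      by (simp only: bal)
    \<comment> \<open>Splitting off the term of \<open>i\<close> turns \<open>1 + (h i - 1)\<close>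
      into \<open>h i\<close>.\<close>
    show "h i + (\<Sum>j\<in>J. h j - 1) \<le> ndeg adj V v" if "v \<in> V" for v
      using deg[OF that] sum.remove[OF I(1) i(1), of "\<lambda>j. h j - 1"] I(2)[OF i(1)]
      by (simp add: J_def)
  qed
  have outside: "a \<notin> S j" if "j \<in> J" for j
    using disj[of i j] i J(2,3)[OF that] by auto
  have conf: "conf S"
    unfolding conf_def using ham outside J(2) SD(2) disj by blast
  have "S i \<subseteq> rest S"
    using subV[OF i(1)] disj[OF i(1)] J(2,3) unfolding rest_def by fastforce
  then have "card (S i) \<le> card (rest S)" using finite_rest by (intro card_mono)
  then have room: "2 * h i \<le> card (rest S)" using SD(2)[OF i(1)] by linarith
  \<comment> \<open>A cycle completing any configuration would fill the place of \<open>i\<close>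
    and give a packing.\<close>
  have "stuck_system adj c V J h (h i)"
  proof
    fix S' T assume *: "conf S'" "ham T" "T \<subseteq> rest S'"
    show "card T < 2 * h i"
    proof (rule ccontr)
      assume big: "\<not> card T < 2 * h i"
      have off: "S' j \<inter> T = {}" "T \<inter> S' j = {}" if "j \<in> J" for j
        using rest_disjoint[OF that, of S'] *(3) by auto
      have IJ: "j = i \<or> j \<in> J" if "j \<in> I" for j using that by (simp add: J_def)
      have "packs adj I h (S'(i := T))"
        unfolding packs_def
      proof (intro conjI ballI impI)
        fix j assume "j \<in> I"
        then show "ham ((S'(i := T)) j)" "2 * h j \<le> card ((S'(i := T)) j)"
          using IJ[of j] confD(1,2)[OF *(1), of j] *(2) big by auto
      next
        fix j k assume "j \<in> I" "k \<in> I" "j \<noteq> k"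
        then show "(S'(i := T)) j \<inter> (S'(i := T)) k = {}"
          using IJ[of j] IJ[of k] confD(3)[OF *(1), of k j] off by auto
      qed
      then show False using none by blast
    qed
  qed
  then show False
    using stuck_system.no_configuration conf room by blast
qed

text \<open>Induction on the number of non-edges. After adding an edge \<open>a b\<close> the cycles exist, and at most one
  of them uses \<open>a b\<close>; dropping that one leaves a configuration with enough room for it.\<close>

theorem cycle_packing:
  fixes adj :: "'a \<Rightarrow> 'a \<Rightarrow> bool" and c :: "'a \<Rightarrow> bool" and h :: "'i \<Rightarrow> nat"
  assumes "coloured_graph adj c" and V: "finite V" and "\<And>u v. adj u v \<Longrightarrow> u \<in> V"
    and I: "finite I" "\<And>j. j \<in> I \<Longrightarrow> 3 \<le> h j"
    and bal: "\<And>k. card {v \<in> V. c v = k} = M" and room: "(\<Sum>j\<in>I. h j) \<le> M"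
    and "\<And>v. v \<in> V \<Longrightarrow> 1 + (\<Sum>j\<in>I. h j - 1) \<le> ndeg adj V v"
  shows "\<exists>S. packs adj I h S \<and> (\<forall>j\<in>I. S j \<subseteq> V)"
  using assms(1,3,8)
proof (induction "card {(u, v). u \<in> V \<and> v \<in> V \<and> c u \<noteq> c v \<and> \<not> adj u v}" arbitrary: adj rule: less_induct)
  case (less adj)
  interpret coloured_graph adj c by (fact less.prems(1))
  have in_V: "S j \<subseteq> V" if "packs adj I h S" "j \<in> I" for S j
  proof
    fix v assume "v \<in> S j"
    moreover have "ham (S j)" using that by (simp add: packs_def)
    ultimately obtain vs where "cyc (v # vs)" using ham_through by metis
    then have "adj v (hd vs)" by (simp add: cyc_Cons_iff)
    then show "v \<in> V" by (rule less.prems(2))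
  qed
  have "\<exists>S. packs adj I h S"
  proof (cases "\<forall>u\<in>V. \<forall>v\<in>V. c u \<noteq> c v \<longrightarrow> adj u v")
    case True
    then show ?thesis
      by (intro packs_complete[OF V I bal room]) auto
  next
    case False
    then obtain a b where ab: "a \<in> V" "b \<in> V" "c a \<noteq> c b" "\<not> adj a b" by blast
    define adj' where "adj' u v \<longleftrightarrow> adj u v \<or> (u = a \<and> v = b) \<or> (u = b \<and> v = a)" for u v
    have c': "coloured_graph adj' c"
      using ab(3) adj_sym adj_colour by unfold_locales (auto simp: adj'_def)
    have V': "u \<in> V" if "adj' u v" for u v
      using that ab less.prems(2) by (auto simp: adj'_def)
    have less': "card {(u, v). u \<in> V \<and> v \<in> V \<and> c u \<noteq> c v \<and> \<not> adj' u v} <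
        card {(u, v). u \<in> V \<and> v \<in> V \<and> c u \<noteq> c v \<and> \<not> adj u v}"
    proof (rule psubset_card_mono)
      show "finite {(u, v). u \<in> V \<and> v \<in> V \<and> c u \<noteq> c v \<and> \<not> adj u v}"
        by (rule finite_subset[of _ "V \<times> V"]) (use V in auto)
      have "(a, b) \<notin> {(u, v). u \<in> V \<and> v \<in> V \<and> c u \<noteq> c v \<and> \<not> adj' u v}"
        "(a, b) \<in> {(u, v). u \<in> V \<and> v \<in> V \<and> c u \<noteq> c v \<and> \<not> adj u v}"
        using ab by (auto simp: adj'_def)
      moreover have "{(u, v). u \<in> V \<and> v \<in> V \<and> c u \<noteq> c v \<and> \<not> adj' u v} \<subseteq>
        {(u, v). u \<in> V \<and> v \<in> V \<and> c u \<noteq> c v \<and> \<not> adj u v}"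
        by (auto simp: adj'_def)
      ultimately show "{(u, v). u \<in> V \<and> v \<in> V \<and> c u \<noteq> c v \<and> \<not> adj' u v} \<subset>
        {(u, v). u \<in> V \<and> v \<in> V \<and> c u \<noteq> c v \<and> \<not> adj u v}"
        by blast
    qed
    have deg': "1 + (\<Sum>j\<in>I. h j - 1) \<le> ndeg adj' V v" if "v \<in> V" for v
    proof -
      have "ndeg adj V v \<le> ndeg adj' V v"
        unfolding ndeg_def using V by (intro card_mono) (auto simp: adj'_def)
      then show ?thesis using less.prems(3)[OF that] by linarith
    qed
    have "\<exists>S. packs adj' I h S \<and> (\<forall>j\<in>I. S j \<subseteq> V)"
      by (rule less.hyps[OF less' c']) (erule V', erule deg')
    then obtain S where S: "packs adj' I h S" "\<And>j. j \<in> I \<Longrightarrow> S j \<subseteq> V" by blast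
    show ?thesis
    proof (rule packs_remove_edge[where adj' = adj' and S = S and a = a and b = b])
      show "coloured_graph adj c" "finite V" "finite I" "packs adj' I h S"
        by (fact less.prems(1) V I(1) S(1))+
    qed (fact less.prems(2) less.prems(3) I(2) bal S(2) adj'_def)+
  qed
  then show ?case using in_V by blast
qed

subsection \<open>Subdivisions of disjoint unions of cycles\<close>

definition path_arcs :: "'a list \<Rightarrow> ('a \<times> 'a) set" where
  "path_arcs xs = set (zip xs (tl xs))"

definition cycle_arcs :: "'a list \<Rightarrow> ('a \<times> 'a) set" where
  "cycle_arcs xs = insert (last xs, hd xs) (path_arcs xs) \<union> (insert (last xs, hd xs) (path_arcs xs))\<inverse>"

lemma path_arcs_simps [simp]: "path_arcs [] = {}" "path_arcs [x] = {}"
    "path_arcs (x # y # xs) = insert (x, y) (path_arcs (y # xs))"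
  by (auto simp: path_arcs_def)

lemma path_arcs_snoc: "xs \<noteq> [] \<Longrightarrow> path_arcs (xs @ [w]) = insert (last xs, w) (path_arcs xs)"
  by (induction xs rule: induct_list012) auto

lemma path_arcs_subset: "path_arcs xs \<subseteq> set xs \<times> set xs"
  by (induction xs rule: induct_list012) auto

lemma path_arcs_map: "path_arcs (map f xs) = map_prod f f ` path_arcs xs"
  by (induction xs rule: induct_list012) auto

lemma successively_path_arcs: "successively adj xs \<longleftrightarrow> (\<forall>(u, v)\<in>path_arcs xs. adj u v)"
  by (induction xs rule: induct_list012) auto

lemma cycle_arcs_subset: "xs \<noteq> [] \<Longrightarrow> cycle_arcs xs \<subseteq> set xs \<times> set xs"
  using path_arcs_subset[of xs] by (auto simp: cycle_arcs_def)

lemma cycle_arcs_sym: "(u, v) \<in> cycle_arcs xs \<longleftrightarrow> (v, u) \<in> cycle_arcs xs"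
  by (auto simp: cycle_arcs_def)

lemma cycle_arcs_map: "xs \<noteq> [] \<Longrightarrow> cycle_arcs (map f xs) = map_prod f f ` cycle_arcs xs"
  by (auto simp: cycle_arcs_def path_arcs_map last_map hd_map image_iff)

lemma path_arcs_hd: "distinct (x # xs) \<Longrightarrow> (x, y) \<in> path_arcs (x # xs) \<Longrightarrow> y = hd xs"
  using path_arcs_subset[of xs] by (cases xs) auto

lemma path_arcs_last: "distinct xs \<Longrightarrow> (last xs, y) \<notin> path_arcs xs"
  by (induction xs rule: induct_list012) auto

lemma path_arcs_irrefl: "distinct xs \<Longrightarrow> (x, x) \<notin> path_arcs xs"
  by (induction xs rule: induct_list012) auto

lemma cycle_arcs_irrefl:
  assumes "distinct xs" "2 \<le> length xs"
  shows "(x, x) \<notin> cycle_arcs xs"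
proof -
  obtain y ys where xs: "xs = y # ys" "ys \<noteq> []" using assms(2) by (cases xs; cases "tl xs") auto
  then have "last xs \<noteq> hd xs" using assms(1) by auto
  then show ?thesis using path_arcs_irrefl[OF assms(1)] by (auto simp: cycle_arcs_def)
qed

text \<open>\<open>P\<close> stands for the arcs of a path from \<open>f\<close> to \<open>l\<close>
  that is closed through \<open>w\<close> instead of directly. The hypotheses ensure that deleting
  the closing edge does not touch \<open>P\<close>.\<close>

lemma reroute_arc:
  assumes "(l, f) \<notin> P" "(f, l) \<notin> P"
  shows "insert (w, f) (insert (l, w) P) \<union> (insert (w, f) (insert (l, w) P))\<inverse> =
    insert (l, f) P \<union> (insert (l, f) P)\<inverse> - {(l, f), (f, l)} \<union> {(l, w), (w, l), (w, f), (f, w)}"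
  using assms by auto

text \<open>Appending a vertex subdivides the closing edge, which for three or more vertices is not
  an edge of the path.\<close>

lemma cycle_arcs_snoc:
  assumes "distinct (xs @ [w])" "3 \<le> length xs"
  shows "cycle_arcs (xs @ [w]) = cycle_arcs xs - {(last xs, hd xs), (hd xs, last xs)} \<union>
    {(last xs, w), (w, last xs), (w, hd xs), (hd xs, w)}"
proof -
  obtain x y z ys where xs: "xs = x # y # z # ys"
    using assms(2) by (metis Suc_le_length_iff numeral_3_eq_3)
  have d: "distinct xs" and ne: "xs \<noteq> []" using assms(1) xs by simp_all
  have n1: "(last xs, hd xs) \<notin> path_arcs xs" using path_arcs_last[OF d] .
  have n2: "(hd xs, last xs) \<notin> path_arcs xs"
  proof
    assume "(hd xs, last xs) \<in> path_arcs xs"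
    then have "last xs = y" using path_arcs_hd[of x "y # z # ys" "last xs"] d xs by simp
    moreover have "last xs \<in> set (z # ys)" using last_in_set[of "z # ys"] xs by simp
    ultimately show False using d xs by auto
  qed
  have e: "cycle_arcs (xs @ [w]) = insert (w, hd xs) (insert (last xs, w) (path_arcs xs)) \<union>
      (insert (w, hd xs) (insert (last xs, w) (path_arcs xs)))\<inverse>"
    using ne by (simp add: cycle_arcs_def path_arcs_snoc)
  show ?thesis
    unfolding e reroute_arc[OF n1 n2] by (simp only: cycle_arcs_def)
qed

lemma cycle_graph_arcs:
  assumes "1 \<le> m"
  shows "parcs (cycle_graph m) = cycle_arcs [0..<m]"
proof -
  have "path_arcs [0..<m] = {(i, Suc i) | i. Suc i < m}"
  proof (induction m)
    case (Suc n)
    then show ?case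
      by (cases "n = 0") (auto simp: path_arcs_snoc)
  qed simp
  moreover have "Suc i mod m = (if Suc i = m then 0 else Suc i)" if "i < m" for i
    using that by auto
  ultimately show ?thesis
    using assms by (auto simp: cycle_arcs_def cycle_graph_def split: if_splits)
qed

definition cycle_union :: "'i set \<Rightarrow> ('i \<Rightarrow> 'a list) \<Rightarrow> 'a pair_pre_digraph" where
  "cycle_union I L = \<lparr> pverts = (\<Union>i\<in>I. set (L i)), parcs = (\<Union>i\<in>I. cycle_arcs (L i)) \<rparr>"

definition cycle_family :: "'i set \<Rightarrow> ('i \<Rightarrow> 'a list) \<Rightarrow> bool" where
  "cycle_family I L \<longleftrightarrow> (\<forall>i\<in>I. distinct (L i) \<and> 3 \<le> length (L i)) \<and>
    (\<forall>i\<in>I. \<forall>j\<in>I. i \<noteq> j \<longrightarrow> set (L i) \<inter> set (L j) = {})"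

lemma cycle_family_ne: "cycle_family I L \<Longrightarrow> i \<in> I \<Longrightarrow> L i \<noteq> []"
  by (auto simp: cycle_family_def)

lemma cycle_union_bidirected:
  assumes "cycle_family I L"
  shows "pair_bidirected_digraph (cycle_union I L)"
proof
  note sub = cycle_arcs_subset[OF cycle_family_ne[OF assms]]
  show "fst e \<in> pverts (cycle_union I L)" "snd e \<in> pverts (cycle_union I L)"
    if "e \<in> parcs (cycle_union I L)" for e
    using that sub by (fastforce simp: cycle_union_def)+
  show "fst e \<noteq> snd e" if e: "e \<in> parcs (cycle_union I L)" for e
  proof -
    obtain i where i: "i \<in> I" "e \<in> cycle_arcs (L i)" using e by (auto simp: cycle_union_def)
    then have "distinct (L i)" "2 \<le> length (L i)" using assms by (auto simp: cycle_family_def)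
    then show ?thesis using cycle_arcs_irrefl[of "L i" "fst e"] i(2) by (cases e) auto
  qed
  have "(v, u) \<in> parcs (cycle_union I L)" if e: "(u, v) \<in> parcs (cycle_union I L)" for u v
  proof -
    obtain i where "i \<in> I" "(u, v) \<in> cycle_arcs (L i)" using e by (auto simp: cycle_union_def)
    then show ?thesis using cycle_arcs_sym[of u v "L i"] by (auto simp: cycle_union_def)
  qed
  then show "symmetric (with_proj (cycle_union I L))"
    by (auto simp: symmetric_def arcs_ends_def arc_to_ends_def intro!: symI)
qed

text \<open>Each \<open>L i\<close> prolongs \<open>K i\<close> at its end, so subdividing closing
  edges suffices: drop the last vertex of a list that is too long and subdivide the closing edge of
  what remains.\<close>

lemma cycle_union_subdivision:
  assumes "finite I" "cycle_family I K" "cycle_family I L" "\<And>i. i \<in> I \<Longrightarrow> \<exists>zs. L i = K i @ zs"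
  shows "subdivision_pair (cycle_union I K) (cycle_union I L)"
  using assms(3,4)
proof (induction "\<Sum>i\<in>I. length (L i)" arbitrary: L rule: less_induct)
  case (less L)
  show ?case
  proof (cases "\<forall>i\<in>I. L i = K i")
    case True
    then have "cycle_union I L = cycle_union I K" by (simp add: cycle_union_def)
    then show ?thesis
      using subdivision_pair_base[OF cycle_union_bidirected[OF assms(2)]] by simp
  next
    case False
    then obtain i where i: "i \<in> I" "L i \<noteq> K i" by blast
    obtain zs where zs: "L i = K i @ zs" using less.prems(2) i(1) by blast
    define ys where "ys = K i @ butlast zs"
    define w where "w = last zs"
    have Li: "L i = ys @ [w]" using zs i(2) by (simp add: ys_def w_def)
    define L' where "L' = L(i := ys)"
    have ys3: "3 \<le> length ys" "distinct (ys @ [w])"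
    proof -
      have "3 \<le> length (K i)" using assms(2) i(1) by (simp add: cycle_family_def)
      then show "3 \<le> length ys" by (simp add: ys_def)
      have "distinct (L i)" using less.prems(1) i(1) by (simp add: cycle_family_def)
      then show "distinct (ys @ [w])" unfolding Li .
    qed
    have disj: "set (ys @ [w]) \<inter> set (L j) = {}" "set (L j) \<inter> set (ys @ [w]) = {}" if "j \<in> I" "j \<noteq> i" for j
      using less.prems(1) i(1) that unfolding cycle_family_def Li[symmetric] by blast+
    have fam: "cycle_family I L'"
      unfolding cycle_family_def
    proof (intro conjI ballI impI)
      fix j assume "j \<in> I"
      then show "distinct (L' j)" "3 \<le> length (L' j)"
        using less.prems(1) ys3 by (auto simp: L'_def cycle_family_def)
    next
      fix j k assume "j \<in> I" "k \<in> I" "j \<noteq> k"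
      then show "set (L' j) \<inter> set (L' k) = {}"
        using less.prems(1) disj by (auto simp: L'_def cycle_family_def)
    qed
    have "(\<Sum>j\<in>I. length (L' j)) < (\<Sum>j\<in>I. length (L j))"
      using assms(1) i(1) Li by (intro sum_strict_mono_ex1) (auto simp: L'_def)
    moreover have "\<exists>zs. L' j = K j @ zs" if "j \<in> I" for j
      using less.prems(2)[OF that] by (auto simp: L'_def ys_def)
    ultimately have sd: "subdivision_pair (cycle_union I K) (cycle_union I L')"
      using less.hyps fam by blast
    let ?e = "(last ys, hd ys)"
    have "?e \<in> parcs (cycle_union I L')"
      using i(1) by (auto simp: cycle_union_def cycle_arcs_def L'_def)
    moreover have "w \<notin> pverts (cycle_union I L')"
      using ys3(2) disj by (auto simp: cycle_union_def L'_def)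
    ultimately have "subdivision_pair (cycle_union I K) (subdivide (cycle_union I L') ?e w)"
      by (rule subdivision_pair_divide[OF _ _ sd])
    moreover have "subdivide (cycle_union I L') ?e w = cycle_union I L"
    proof -
      have ysne: "ys \<noteq> []" using ys3(1) by auto
      define others where "others = (\<Union>j\<in>I - {i}. cycle_arcs (L j))"
      have un: "(\<Union>j\<in>I. cycle_arcs (F j)) = cycle_arcs (F i) \<union> others" if "\<And>j. j \<noteq> i \<Longrightarrow> F j = L j" for F
      proof -
        have "(\<Union>j\<in>I - {i}. cycle_arcs (F j)) = others"
          unfolding others_def using that by (intro SUP_cong) auto
        then show ?thesis using i(1) by blast
      qed
      have "(u, v) \<notin> others" if "u \<in> set ys" for u v
      proof
        assume "(u, v) \<in> others"
        then obtain j where "j \<in> I" "j \<noteq> i" "(u, v) \<in> cycle_arcs (L j)" by (auto simp: others_def)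
        then show False
          using cycle_arcs_subset[of "L j"] cycle_family_ne[OF less.prems(1)] disj[of j] that by auto
      qed
      then have "?e \<notin> others" "(hd ys, last ys) \<notin> others" using ysne by auto
      then have arcs: "(cycle_arcs ys \<union> others) - {?e, (hd ys, last ys)} \<union>
          {(last ys, w), (w, last ys), (w, hd ys), (hd ys, w)} = cycle_arcs (ys @ [w]) \<union> others"
        unfolding cycle_arcs_snoc[OF ys3(2,1)] by blast
      have "parcs (cycle_union I L') = cycle_arcs ys \<union> others"
        "parcs (cycle_union I L) = cycle_arcs (ys @ [w]) \<union> others"
        using un[of L'] un[of L] Li by (auto simp: cycle_union_def L'_def)
      moreover have "pverts (cycle_union I L) = pverts (cycle_union I L') \<union> {w}"
      proof -
        have "(\<Union>j\<in>I. B j) = B i \<union> (\<Union>j\<in>I - {i}. B j)" for B :: "'a \<Rightarrow> 'b set"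
          using i(1) by blast
        note this[of "\<lambda>j. set (L j)"] this[of "\<lambda>j. set (L' j)"]
        moreover have "(\<Union>j\<in>I - {i}. set (L' j)) = (\<Union>j\<in>I - {i}. set (L j))"
          by (intro SUP_cong) (auto simp: L'_def)
        ultimately show ?thesis by (simp add: cycle_union_def L'_def Li)
      qed
      ultimately show ?thesis
        using arcs by (simp add: subdivide.simps)
    qed
    ultimately show ?thesis by simp
  qed
qed

lemma cycle_union_iso:
  assumes "cycle_family I K" "inj_on f (\<Union>i\<in>I. set (K i))"
  shows "digraph_iso (with_proj (cycle_union I K)) (with_proj (cycle_union I (\<lambda>i. map f (K i))))"
proof -
  interpret pair_bidirected_digraph "cycle_union I K" by (rule cycle_union_bidirected[OF assms(1)])
  let ?V = "\<Union>i\<in>I. set (K i)"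
  let ?hom = "\<lparr> iso_verts = f, iso_arcs = map_prod f f, iso_head = snd, iso_tail = fst \<rparr>"
  have sub: "parcs (cycle_union I K) \<subseteq> ?V \<times> ?V"
    using cycle_arcs_subset[OF cycle_family_ne[OF assms(1)]] by (fastforce simp: cycle_union_def)
  have "inj_on (map_prod f f) (?V \<times> ?V)" using assms(2) by (intro map_prod_inj_on)
  then have "inj_on (map_prod f f) (parcs (cycle_union I K))"
    using sub inj_on_subset by blast
  moreover have "wf_digraph (with_proj (cycle_union I K))" by (rule wf_digraph)
  ultimately have "digraph_isomorphism ?hom"
    using assms(2) unfolding digraph_isomorphism_def by (auto simp: cycle_union_def)
  moreover have "cycle_arcs (map f (K i)) = map_prod f f ` cycle_arcs (K i)" if "i \<in> I" for i
    using cycle_arcs_map cycle_family_ne[OF assms(1) that] by blast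
  then have "with_proj (cycle_union I (\<lambda>i. map f (K i))) = app_iso ?hom (with_proj (cycle_union I K))"
    by (auto simp: app_iso_def with_proj_def cycle_union_def image_UN)
  ultimately show ?thesis unfolding digraph_iso_def by blast
qed

lemma iso_cycle_graph:
  assumes iso: "digraph_iso (with_proj (cycle_graph m)) C" and m: "3 \<le> m"
    and ends: "tail C = fst" "head C = snd"
  obtains xs where "distinct xs" "length xs = m" "verts C = set xs" "arcs C = cycle_arcs xs"
proof -
  obtain g where g: "pre_digraph.digraph_isomorphism (with_proj (cycle_graph m)) g"
      "C = app_iso g (with_proj (cycle_graph m))"
    using iso by (auto simp: digraph_iso_def)
  let ?p = "iso_verts g"
  have inj: "inj_on ?p {..<m}"
    using g(1) by (auto simp: pre_digraph.digraph_isomorphism_def cycle_graph_def)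
  \<comment> \<open>Tails and heads in \<open>C\<close> are the projections, so the vertex map
    determines the arc map.\<close>
  have "iso_arcs g e = map_prod ?p ?p e" if "e \<in> parcs (cycle_graph m)" for e
  proof -
    have "?p (fst e) = iso_tail g (iso_arcs g e)" "?p (snd e) = iso_head g (iso_arcs g e)"
      using g(1) that by (auto simp: pre_digraph.digraph_isomorphism_def)
    moreover have "iso_tail g = fst" "iso_head g = snd" using ends g(2) by auto
    ultimately show ?thesis by (cases e) (auto intro: prod_eqI)
  qed
  then have "arcs C = map_prod ?p ?p ` parcs (cycle_graph m)"
    using g(2) by (auto simp: image_iff)
  also have "\<dots> = cycle_arcs (map ?p [0..<m])"
    using m by (simp add: cycle_graph_arcs cycle_arcs_map)
  finally have "arcs C = cycle_arcs (map ?p [0..<m])" .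
  moreover have "verts C = set (map ?p [0..<m])"
    using g(2) by (auto simp: cycle_graph_def)
  moreover have "distinct (map ?p [0..<m])"
    using inj by (simp add: distinct_map atLeast0LessThan)
  ultimately show thesis using that by force
qed

text \<open>In a symmetric digraph the strong components are the connected components: they are
  disjoint, induced, and contain every arc, so \<open>H\<close> is recovered from cyclic lists of
  their vertices.\<close>

lemma even_cycle_components:
  assumes "pair_graph H"
    and comps: "\<forall>C \<in> pre_digraph.sccs (with_proj H).
           \<exists>m. even m \<and> m \<ge> 6 \<and> digraph_iso (with_proj (cycle_graph m)) C"
  obtains K where "H = cycle_union (pre_digraph.sccs (with_proj H)) K"
    "cycle_family (pre_digraph.sccs (with_proj H)) K"
    "\<And>C. C \<in> pre_digraph.sccs (with_proj H) \<Longrightarrow> even (length (K C)) \<and> 6 \<le> length (K C)"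
proof -
  interpret pair_graph H by fact
  have ind: "induced_subgraph C (with_proj H)" if "C \<in> sccs" for C
    using in_sccs_imp_induced[OF that] .
  have "\<exists>xs. distinct xs \<and> even (length xs) \<and> 6 \<le> length xs \<and> verts C = set xs \<and> arcs C = cycle_arcs xs"
    if C: "C \<in> sccs" for C
  proof -
    obtain m where m: "even m" "m \<ge> 6" "digraph_iso (with_proj (cycle_graph m)) C" using comps C by blast
    have "tail C = fst" "head C = snd"
      using ind[OF C] by (auto simp: induced_subgraph_def subgraph_def compatible_def)
    moreover have "3 \<le> m" using m(2) by simp
    ultimately obtain xs where "distinct xs" "length xs = m" "verts C = set xs" "arcs C = cycle_arcs xs"
      using iso_cycle_graph[OF m(3)] by blast
    then show ?thesis using m(1,2) by blast
  qed
  then obtain K where K: "\<And>C. C \<in> sccs \<Longrightarrow> distinct (K C) \<and> even (length (K C)) \<and> 6 \<le> length (K C) \<and>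
      verts C = set (K C) \<and> arcs C = cycle_arcs (K C)"
    by metis
  have disj: "verts C \<inter> verts D = {}" if "C \<in> sccs" "D \<in> sccs" "C \<noteq> D" for C D
  proof -
    have "verts C \<noteq> verts D" using inj_on_verts_sccs that by (auto dest: inj_onD)
    then show ?thesis
      using sccs_verts_disjoint[of "verts C" "verts D"] that by (simp add: sccs_verts_conv)
  qed
  \<comment> \<open>By symmetry, the vertices reachable from \<open>u\<close> induce a strong
    component.\<close>
  have cover: "\<exists>C\<in>sccs. \<forall>v. u \<rightarrow>\<^sup>*\<^bsub>with_proj H\<^esub> v \<longrightarrow> v \<in> verts C" if "u \<in> pverts H" for u
    using induce_reachable_is_in_sccs[of u] that by (intro bexI) auto
  have verts: "pverts H = (\<Union>C\<in>sccs. set (K C))"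
  proof
    show "pverts H \<subseteq> (\<Union>C\<in>sccs. set (K C))"
    proof
      fix u assume u: "u \<in> pverts H"
      then have "u \<rightarrow>\<^sup>*\<^bsub>with_proj H\<^esub> u" by simp
      then show "u \<in> (\<Union>C\<in>sccs. set (K C))" using cover[OF u] K by blast
    qed
    have "set (K C) \<subseteq> pverts H" if "C \<in> sccs" for C
      using ind[OF that] K[OF that] by (simp add: induced_subgraph_def subgraph_def)
    then show "(\<Union>C\<in>sccs. set (K C)) \<subseteq> pverts H" by blast
  qed
  have arcs: "parcs H = (\<Union>C\<in>sccs. cycle_arcs (K C))"
  proof
    show "parcs H \<subseteq> (\<Union>C\<in>sccs. cycle_arcs (K C))"
    proof
      fix e assume e: "e \<in> parcs H"
      then have u: "fst e \<in> pverts H" by (cases e) (auto dest: wellformed')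
      obtain C where C: "C \<in> sccs" "\<And>v. fst e \<rightarrow>\<^sup>*\<^bsub>with_proj H\<^esub> v \<Longrightarrow> v \<in> verts C"
        using cover[OF u] by blast
      have "fst e \<rightarrow>\<^bsub>with_proj H\<^esub> snd e" using e by (simp add: arcs_ends_def arc_to_ends_def)
      then have "fst e \<in> verts C" "snd e \<in> verts C" using C(2) u by auto
      then have "e \<in> arcs C" using ind[OF C(1)] e by (simp add: induced_subgraph_def)
      then show "e \<in> (\<Union>C\<in>sccs. cycle_arcs (K C))" using K C(1) by blast
    qed
    have "cycle_arcs (K C) \<subseteq> parcs H" if "C \<in> sccs" for C
      using ind[OF that] K[OF that] by (simp add: induced_subgraph_def subgraph_def)
    then show "(\<Union>C\<in>sccs. cycle_arcs (K C)) \<subseteq> parcs H" by blast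
  qed
  have "H = cycle_union sccs K"
    using verts arcs by (simp add: cycle_union_def)
  moreover have "cycle_family sccs K"
    unfolding cycle_family_def
  proof (intro conjI ballI impI)
    show "distinct (K C)" "3 \<le> length (K C)" if "C \<in> sccs" for C using K[OF that] by auto
    show "set (K C) \<inter> set (K D) = {}" if "C \<in> sccs" "D \<in> sccs" "C \<noteq> D" for C D
      using disj[OF that] K[OF that(1)] K[OF that(2)] by simp
  qed
  ultimately show thesis using that K by blast
qed

lemma contains_subdivision_cycle_union:
  assumes "pair_graph G" and "finite I" and K: "cycle_family I K"
    and L: "\<And>i. i \<in> I \<Longrightarrow> gcycle (\<lambda>u v. (u, v) \<in> parcs G) (L i)"
      "\<And>i. i \<in> I \<Longrightarrow> length (K i) \<le> length (L i)"
      "\<And>i. i \<in> I \<Longrightarrow> set (L i) \<subseteq> pverts G"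
    and disj: "\<And>i j. i \<in> I \<Longrightarrow> j \<in> I \<Longrightarrow> i \<noteq> j \<Longrightarrow> set (L i) \<inter> set (L j) = {}"
  shows "contains_subdivision G (cycle_union I K)"
proof -
  interpret pair_graph G by fact
  \<comment> \<open>The first vertices of \<open>L i\<close> carry the copy of \<open>K i\<close>;
    the others are the subdividing vertices.\<close>
  define K' where "K' i = take (length (K i)) (L i)" for i
  define f where "f v = (let i = THE i. i \<in> I \<and> v \<in> set (K i) in the (map_of (zip (K i) (K' i)) v))" for v
  have len: "length (K' i) = length (K i)" if "i \<in> I" for i
    using L(2)[OF that] by (simp add: K'_def)
  have famL: "cycle_family I L"
    using L(1) disj by (auto simp: cycle_family_def gcycle_def gpath_def)
  have sub: "set (K' i) \<subseteq> set (L i)" for i by (simp add: K'_def set_take_subset)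
  have famK': "cycle_family I K'"
    unfolding cycle_family_def
  proof (intro conjI ballI impI)
    fix i assume i: "i \<in> I"
    then have "distinct (L i)" "3 \<le> length (K i)" using famL K by (auto simp: cycle_family_def)
    then show "distinct (K' i)" "3 \<le> length (K' i)" using len[OF i] by (auto simp: K'_def)
  next
    fix i j assume "i \<in> I" "j \<in> I" "i \<noteq> j"
    then show "set (K' i) \<inter> set (K' j) = {}" using disj[of i j] sub[of i] sub[of j] by blast
  qed
  have f: "map f (K i) = K' i" if i: "i \<in> I" for i
  proof (rule nth_equalityI)
    fix p assume "p < length (map f (K i))"
    then have p: "p < length (K i)" by simp
    have "(THE j. j \<in> I \<and> K i ! p \<in> set (K j)) = i"
    proof (rule the_equality)
      show "i \<in> I \<and> K i ! p \<in> set (K i)" using i p by simp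
      fix j assume "j \<in> I \<and> K i ! p \<in> set (K j)"
      moreover have "K i ! p \<in> set (K i)" using p by simp
      ultimately show "j = i" using K i unfolding cycle_family_def by blast
    qed
    moreover have "distinct (K i)" using K i by (simp add: cycle_family_def)
    ultimately show "map f (K i) ! p = K' i ! p"
      using p len[OF i] by (simp add: f_def map_of_zip_nth)
  qed (simp add: len[OF i])
  have "inj_on f (\<Union>i\<in>I. set (K i))"
  proof (rule inj_onI)
    fix u v assume "u \<in> (\<Union>i\<in>I. set (K i))" "v \<in> (\<Union>i\<in>I. set (K i))" and e: "f u = f v"
    then obtain i j where i: "i \<in> I" "u \<in> set (K i)" and j: "j \<in> I" "v \<in> set (K j)" by blast
    have "f u \<in> set (K' i)" "f v \<in> set (K' j)"
      unfolding f[OF i(1), symmetric] f[OF j(1), symmetric] using i(2) j(2) by auto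
    then have "i = j" using e famK' i(1) j(1) unfolding cycle_family_def by (metis disjoint_iff)
    have "distinct (map f (K i))" using f[OF i(1)] famK' i(1) by (simp add: cycle_family_def)
    then show "u = v" using e i(2) j(2) \<open>i = j\<close> by (simp add: distinct_map inj_on_def)
  qed
  from cycle_union_iso[OF K this]
  have iso: "digraph_iso (with_proj (cycle_union I K)) (with_proj (cycle_union I K'))"
    by (simp add: cycle_union_def f)
  have "\<exists>zs. L i = K' i @ zs" for i
    using append_take_drop_id[of "length (K i)" "L i"] unfolding K'_def by metis
  then have sd: "subdivision_pair (cycle_union I K') (cycle_union I L)"
    using cycle_union_subdivision[OF assms(2) famK' famL] by blast
  interpret L: pair_bidirected_digraph "cycle_union I L" by (rule cycle_union_bidirected[OF famL])
  have "cycle_arcs (L i) \<subseteq> parcs G" if "i \<in> I" for i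
  proof -
    have "successively (\<lambda>u v. (u, v) \<in> parcs G) (L i)" and e: "(last (L i), hd (L i)) \<in> parcs G"
      using L(1)[OF that] by (auto simp: gcycle_def gpath_def)
    then have "path_arcs (L i) \<subseteq> parcs G" by (auto simp: successively_path_arcs)
    then show ?thesis using e arcs_symmetric unfolding cycle_arcs_def by blast
  qed
  then have "subgraph (with_proj (cycle_union I L)) (with_proj G)"
    using L(3) L.wf_digraph wf_digraph
    by (intro subgraphI) (auto simp: cycle_union_def)
  then show ?thesis using iso sd unfolding contains_subdivision_def by blast
qed

theorem theorem3:
  fixes n k :: nat
    and H :: "'b pair_pre_digraph"
    and G :: "'a pair_pre_digraph"
    and X Y :: "'a set"
  assumes "n \<ge> 6" and "k \<ge> 1"
    and "pair_graph H"
    and "card (pverts H) = n"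
    and "card (pre_digraph.sccs (with_proj H)) = k"
    and "\<forall>C \<in> pre_digraph.sccs (with_proj H).
           \<exists>m. even m \<and> m \<ge> 6 \<and> digraph_iso (with_proj (cycle_graph m)) C"
    and "pair_graph G"
    and "bipartition G X Y"
    and "card X = card Y"
    and "real (card X) \<ge> real n / 2"
    and "real (min_degree G) \<ge> real n / 2 - real k + 1"
  shows "contains_subdivision G H"
proof -
  interpret G: pair_graph G by fact
  define I where "I = pre_digraph.sccs (with_proj H)"
  obtain K where H: "H = cycle_union I K" and fam: "cycle_family I K"
    and even: "\<And>C. C \<in> I \<Longrightarrow> even (length (K C)) \<and> 6 \<le> length (K C)"
    using even_cycle_components[OF assms(3,6)] unfolding I_def by blast
  \<comment> \<open>An infinite set has \<open>card\<close> 0, so \<open>k \<ge> 1\<close> makes the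
    set of components finite.\<close>
  have cardI: "card I = k" and finI: "finite I"
    using assms(2,5) card.infinite unfolding I_def by fastforce+
  define h where "h C = length (K C) div 2" for C
  have h: "length (K C) = 2 * h C" "3 \<le> h C" if "C \<in> I" for C
    using even[OF that] by (auto simp: h_def)
  have "n = (\<Sum>C\<in>I. card (set (K C)))"
    using assms(4) fam finI unfolding H
    by (simp add: cycle_union_def cycle_family_def card_UN_disjoint)
  also have "\<dots> = (\<Sum>C\<in>I. 2 * h C)"
    using fam h(1) by (intro sum.cong) (auto simp: cycle_family_def distinct_card)
  finally have n: "n = 2 * (\<Sum>C\<in>I. h C)" by (simp add: sum_distrib_left)
  define s where "s = (\<Sum>C\<in>I. h C - 1)"
  have "(\<Sum>C\<in>I. h C) = (\<Sum>C\<in>I. (h C - 1) + 1)"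
    using h(2) by (intro sum.cong) fastforce+
  also have "\<dots> = s + k"
    unfolding sum.distrib s_def by (simp add: cardI)
  \<comment> \<open>The minimum degree is thus at least \<open>1 + s\<close>, the bound in
    \<open>cycle_packing\<close>.\<close>
  finally have half: "real n / 2 = real s + real k" using n by simp
  define adj where "adj u v \<longleftrightarrow> (u, v) \<in> parcs G" for u v
  define c where "c v \<longleftrightarrow> v \<in> X" for v
  have bip: "X \<union> Y = pverts G" "X \<inter> Y = {}" "parcs G \<subseteq> X \<times> Y \<union> Y \<times> X"
    using assms(8) by (auto simp: bipartition_def)
  have "coloured_graph adj c"
    using bip G.arcs_symmetric by unfold_locales (auto simp: adj_def c_def)
  moreover have finV: "finite (pverts G)" by (rule G.pair_finite_verts)
  moreover have "u \<in> pverts G" if "adj u v" for u v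
    using that bip by (auto simp: adj_def)
  moreover have "card {v \<in> pverts G. c v = b} = card X" for b
  proof (cases b)
    case True
    then have "{v \<in> pverts G. c v = b} = X" using bip by (auto simp: c_def)
    then show ?thesis by simp
  next
    case False
    then have "{v \<in> pverts G. c v = b} = Y" using bip by (auto simp: c_def)
    then show ?thesis using assms(9) by simp
  qed
  moreover have "(\<Sum>C\<in>I. h C) \<le> card X" using assms(10) n by (simp flip: of_nat_sum)
  moreover have "1 + (\<Sum>C\<in>I. h C - 1) \<le> ndeg adj (pverts G) v" if v: "v \<in> pverts G" for v
  proof -
    have "out_arcs (with_proj G) v = Pair v ` {w \<in> pverts G. adj v w}"
      by (auto simp: out_arcs_def adj_def intro: G.in_arcsD2)
    then have "out_degree (with_proj G) v = ndeg adj (pverts G) v"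
      by (simp add: out_degree_def ndeg_def card_image inj_on_def)
    moreover have "min_degree G \<le> out_degree (with_proj G) v"
      unfolding min_degree_def using v finV by (intro Min_le) auto
    ultimately show ?thesis using assms(11) half unfolding s_def[symmetric] by linarith
  qed
  ultimately obtain S where S: "packs adj I h S" "\<forall>C\<in>I. S C \<subseteq> pverts G"
    using cycle_packing[of adj c "pverts G" I h "card X"] finI h(2) by blast
  have "\<forall>C\<in>I. \<exists>xs. gcycle adj xs \<and> set xs = S C"
    using S(1) by (simp add: packs_def hamiltonian_def)
  then obtain L where L: "\<And>C. C \<in> I \<Longrightarrow> gcycle adj (L C)" "\<And>C. C \<in> I \<Longrightarrow> set (L C) = S C"
    by metis
  show ?thesis
    unfolding H
  proof (rule contains_subdivision_cycle_union[OF assms(7) finI fam])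
    show "gcycle (\<lambda>u v. (u, v) \<in> parcs G) (L C)" if "C \<in> I" for C
      using L(1)[OF that] by (simp add: adj_def[abs_def])
    show "length (K C) \<le> length (L C)" if "C \<in> I" for C
    proof -
      have "2 * h C \<le> card (set (L C))" using S(1) L(2) that by (simp add: packs_def)
      then show ?thesis using card_length[of "L C"] h(1)[OF that] by simp
    qed
    show "set (L C) \<subseteq> pverts G" if "C \<in> I" for C
      using S(2) L(2) that by simp
    show "set (L C) \<inter> set (L D) = {}" if "C \<in> I" "D \<in> I" "C \<noteq> D" for C D
      using S(1) L(2) that by (simp add: packs_def)
  qed
qed

end
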